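(* Suppose that $\widehat{S} \subset \mathbb{R}^2$ is a compact surface with boundary that is the union of finitely many horizontal and vertical line segments, and that there is a diffeomorphism $H$ of $\widehat{S}$ onto a surface $S \subset \mathbb{R}^2$. Then for any C$^1$ vector field $\mathbf{F}$ on $S$, $$\int_{\partial S} \mathbf{F} \cdot d\mathbf{s} = \iint_{S} \operatorname{scurl} \mathbf{F} \, dA .$$
   Context: Here a diffeomorphism $H\colon\widehat{S}\to S$ means a continuous bijection of class C$^2$ (all second partial derivatives exist and are continuous) such that $\det DH$ is non-zero on $\widehat{S}$. A vector field $\mathbf{F}= \begin{pmatrix} M \\ N \end{pmatrix}\colon S\to\mathbb{R}^2$ is C$^1$ if it is differentiable on $S$ with continuous derivative. The scalar curl is $\operatorname{scurl}\begin{pmatrix} M \\ N\end{pmatrix}=\frac{\partial N}{\partial x}-\frac{\partial M}{\partial y}$. For a piecewise C$^1$ path $\phi\colon[a,b]\to S$, $\int_\phi\mathbf{F}\cdot d\mathbf{s}=\int_a^b\mathbf{F}(\phi(t))\cdot\phi'(t)\,dt$. The boundary $\partial S$ is given the orientation such that $S$ is always on the left, and $\int_{\partial S}\mathbf{F}\cdot d\mathbf{s}$ is the sum over the boundary components. A surface in $\mathbb{R}^2$ means a 2-dimensional (topological) submanifold with boundary; corners of the boundary are allowed. *)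

theory Defs
  imports "HOL-Analysis.Analysis"
begin

text \<open>
  Points of the plane are vectors in \<open>real ^ 2\<close>, with \<open>x $ 1\<close> and \<open>x $ 2\<close> the two coordinates.
\<close>

subsection \<open>Surfaces in the plane\<close>

definition half_plane :: "(real ^ 2) set" where
  "half_plane = {x. x $ 2 \<ge> 0}"

text \<open>
  A 2-dimensional topological manifold with boundary, in the subspace topology.
  Only homeomorphisms occur as charts, so corners of the boundary are allowed.
\<close>

definition surface_with_boundary :: "(real ^ 2) set \<Rightarrow> bool" where
  "surface_with_boundary S \<longleftrightarrow>
     (\<forall>p\<in>S. \<exists>U V. openin (top_of_set S) U \<and> p \<in> U \<and>
        openin (top_of_set half_plane) V \<and> U homeomorphic V)"

text \<open>The boundary in the sense of manifolds: the points without a chart onto an open set of the plane.\<close>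

definition surface_boundary :: "(real ^ 2) set \<Rightarrow> (real ^ 2) set" where
  "surface_boundary S =
     {p \<in> S. \<not> (\<exists>U V. openin (top_of_set S) U \<and> p \<in> U \<and>
        open (V :: (real ^ 2) set) \<and> U homeomorphic V)}"

definition axis_parallel_segment :: "(real ^ 2) set \<Rightarrow> bool" where
  "axis_parallel_segment L \<longleftrightarrow>
     (\<exists>p q. p \<noteq> q \<and> (p $ 1 = q $ 1 \<or> p $ 2 = q $ 2) \<and> L = closed_segment p q)"

definition rectilinear_boundary :: "(real ^ 2) set \<Rightarrow> bool" where
  "rectilinear_boundary S \<longleftrightarrow>
     (\<exists>\<L>. finite \<L> \<and> (\<forall>L\<in>\<L>. axis_parallel_segment L) \<and> surface_boundary S = \<Union>\<L>)"

subsection \<open>Diffeomorphisms\<close>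

text \<open>
  Partial derivatives of a map on a set \<open>S\<close> are taken along the slice of \<open>S\<close> through \<open>x\<close> in
  direction \<open>i\<close>; hence they are one-sided at boundary points where the slice ends. They are used
  only for surfaces with rectilinear boundary, where no slice has an isolated point, so that
  they are uniquely determined.
\<close>

definition slice :: "(real ^ 2) set \<Rightarrow> 2 \<Rightarrow> real ^ 2 \<Rightarrow> real set" where
  "slice S i x = {t. x + t *\<^sub>R axis i 1 \<in> S}"

definition has_partial_on :: "(real ^ 2) set \<Rightarrow> 2 \<Rightarrow> (real ^ 2 \<Rightarrow> real ^ 2) \<Rightarrow> bool" where
  "has_partial_on S i f \<longleftrightarrow>
     (\<forall>x\<in>S. (\<lambda>t. f (x + t *\<^sub>R axis i 1)) differentiable (at 0 within slice S i x))"

definition partial :: "(real ^ 2) set \<Rightarrow> 2 \<Rightarrow> (real ^ 2 \<Rightarrow> real ^ 2) \<Rightarrow> real ^ 2 \<Rightarrow> real ^ 2" where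
  "partial S i f x =
     vector_derivative (\<lambda>t. f (x + t *\<^sub>R axis i 1)) (at 0 within slice S i x)"

definition C2_on :: "(real ^ 2) set \<Rightarrow> (real ^ 2 \<Rightarrow> real ^ 2) \<Rightarrow> bool" where
  "C2_on S f \<longleftrightarrow>
     (\<forall>i. has_partial_on S i f) \<and>
     (\<forall>i j. has_partial_on S j (partial S i f)) \<and>
     (\<forall>i j. continuous_on S (partial S j (partial S i f)))"

definition jacobian :: "(real ^ 2) set \<Rightarrow> (real ^ 2 \<Rightarrow> real ^ 2) \<Rightarrow> real ^ 2 \<Rightarrow> real ^ 2 ^ 2" where
  "jacobian S f x = (\<chi> i j. partial S j f x $ i)"

definition diffeomorphism :: "(real ^ 2) set \<Rightarrow> (real ^ 2) set \<Rightarrow> (real ^ 2 \<Rightarrow> real ^ 2) \<Rightarrow> bool" where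
  "diffeomorphism R S H \<longleftrightarrow>
     continuous_on R H \<and> bij_betw H R S \<and> C2_on R H \<and> (\<forall>x\<in>R. det (jacobian R H x) \<noteq> 0)"

subsection \<open>Vector fields\<close>

text \<open>
  Derivatives of vector fields are Frechet derivatives relative to \<open>S\<close>, because the boundary of
  \<open>S\<close> may be curved and slices may degenerate to points there.
\<close>

definition derivative_matrix ::
  "(real ^ 2) set \<Rightarrow> (real ^ 2 \<Rightarrow> real ^ 2) \<Rightarrow> real ^ 2 \<Rightarrow> real ^ 2 ^ 2" where
  "derivative_matrix S F x = matrix (frechet_derivative F (at x within S))"

definition C1_vector_field :: "(real ^ 2) set \<Rightarrow> (real ^ 2 \<Rightarrow> real ^ 2) \<Rightarrow> bool" where
  "C1_vector_field S F \<longleftrightarrow> F differentiable_on S \<and> continuous_on S (derivative_matrix S F)"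

text \<open>
  The entry \<open>A $ i $ j\<close> of the derivative matrix is the partial derivative of the \<open>i\<close>-th component
  in the \<open>j\<close>-th variable.
\<close>

definition scurl :: "(real ^ 2) set \<Rightarrow> (real ^ 2 \<Rightarrow> real ^ 2) \<Rightarrow> real ^ 2 \<Rightarrow> real" where
  "scurl S F x = derivative_matrix S F x $ 2 $ 1 - derivative_matrix S F x $ 1 $ 2"

subsection \<open>Line integrals and the boundary integral\<close>

definition line_integral ::
  "(real ^ 2 \<Rightarrow> real ^ 2) \<Rightarrow> real \<Rightarrow> real \<Rightarrow> (real \<Rightarrow> real ^ 2) \<Rightarrow> real" where
  "line_integral F a b \<phi> = integral {a..b} (\<lambda>t. F (\<phi> t) \<bullet> vector_derivative \<phi> (at t))"

definition left_normal :: "real ^ 2 \<Rightarrow> real ^ 2" where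
  "left_normal v = vector [- (v $ 2), v $ 1]"

text \<open>
  \<open>S\<close> is on the left of the path: wherever there is a nonzero velocity, points slightly to the
  left of the path lie in \<open>S\<close> and points slightly to the right do not. Corners of the path and
  times with velocity zero impose no condition.
\<close>

definition on_left :: "(real ^ 2) set \<Rightarrow> real \<Rightarrow> real \<Rightarrow> (real \<Rightarrow> real ^ 2) \<Rightarrow> bool" where
  "on_left S a b \<phi> \<longleftrightarrow>
     (\<forall>t\<in>{a<..<b}. \<forall>v. (\<phi> has_vector_derivative v) (at t) \<and> v \<noteq> 0 \<longrightarrow>
        (\<exists>\<epsilon>>0. \<forall>s\<in>{0<..<\<epsilon>}.
           \<phi> t + s *\<^sub>R left_normal v \<in> S \<and> \<phi> t - s *\<^sub>R left_normal v \<notin> S))"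

definition oriented_parametrization ::
  "(real ^ 2) set \<Rightarrow> (real ^ 2) set \<Rightarrow> real \<Rightarrow> real \<Rightarrow> (real \<Rightarrow> real ^ 2) \<Rightarrow> bool" where
  "oriented_parametrization S C a b \<phi> \<longleftrightarrow>
     a < b \<and> \<phi> piecewise_C1_differentiable_on {a..b} \<and>
     \<phi> a = \<phi> b \<and> inj_on \<phi> {a..<b} \<and> \<phi> ` {a..b} = C \<and> on_left S a b \<phi>"

text \<open>
  \<open>has_boundary_integral S F I\<close> says that the integral of \<open>F\<close> over the oriented boundary of \<open>S\<close> is
  well defined and equals \<open>I\<close>: there are finitely many boundary components, each of them has an
  oriented piecewise C1 parametrization, and for every choice of such parametrizations the line
  integrals sum up to \<open>I\<close>.
\<close>

definition has_boundary_integral ::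
  "(real ^ 2) set \<Rightarrow> (real ^ 2 \<Rightarrow> real ^ 2) \<Rightarrow> real \<Rightarrow> bool" where
  "has_boundary_integral S F I \<longleftrightarrow>
     finite (components (surface_boundary S)) \<and>
     (\<forall>C\<in>components (surface_boundary S). \<exists>a b \<phi>. oriented_parametrization S C a b \<phi>) \<and>
     (\<forall>a b \<phi>.
        (\<forall>C\<in>components (surface_boundary S). oriented_parametrization S C (a C) (b C) (\<phi> C)) \<longrightarrow>
        (\<Sum>C\<in>components (surface_boundary S). line_integral F (a C) (b C) (\<phi> C)) = I)"

end

theory Submission
  imports Defs
begin

text \<open>
  The idea is to pull the line integral and the area integral back to \<open>R\<close>, where Green's formula is
  Fubini's theorem and the fundamental theorem of calculus on rectangles.

  By invariance of domain the boundary of a surface in the plane is the set of its points that are not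
  interior, and \<open>H\<close> maps boundary to boundary. Choose a grid whose lines contain
  the finitely many boundary segments of \<open>R\<close>. The open cells of this grid do not meet the boundary,
  so \<open>R\<close> is a finite union of closed cells (\<open>surface_region_exists\<close>). Two cells that touch only
  in a common corner are never all of \<open>R\<close> near that corner, because a surface is not cut by one of its
  points.

  Nearby points of \<open>R\<close> lie in a common cell. Hence a map with continuous second partial derivatives in
  the sense of slices has a Frechet derivative relative to \<open>R\<close>, given by the Jacobian matrix. The
  pullback of \<open>F \<bullet> ds\<close> has the components \<open>F (H x) \<bullet> \<partial>\<^sub>k H x\<close>, and its
  scalar curl is \<open>det (DH)\<close> times the scalar curl of \<open>F\<close> at \<open>H x\<close>, by symmetry of the
  mixed second partial derivatives. The sign of \<open>det (DH)\<close> is constant on each cell and is put into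
  the pullback, so that the change of variables formula for the absolute value of the determinant applies.
  Integrating over each cell and summing by parts leaves one integral for each grid edge on the boundary
  (\<open>scurl_has_integral\<close>).

  It remains to see that the line integrals along the components of the boundary of \<open>S\<close>, in any
  oriented parametrizations, add up to the same sum. The times at which a parametrization \<open>\<phi>\<close> runs
  through the image of a given edge form an open set up to finitely many points, on which the pulled back
  path moves in one coordinate only. Since \<open>\<phi>\<close> is injective, the one-dimensional change of variables
  formula evaluates the integral over these times, provided that the sign of the velocity is known. This
  sign is read off, at each time with nonzero velocity, from the condition that \<open>S\<close> is on the left:
  near the image of a point of an edge, \<open>S\<close> contains a cone around each inward direction and misses each
  outward direction (\<open>inward_in_S\<close>, \<open>outward_not_in_S\<close>, \<open>edge_line_integral\<close>).

  Oriented parametrizations exist because from every boundary node of the grid exactly one boundary edge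
  leaves with \<open>R\<close> on its left, and exactly one arrives. So the successor map is a permutation of the
  boundary nodes; its cycles are closed polygons, and their images are the components of the boundary
  of \<open>S\<close>. The polygons are traversed with velocity zero at the nodes, so that corners impose no
  condition on the orientation (\<open>component_parametrization\<close>).
\<close>

section \<open>Boundary and interior of plane surfaces\<close>

lemma homeomorphic_open_imp_open:
  fixes U V :: "(real ^ 2) set"
  assumes "U homeomorphic V" "open V"
  shows "open U"
proof -
  obtain f h where "homeomorphism U V f h"
    using assms(1) homeomorphic_def by blast
  then have "continuous_on V h" "inj_on h V" "h ` V = U"
    unfolding homeomorphism_def inj_on_def by auto
  then show ?thesis
    using invariance_of_domain assms(2) by blast
qed

text \<open>By invariance of domain, a chart onto an open set of the plane exists exactly at the interior points.\<close>
lemma surface_boundary_eq: "surface_boundary S = S - interior S"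
proof -
  have "p \<in> interior S" if "openin (top_of_set S) U" "p \<in> U" "open V" "U homeomorphic V" for p U and V :: "(real ^ 2) set"
    using interior_maximal[OF openin_imp_subset[OF that(1)] homeomorphic_open_imp_open[OF that(4,3)]] that(2) by blast
  moreover have "\<exists>U V. openin (top_of_set S) U \<and> p \<in> U \<and> open (V :: (real ^ 2) set) \<and> U homeomorphic V"
    if "p \<in> interior S" for p
    using that by (intro exI[of _ "interior S"])
      (auto simp: homeomorphic_refl intro: open_subset[OF interior_subset open_interior])
  ultimately show ?thesis
    unfolding surface_boundary_def by blast
qed

lemma homeomorphism_image_interior:
  fixes R S :: "(real ^ 2) set"
  assumes "homeomorphism R S H K"
  shows "H ` interior R = interior S"
proof
  have *: "h ` interior A \<subseteq> interior B" if "homeomorphism A B h k" for A B :: "(real ^ 2) set" and h k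
  proof (rule interior_maximal)
    have "continuous_on (interior A) h" "inj_on h (interior A)"
      using that interior_subset[of A]
      by (auto simp: homeomorphism_def inj_on_def intro: continuous_on_subset) (metis subset_iff)
    then show "open (h ` interior A)" by (intro invariance_of_domain) auto
    show "h ` interior A \<subseteq> B" using that interior_subset[of A] by (auto simp: homeomorphism_def)
  qed
  show "H ` interior R \<subseteq> interior S" using *[OF assms] .
  have "K ` interior S \<subseteq> interior R" using * assms homeomorphism_sym by blast
  moreover have "H (K y) = y" if "y \<in> interior S" for y
    using that assms interior_subset[of S] by (auto simp: homeomorphism_def)
  ultimately show "interior S \<subseteq> H ` interior R" by (metis image_eqI image_subset_iff subsetI)
qed

lemma homeomorphism_image_surface_boundary:
  assumes "homeomorphism R S H K"
  shows "H ` surface_boundary R = surface_boundary S"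
proof -
  have "inj_on H R" "H ` R = S" using assms by (auto simp: homeomorphism_def inj_on_def) metis
  then show ?thesis
    unfolding surface_boundary_eq homeomorphism_image_interior[OF assms, symmetric]
    by (metis Diff_subset inj_on_image_set_diff interior_subset)
qed

text \<open>Points of the half-plane are limits of points of the open half-plane, and a chart carries the latter to
  interior points.\<close>
lemma surface_subset_closure_interior:
  assumes "surface_with_boundary R"
  shows "R \<subseteq> closure (interior R)"
proof
  fix p assume "p \<in> R"
  obtain U V where U: "openin (top_of_set R) U" "p \<in> U" "openin (top_of_set half_plane) V" "U homeomorphic V"
    using assms \<open>p \<in> R\<close> unfolding surface_with_boundary_def by blast
  obtain f h where fh: "homeomorphism U V f h" using U homeomorphic_def by blast
  obtain W where W: "open W" "V = half_plane \<inter> W" using U(3) by (metis openin_open)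
  have "f p \<in> V" using fh U by (auto simp: homeomorphism_def)
  define q where "q n = f p + (1 / real (Suc n)) *\<^sub>R (axis 2 1 :: real^2)" for n
  have qlim: "q \<longlonglongrightarrow> f p"
  proof -
    have "q \<longlonglongrightarrow> f p + 0 *\<^sub>R (axis 2 1 :: real^2)"
      unfolding q_def by (intro tendsto_intros LIMSEQ_Suc lim_1_over_n)
    then show ?thesis by simp
  qed
  have qpos: "q n $ 2 > 0" for n
    using \<open>f p \<in> V\<close> W by (auto simp: q_def half_plane_def axis_def add_nonneg_pos)
  have ev: "\<forall>\<^sub>F n in sequentially. q n \<in> W"
    using qlim W \<open>f p \<in> V\<close> by (auto dest: topological_tendstoD)
  have "continuous_on V h" "h (f p) = p" using fh U by (auto simp: homeomorphism_def)
  then have "((\<lambda>n. h (q n)) \<longlonglongrightarrow> p)"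
  proof -
    have "\<forall>\<^sub>F n in sequentially. q n \<in> V"
      using ev by eventually_elim (use qpos W in \<open>auto simp: half_plane_def less_imp_le\<close>)
    from continuous_on_tendsto_compose[OF \<open>continuous_on V h\<close> qlim \<open>f p \<in> V\<close> this]
    show ?thesis using \<open>h (f p) = p\<close> by simp
  qed
  moreover have "\<forall>\<^sub>F n in sequentially. h (q n) \<in> interior R"
    using ev
  proof eventually_elim
    case (elim n)
    define V' where "V' = W \<inter> {x. x $ 2 > 0}"
    have V': "open V'" "V' \<subseteq> V" "q n \<in> V'"
      using W elim qpos by (auto simp: V'_def half_plane_def intro!: open_Int open_halfspace_component_gt_cart)
    have "open (h ` V')"
    proof (rule invariance_of_domain)
      show "continuous_on V' h" using \<open>continuous_on V h\<close> V'(2) continuous_on_subset by blast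
      show "inj_on h V'"
        using fh V'(2) by (intro inj_on_inverseI[of _ f]) (auto simp: homeomorphism_def)
    qed fact
    moreover have "h ` V' \<subseteq> R"
      using homeomorphism_image2[OF fh] V'(2) openin_imp_subset[OF U(1)] by blast
    ultimately show ?case using V' interior_maximal by blast
  qed
  ultimately show "p \<in> closure (interior R)"
    using closure_subset[of "interior R"]
    by (intro Lim_in_closed_set[of "closure (interior R)" "\<lambda>n. h (q n)" sequentially p])
      (auto elim!: eventually_mono)
qed

text \<open>A small half-disc stays connected when one point is removed, so a surface is not cut by one of its
  points, not even locally. This excludes, for instance, two opposite quadrants.\<close>
lemma surface_not_locally_cut:
  assumes "surface_with_boundary R" "p \<in> R" "open N" "p \<in> N" and "open A" "open B" "A \<inter> B = {}"
    and cut: "R \<inter> N - {p} \<subseteq> A \<union> B"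
    and A: "p \<in> closure (R \<inter> A)" and B: "p \<in> closure (R \<inter> B)"
  shows False
proof -
  obtain U V where U: "openin (top_of_set R) U" "p \<in> U" "openin (top_of_set half_plane) V" "U homeomorphic V"
    using assms(1,2) unfolding surface_with_boundary_def by blast
  obtain f h where fh: "homeomorphism U V f h" using U homeomorphic_def by blast
  have h: "continuous_on V h" "h (f p) = p" "f p \<in> V" "continuous_on U f" 
    and inv: "\<And>x. x \<in> U \<Longrightarrow> h (f x) = x" "\<And>y. y \<in> V \<Longrightarrow> f (h y) = y" "h ` V = U" "f ` U = V"
    using fh U by (auto simp: homeomorphism_def)
  have "openin (top_of_set V) (V \<inter> h -` N)" 
    using h(1) assms(3) continuous_openin_preimage_gen by blast
  then have "openin (top_of_set half_plane) (V \<inter> h -` N)" using U(3) openin_trans by blast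
  then obtain W where W: "open W" "V \<inter> h -` N = half_plane \<inter> W" by (metis openin_open)
  have "f p \<in> half_plane \<inter> W" using W h assms(4) by blast
  then obtain e where e: "e > 0" "ball (f p) e \<subseteq> W" using W(1) open_contains_ball by blast
  define D where "D = half_plane \<inter> ball (f p) e"
  have DV: "D \<subseteq> V" and DN: "h ` D \<subseteq> N" using W(2) e(2) by (auto simp: D_def)
  have conv: "convex D" unfolding D_def half_plane_def
    by (intro convex_Int convex_ball) (simp add: convex_def algebra_simps)
  have fpD: "f p \<in> D" using \<open>f p \<in> half_plane \<inter> W\<close> e by (auto simp: D_def)
  have "\<not> collinear D"
  proof -
    define q where "q = f p + (e/2) *\<^sub>R (axis 2 1 :: real^2)"
    have "q \<in> interior D"
    proof -
      have "open ({x::real^2. x $ 2 > 0} \<inter> ball (f p) e)"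
        by (intro open_Int open_halfspace_component_gt_cart open_ball)
      moreover have "q \<in> {x. x $ 2 > 0} \<inter> ball (f p) e"
        using e fpD by (auto simp: q_def D_def half_plane_def add_nonneg_pos dist_norm axis_nth)
      moreover have "{x::real^2. x $ 2 > 0} \<inter> ball (f p) e \<subseteq> D" by (auto simp: D_def half_plane_def)
      ultimately show ?thesis using interior_maximal by blast
    qed
    then have "aff_dim D = 2" using aff_dim_nonempty_interior[of D] by auto
    then show ?thesis by (simp add: collinear_aff_dim)
  qed
  then have "connected (D - {f p})" using connected_convex_diff_countable[OF conv, of "{f p}"] by auto
  then have con: "connected (h ` (D - {f p}))" 
    using h(1) DV by (metis Diff_subset connected_continuous_image continuous_on_subset order_trans)
  have "openin (top_of_set half_plane) D" unfolding D_def using openin_open by blast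
  then have "openin (top_of_set V) D" using DV openin_imp_subset[OF U(3)] by (metis openin_subset_trans)
  then have "openin (top_of_set U) (U \<inter> f -` D)"
    using h(4) inv(4) continuous_openin_preimage by (metis Pi_iff image_subset_iff order_refl)
  moreover have hD: "U \<inter> f -` D = h ` D" using inv DV by (auto simp: subset_iff image_iff, (metis)?)
  ultimately have "openin (top_of_set R) (h ` D)" using U(1) openin_trans by metis
  then obtain O' where O': "open O'" "h ` D = R \<inter> O'" by (metis openin_open)
  have pO: "p \<in> O'" using O'(2) h(2) fpD by (metis IntD2 image_eqI)
  have hDp: "h ` (D - {f p}) = h ` D - {p}" using inv h DV fpD by (auto simp: subset_iff, (metis)?)
  have ne: "A \<inter> h ` (D - {f p}) \<noteq> {}" if "p \<in> closure (R \<inter> A)" "p \<notin> A" for A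
  proof -
    have "O' \<inter> (R \<inter> A) \<noteq> {}" using open_Int_closure_eq_empty[OF O'(1), of "R \<inter> A"] pO that(1) by blast
    then show ?thesis using that(2) unfolding hDp O'(2) by blast
  qed
  have "h ` (D - {f p}) \<subseteq> A \<union> B" using cut DN O'(2) hDp by blast
  moreover have pA: "p \<notin> A" using open_Int_closure_eq_empty[OF assms(5), of "R \<inter> B"] B assms(7) by blast
  moreover have pB: "p \<notin> B" using open_Int_closure_eq_empty[OF assms(6), of "R \<inter> A"] A assms(7) by blast
  ultimately show False
    using con ne[OF A pA] ne[OF B pB] assms(5-7) unfolding connected_def by blast
qed

section \<open>Coordinates\<close>

definition oth :: "2 \<Rightarrow> 2" where
  "oth k = (if k = 1 then 2 else 1)"

lemma oth_simps [simp]: "oth 1 = 2" "oth 2 = 1" "oth (oth k) = k" "oth k \<noteq> k" "k \<noteq> oth k"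
  using exhaust_2[of k] by (auto simp: oth_def)

lemma all_coords: "(\<forall>m. P m) \<longleftrightarrow> P k \<and> P (oth k)"
  using exhaust_2[of k] by (elim disjE) (auto simp only: forall_2 oth_simps)

lemma neq_iff_oth: "m \<noteq> k \<longleftrightarrow> m = oth k"
  using exhaust_2[of k] exhaust_2[of m] unfolding oth_def by (elim disjE) simp_all

lemma vec_eq_coords: "x = (y :: 'a ^ 2) \<longleftrightarrow> x $ k = y $ k \<and> x $ oth k = y $ oth k"
  unfolding vec_eq_iff using all_coords[of "\<lambda>m. x $ m = y $ m" k] .

text \<open>The point with coordinate \<open>s\<close> in direction \<open>k\<close> and \<open>t\<close> in the other direction. With
  this notation both coordinate directions are treated by the same lemmas.\<close>
definition crd :: "2 \<Rightarrow> real \<Rightarrow> real \<Rightarrow> real ^ 2" where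
  "crd k s t = (\<chi> m. if m = k then s else t)"

lemma crd_nth [simp]: "crd k s t $ k = s" "crd k s t $ oth k = t"
  by (auto simp: crd_def)

lemma crd_eqI: "x $ k = s \<Longrightarrow> x $ oth k = t \<Longrightarrow> crd k s t = x"
  by (simp add: vec_eq_coords[of _ _ k])

lemma crd_swap: "crd (oth k) t s = crd k s t"
  by (rule crd_eqI) auto

lemma axis_nth_eq: "axis k (c :: 'a::zero) $ m = (if m = k then c else 0)"
  by (simp add: axis_def)

lemma axis_oth [simp]: "axis k (c :: 'a::zero) $ oth k = 0" "axis (oth k) c $ k = 0"
  by (simp_all add: axis_nth_eq)

section \<open>Grids\<close>

text \<open>The grid lines are indexed by all integers and fill the whole plane, so that there are no outermost cells
  that need separate treatment. The cell \<open>z\<close> lies between the lines \<open>z $ k\<close> and \<open>z $ k + 1\<close>.\<close>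
locale grid =
  fixes g :: "2 \<Rightarrow> int \<Rightarrow> real"
  assumes g_less_iff [simp]: "g k i < g k j \<longleftrightarrow> i < j"
    and g_cover: "\<exists>i. g k i \<le> x \<and> x < g k (i + 1)"
begin

lemma g_le_iff [simp]: "g k i \<le> g k j \<longleftrightarrow> i \<le> j"
  by (metis g_less_iff linorder_not_less)

lemma g_eq_iff [simp]: "g k i = g k j \<longleftrightarrow> i = j"
  by (metis g_le_iff order_antisym order_refl)

lemma between_unique:
  assumes "g k i < x" "x < g k (i + 1)"
  shows "g k j \<le> x \<and> x \<le> g k (j + 1) \<longleftrightarrow> j = i"
proof -
  have "j \<le> i \<and> i \<le> j" if "g k j \<le> x" "x \<le> g k (j + 1)"
    using that assms g_less_iff[of k j "i + 1"] g_less_iff[of k i "j + 1"] by linarith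
  then show ?thesis using assms by auto
qed

lemma at_node: "g k j \<le> g k i \<and> g k i \<le> g k (j + 1) \<longleftrightarrow> j = i \<or> j = i - 1"
  by auto

lemma interval_stable:
  "\<exists>e>0. \<forall>t i. \<bar>t - x\<bar> < e \<and> g k i \<le> t \<and> t \<le> g k (i + 1) \<longrightarrow> g k i \<le> x \<and> x \<le> g k (i + 1)"
proof -
  obtain j where j: "g k j \<le> x" "x < g k (j + 1)" using g_cover by blast
  define l where "l = (if x = g k j then j - 1 else j)"
  have l: "g k l < x" using j by (auto simp: l_def)
  show ?thesis
  proof (intro exI[of _ "min (x - g k l) (g k (j + 1) - x)"] conjI allI impI, goal_cases)
    case 1
    then show ?case using l j by simp
  next
    case (2 t i)
    then have "g k i < g k (j + 1)" "g k l < g k (i + 1)" by linarith+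
    then have "l \<le> i" "i \<le> j" by auto
    then have "i = j \<or> (x = g k j \<and> i = j - 1)" by (auto simp: l_def split: if_splits)
    then show ?case using j by auto
  next
    case (3 t i)
    then have "g k i < g k (j + 1)" "g k l < g k (i + 1)" by linarith+
    then have "l \<le> i" "i \<le> j" by auto
    then have "i = j \<or> (x = g k j \<and> i = j - 1)" by (auto simp: l_def split: if_splits)
    then show ?case using j by auto
  qed
qed

definition node :: "int ^ 2 \<Rightarrow> real ^ 2" where
  "node z = (\<chi> k. g k (z $ k))"

definition cell :: "int ^ 2 \<Rightarrow> (real ^ 2) set" where
  "cell z = box (node z) (node (z + 1))"

definition ccell :: "int ^ 2 \<Rightarrow> (real ^ 2) set" where
  "ccell z = cbox (node z) (node (z + 1))"

text \<open>The open edge that starts at \<open>node z\<close> in direction \<open>k\<close>. Its adjacent cells are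
  \<open>z\<close> and \<open>z - axis (oth k) 1\<close>.\<close>
definition edge :: "int ^ 2 \<Rightarrow> 2 \<Rightarrow> (real ^ 2) set" where
  "edge z k = {x. g k (z $ k) < x $ k \<and> x $ k < g k (z $ k + 1) \<and> x $ oth k = g (oth k) (z $ oth k)}"

lemma node_nth [simp]: "node z $ k = g k (z $ k)"
  by (simp add: node_def)

lemma node_eq_iff [simp]: "node z = node w \<longleftrightarrow> z = w"
  by (simp add: vec_eq_iff)

lemma mem_cell: "x \<in> cell z \<longleftrightarrow> (\<forall>k. g k (z $ k) < x $ k \<and> x $ k < g k (z $ k + 1))"
  by (simp add: cell_def mem_box_cart)

lemma mem_ccell: "x \<in> ccell z \<longleftrightarrow> (\<forall>k. g k (z $ k) \<le> x $ k \<and> x $ k \<le> g k (z $ k + 1))"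
  by (simp add: ccell_def mem_box_cart)

lemma cell_nonempty: "cell z \<noteq> {}"
  by (simp add: cell_def interval_ne_empty_cart)

lemma cell_subset: "cell z \<subseteq> ccell z"
  by (auto simp: mem_cell mem_ccell less_imp_le)

lemma closure_cell: "closure (cell z) = ccell z"
  using cell_nonempty by (simp add: cell_def ccell_def closure_box)

lemma cell_ccell: "x \<in> cell z \<Longrightarrow> x \<in> ccell w \<longleftrightarrow> w = z"
  unfolding mem_cell mem_ccell vec_eq_iff using between_unique by blast

lemma edge_ccell:
  assumes "x \<in> edge z k"
  shows "x \<in> ccell w \<longleftrightarrow> w = z \<or> w = z - axis (oth k) 1"
proof -
  have "x \<in> ccell w \<longleftrightarrow> w $ k = z $ k \<and> (w $ oth k = z $ oth k \<or> w $ oth k = z $ oth k - 1)"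
    unfolding mem_ccell all_coords[of _ k]
    using assms between_unique[of k "z $ k" "x $ k" "w $ k"] by (auto simp: edge_def)
  then show ?thesis by (auto simp: vec_eq_coords[of _ _ k])
qed

lemma node_ccell: "node v \<in> ccell w \<longleftrightarrow> (\<forall>k. w $ k = v $ k \<or> w $ k = v $ k - 1)"
  by (simp only: mem_ccell node_nth at_node)

lemma point_cases:
  obtains z where "x \<in> cell z" | z k where "x \<in> edge z k" | z where "x = node z"
proof -
  obtain i where i: "\<And>k. g k (i k) \<le> x $ k \<and> x $ k < g k (i k + 1)"
    using choice[of "\<lambda>k i. g k i \<le> x $ k \<and> x $ k < g k (i + 1)"] g_cover by blast
  define z :: "int ^ 2" where "z = (\<chi> k. i k)"
  have z: "g k (z $ k) \<le> x $ k" "x $ k < g k (z $ k + 1)" for k using i by (auto simp: z_def)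
  consider "\<forall>k. g k (z $ k) \<noteq> x $ k" | "\<forall>k. g k (z $ k) = x $ k" 
    | k where "g k (z $ k) \<noteq> x $ k" "g (oth k) (z $ oth k) = x $ oth k"
    using all_coords[of "\<lambda>k. g k (z $ k) = x $ k" 1] all_coords[of "\<lambda>k. g k (z $ k) \<noteq> x $ k" 1] oth_simps by metis
  then show thesis
  proof cases
    case 1
    then show ?thesis using that(1)[of z] z by (auto simp: mem_cell order.not_eq_order_implies_strict)
  next
    case 2
    then show ?thesis using that(3)[of z] by (simp add: vec_eq_iff)
  next
    case 3
    then show ?thesis using that(2)[of z k] z[of k] by (auto simp: edge_def)
  qed
qed

lemma in_some_ccell: obtains z where "x \<in> ccell z"
proof -
  obtain i where i: "\<And>k. g k (i k) \<le> x $ k \<and> x $ k < g k (i k + 1)"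
    using choice[of "\<lambda>k i. g k i \<le> x $ k \<and> x $ k < g k (i + 1)"] g_cover by blast
  then have "x \<in> ccell (\<chi> k. i k)" by (auto simp: mem_ccell less_imp_le)
  then show thesis using that by blast
qed

text \<open>Each coordinate of \<open>p\<close> has positive distance from the grid lines on which \<open>p\<close> does not lie,
  so only cells that contain \<open>p\<close> come close to \<open>p\<close>.\<close>
lemma ccell_local:
  obtains e where "e > 0" "\<And>q z. dist q p < e \<Longrightarrow> q \<in> ccell z \<Longrightarrow> p \<in> ccell z"
proof -
  have "\<exists>e. \<forall>k. e k > 0 \<and> (\<forall>t i. \<bar>t - p $ k\<bar> < e k \<and> g k i \<le> t \<and> t \<le> g k (i + 1) \<longrightarrow> g k i \<le> p $ k \<and> p $ k \<le> g k (i + 1))"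
    using interval_stable by (intro choice) blast
  then obtain e where e: "\<And>k. e k > 0"
    "\<And>k t i. \<bar>t - p $ k\<bar> < e k \<Longrightarrow> g k i \<le> t \<Longrightarrow> t \<le> g k (i + 1) \<Longrightarrow> g k i \<le> p $ k \<and> p $ k \<le> g k (i + 1)"
    by metis
  have "p \<in> ccell z" if "dist q p < Min (range e)" "q \<in> ccell z" for q z
  proof -
    have "g k (z $ k) \<le> p $ k \<and> p $ k \<le> g k (z $ k + 1)" for k
    proof -
      have "\<bar>q $ k - p $ k\<bar> \<le> dist q p"
        using component_le_norm_cart[of "q - p" k] by (simp add: dist_norm)
      moreover have "Min (range e) \<le> e k" by simp
      ultimately have "\<bar>q $ k - p $ k\<bar> < e k" using that by linarith
      then show ?thesis using e(2) that(2) by (simp add: mem_ccell)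
    qed
    then show ?thesis by (simp add: mem_ccell)
  qed
  moreover have "Min (range e) > 0" using e by simp
  ultimately show thesis using that by blast
qed

end

text \<open>A further point is inserted between two consecutive ones by shifting the indices above it.\<close>
lemma grid_through:
  assumes "finite X"
  shows "\<exists>h :: int \<Rightarrow> real. strict_mono h \<and> (\<forall>x. \<exists>i. h i \<le> x \<and> x < h (i + 1)) \<and> X \<subseteq> range h"
  using assms
proof induction
  case empty
  have "strict_mono real_of_int" by (simp add: strict_mono_def)
  moreover have "\<exists>i. real_of_int i \<le> x \<and> x < real_of_int (i + 1)" for x
    by (rule exI[of _ "\<lfloor>x\<rfloor>"]) linarith
  ultimately show ?case by blast
next
  case (insert a X)
  then obtain h :: "int \<Rightarrow> real" where h: "strict_mono h" "\<And>x. \<exists>i. h i \<le> x \<and> x < h (i + 1)" "X \<subseteq> range h" by auto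
  show ?case
  proof (cases "a \<in> range h")
    case True
    then show ?thesis using h by blast
  next
    case False
    obtain j where j: "h j \<le> a" "a < h (j + 1)" using h(2) by blast
    with False have j': "h j < a" by (metis order_le_less rangeI)
    define h' where "h' i = (if i \<le> j then h i else if i = j + 1 then a else h (i - 1))" for i
    have hl: "h i < h i' \<longleftrightarrow> i < i'" for i i' using h(1) by (simp add: strict_mono_less)
    have hle: "h i \<le> h i' \<longleftrightarrow> i \<le> i'" for i i' using h(1) by (simp add: strict_mono_less_eq)
    have "h' i < h' i'" if "i < i'" for i i'
    proof -
      have "h i < a" if "i \<le> j" for i using that j' hle[of i j] by linarith
      moreover have "a < h i" if "j < i" for i using that j hle[of "j + 1" i] by linarith
      ultimately show ?thesis using \<open>i < i'\<close> by (auto simp: h'_def hl) 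
    qed
    then have "strict_mono h'" by (simp add: strict_mono_def)
    moreover have "\<exists>i. h' i \<le> x \<and> x < h' (i + 1)" for x
    proof -
      obtain i where i: "h i \<le> x" "x < h (i + 1)" using h(2) by blast
      consider "i < j" | "i = j" "x < a" | "i = j" "a \<le> x" | "i > j" by linarith
      then show ?thesis
      proof cases
        case 1 then show ?thesis using i by (intro exI[of _ i]) (auto simp: h'_def)
      next
        case 2 then show ?thesis using i by (intro exI[of _ i]) (auto simp: h'_def)
      next
        case 3 then show ?thesis using i by (intro exI[of _ "i + 1"]) (auto simp: h'_def add.commute)
      next
        case 4 then show ?thesis using i by (intro exI[of _ "i + 1"]) (auto simp: h'_def add.commute)
      qed
    qed
    moreover have "insert a X \<subseteq> range h'"
    proof -
      have "h i = (if i \<le> j then h' i else h' (i + 1))" for i by (auto simp: h'_def)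
      then have "h i \<in> range h'" for i by auto
      moreover have "a = h' (j + 1)" by (simp add: h'_def)
      ultimately show ?thesis using h(3) by auto
    qed
    ultimately show ?thesis by blast
  qed
qed

lemma finite_int_box: "finite {z :: int ^ 2. \<forall>k. a k \<le> z $ k \<and> z $ k \<le> b k}"
proof (rule finite_imageD)
  show "inj_on (\<lambda>z :: int ^ 2. (z $ 1, z $ 2)) {z. \<forall>k. a k \<le> z $ k \<and> z $ k \<le> b k}"
    by (auto simp: inj_on_def vec_eq_iff forall_2)
  show "finite ((\<lambda>z :: int ^ 2. (z $ 1, z $ 2)) ` {z. \<forall>k. a k \<le> z $ k \<and> z $ k \<le> b k})"
    by (rule finite_subset[of _ "{a 1..b 1} \<times> {a 2..b 2}"]) auto
qed

section \<open>Unions of grid cells\<close>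

locale cell_region = grid +
  fixes Z :: "(int ^ 2) set" and R :: "(real ^ 2) set"
  assumes finite_Z: "finite Z" and R_eq: "R = (\<Union>z\<in>Z. ccell z)"
begin

lemma compact_R: "compact R"
  unfolding R_eq ccell_def using finite_Z by (intro compact_UN) auto

text \<open>The cells that contain \<open>p\<close> form a neighbourhood of \<open>p\<close>; conversely, the interior of a missing
  cell that contains \<open>p\<close> has points outside \<open>R\<close> arbitrarily close to \<open>p\<close>.\<close>
lemma interior_R_iff: "p \<in> interior R \<longleftrightarrow> (\<forall>z. p \<in> ccell z \<longrightarrow> z \<in> Z)"
proof
  assume p: "p \<in> interior R"
  show "\<forall>z. p \<in> ccell z \<longrightarrow> z \<in> Z"
  proof (intro allI impI)
    fix z assume "p \<in> ccell z"
    then have "p \<in> closure (cell z)" by (simp add: closure_cell)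
    then obtain q where "q \<in> interior R" "q \<in> cell z"
      using p open_Int_closure_eq_empty[OF open_interior, of R "cell z"] by blast
    then obtain w where "w \<in> Z" "q \<in> ccell w" using interior_subset R_eq by blast
    then show "z \<in> Z" using cell_ccell[OF \<open>q \<in> cell z\<close>, of w] by simp
  qed
next
  assume *: "\<forall>z. p \<in> ccell z \<longrightarrow> z \<in> Z"
  obtain e where e: "e > 0" "\<And>q z. dist q p < e \<Longrightarrow> q \<in> ccell z \<Longrightarrow> p \<in> ccell z"
    using ccell_local by blast
  have "ball p e \<subseteq> R"
  proof
    fix q assume "q \<in> ball p e"
    moreover obtain z where "q \<in> ccell z" using in_some_ccell by blast
    ultimately show "q \<in> R" using e(2) * R_eq by (auto simp: dist_commute)
  qed
  then show "p \<in> interior R" using e(1) mem_interior by blast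
qed

lemma boundary_iff:
  "p \<in> R - interior R \<longleftrightarrow> (\<exists>z. z \<in> Z \<and> p \<in> ccell z) \<and> (\<exists>z. z \<notin> Z \<and> p \<in> ccell z)"
  using interior_R_iff R_eq by auto

lemma edge_boundary_iff:
  "p \<in> edge z k \<Longrightarrow> p \<in> R - interior R \<longleftrightarrow> (z \<in> Z) \<noteq> (z - axis (oth k) 1 \<in> Z)"
  unfolding boundary_iff by (auto simp: edge_ccell)

lemma cell_not_boundary: "p \<in> cell z \<Longrightarrow> p \<notin> R - interior R"
  unfolding boundary_iff by (auto simp: cell_ccell)

lemma region_local:
  obtains e where "e > 0" "\<And>q. q \<in> R \<Longrightarrow> dist q p < e \<Longrightarrow> \<exists>z\<in>Z. p \<in> ccell z \<and> q \<in> ccell z"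
  using ccell_local R_eq by (metis UN_iff)

end

text \<open>Two opposite cells at a node, without the other two, would make the node a point that cuts the region;
  a union of cells that is a surface has none.\<close>
locale surface_region = cell_region +
  assumes no_opposite: 
    "\<not> (v \<in> Z \<and> v - axis 1 1 - axis 2 1 \<in> Z \<and> v - axis 1 1 \<notin> Z \<and> v - axis 2 1 \<notin> Z)"
    "\<not> (v \<notin> Z \<and> v - axis 1 1 - axis 2 1 \<notin> Z \<and> v - axis 1 1 \<in> Z \<and> v - axis 2 1 \<in> Z)"

text \<open>If \<open>z\<close> and \<open>w\<close> are the only cells of \<open>R\<close> at a node, and they lie in disjoint open sets apart
  from the node, then removing the node cuts \<open>R\<close>.\<close>
lemma (in cell_region) no_opposite_cells:
  assumes surf: "surface_with_boundary R" and z: "z \<in> Z" "w \<in> Z" "node v \<in> ccell z" "node v \<in> ccell w"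
    and only: "\<And>u. u \<in> Z \<Longrightarrow> node v \<in> ccell u \<Longrightarrow> u = z \<or> u = w"
    and A: "open A" "ccell z \<subseteq> insert (node v) A" and B: "open B" "ccell w \<subseteq> insert (node v) B" "A \<inter> B = {}"
  shows False
proof -
  obtain e where e: "e > 0" "\<And>q. q \<in> R \<Longrightarrow> dist q (node v) < e \<Longrightarrow> \<exists>z\<in>Z. node v \<in> ccell z \<and> q \<in> ccell z"
    using region_local by blast
  have cl: "node v \<in> closure (R \<inter> A)" if "z \<in> Z" "node v \<in> ccell z" "ccell z \<subseteq> insert (node v) A" for z A
  proof -
    have "node v \<notin> cell z" by (auto simp: mem_cell dest: spec[of _ 1])
    then have "cell z \<subseteq> R \<inter> A"
      using that cell_subset[of z] R_eq by blast
    then show ?thesis using that(2) closure_mono closure_cell by blast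
  qed
  show False
  proof (rule surface_not_locally_cut[OF surf])
    show "node v \<in> R" using z R_eq by auto
    show "R \<inter> ball (node v) e - {node v} \<subseteq> A \<union> B"
    proof
      fix q assume q: "q \<in> R \<inter> ball (node v) e - {node v}"
      then obtain u where "u \<in> Z" "node v \<in> ccell u" "q \<in> ccell u" using e(2)[of q] by (auto simp: dist_commute)
      then show "q \<in> A \<union> B" using only A B q by blast
    qed
  qed (use e A B cl z in auto)
qed

text \<open>The grid is chosen such that each boundary segment lies on a grid line. Then an open cell is connected and
  disjoint from the boundary, so it is contained in \<open>R\<close> or disjoint from it; and the cells contained
  in \<open>R\<close> are dense in \<open>R\<close>, because the interior points of \<open>R\<close> are.\<close>
lemma surface_region_exists:
  assumes surf: "surface_with_boundary R" and comp: "compact R" and rect: "rectilinear_boundary R"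
  obtains g Z where "surface_region g Z R"
proof -
  obtain \<L> where L: "finite \<L>" "\<forall>L\<in>\<L>. axis_parallel_segment L" "surface_boundary R = \<Union>\<L>"
    using rect unfolding rectilinear_boundary_def by blast
  have "\<exists>a. \<forall>L\<in>\<L>. \<exists>k. \<forall>x\<in>L. x $ k = a L $ k"
  proof (rule bchoice, rule ballI)
    fix L assume "L \<in> \<L>"
    then obtain p q where pq: "p $ 1 = q $ 1 \<or> p $ 2 = q $ 2" "L = closed_segment p q"
      using L unfolding axis_parallel_segment_def by blast
    then obtain k where "q $ k = p $ k" by metis
    then have "\<forall>x\<in>L. x $ k = p $ k"
      by (clarsimp simp: pq(2) closed_segment_def) (simp add: algebra_simps)
    then show "\<exists>a. \<exists>k. \<forall>x\<in>L. x $ k = a $ k" by blast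
  qed
  then obtain a where a: "\<And>L. L \<in> \<L> \<Longrightarrow> \<exists>k. \<forall>x\<in>L. x $ k = a L $ k" by blast
  have "\<exists>h :: int \<Rightarrow> real. strict_mono h \<and> (\<forall>x. \<exists>i. h i \<le> x \<and> x < h (i + 1)) \<and> (\<lambda>L. a L $ k) ` \<L> \<subseteq> range h" for k
    using L(1) by (intro grid_through) auto
  then obtain g :: "2 \<Rightarrow> int \<Rightarrow> real" where g: "\<And>k. strict_mono (g k)" "\<And>k x. \<exists>i. g k i \<le> x \<and> x < g k (i + 1)"
    "\<And>k. (\<lambda>L. a L $ k) ` \<L> \<subseteq> range (g k)" by metis
  interpret grid g
    using g by unfold_locales (auto simp: strict_mono_less)
  have fr: "frontier R = \<Union>\<L>"
    using L(3) closure_closed[OF compact_imp_closed[OF comp]] surface_boundary_eq[of R] by (simp add: frontier_def)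
  have cell_fr: "cell z \<inter> frontier R = {}" for z
  proof -
    have False if "x \<in> cell z" "L \<in> \<L>" "x \<in> L" for x L
    proof -
      obtain k where "x $ k = a L $ k" using a[OF \<open>L \<in> \<L>\<close>] \<open>x \<in> L\<close> by blast
      then obtain i where "x $ k = g k i" using g(3)[of k] \<open>L \<in> \<L>\<close> by auto
      moreover have "g k (z $ k) < x $ k" "x $ k < g k (z $ k + 1)" using that(1) by (simp_all add: mem_cell)
      ultimately show False by simp
    qed
    then show ?thesis using fr by blast
  qed
  define Z where "Z = {z. cell z \<inter> R \<noteq> {}}"
  have cellZ: "ccell z \<subseteq> R" if "z \<in> Z" for z
  proof -
    have "connected (cell z)" unfolding cell_def by (simp add: convex_connected)
    then have "cell z \<subseteq> R" using that connected_Int_frontier[of "cell z" R] cell_fr unfolding Z_def by blast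
    then show ?thesis using closure_cell closure_minimal comp compact_imp_closed by metis
  qed
  have "finite Z"
  proof -
    obtain b where b: "\<And>x. x \<in> R \<Longrightarrow> norm x \<le> b" using comp compact_imp_bounded bounded_iff by metis
    have "\<forall>k. \<exists>i. g k i \<le> - b" "\<forall>k. \<exists>i. b < g k (i + 1)" using g_cover by blast+
    then obtain l u where l: "\<And>k. g k (l k) \<le> - b" and u: "\<And>k. b < g k (u k + 1)" by metis
    have "l k \<le> z $ k \<and> z $ k \<le> u k" if "z \<in> Z" for z k
    proof -
      obtain x where x: "x \<in> R" "x \<in> cell z" using \<open>z \<in> Z\<close> by (auto simp: Z_def)
      then have "\<bar>x $ k\<bar> \<le> b" using b component_le_norm_cart order_trans by blast
      moreover have "g k (z $ k) < x $ k" "x $ k < g k (z $ k + 1)" using x(2) by (simp_all add: mem_cell)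
      ultimately have "g k (l k) < g k (z $ k + 1)" "g k (z $ k) < g k (u k + 1)"
        using l[of k] u[of k] by linarith+
      then show ?thesis by auto
    qed
    then have "Z \<subseteq> {z. \<forall>k. l k \<le> z $ k \<and> z $ k \<le> u k}" by blast
    then show ?thesis using finite_int_box finite_subset by blast
  qed
  moreover have "R \<subseteq> (\<Union>z\<in>Z. ccell z)"
  proof
    fix p assume "p \<in> R"
    then have "p \<in> closure (interior R)" using surface_subset_closure_interior[OF surf] by blast
    moreover obtain e where e: "e > 0" "\<And>q z. dist q p < e \<Longrightarrow> q \<in> ccell z \<Longrightarrow> p \<in> ccell z"
      using ccell_local by blast
    ultimately obtain q where q: "q \<in> interior R" "dist q p < e" by (meson closure_approachable)
    obtain z where z: "q \<in> ccell z" using in_some_ccell by blast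
    then have "cell z \<inter> interior R \<noteq> {}"
      using q(1) open_Int_closure_eq_empty[OF open_interior, of R "cell z"] by (auto simp: closure_cell)
    then have "z \<in> Z" using interior_subset[of R] by (auto simp: Z_def)
    then show "p \<in> (\<Union>z\<in>Z. ccell z)" using e(2) q z by blast
  qed
  ultimately interpret cell_region g Z R
    using cellZ by unfold_locales auto
  have near: "u = v \<or> u = v - axis 1 1 - axis 2 1 \<or> u = v - axis 1 1 \<or> u = v - axis 2 1"
    if "node v \<in> ccell u" for u v
    using that[unfolded node_ccell forall_2] by (auto simp: vec_eq_iff forall_2 axis_nth_eq)
  have "surface_region g Z R"
  proof
    fix v
    define p where "p = node v"
    have p: "p $ 1 = g 1 (v $ 1)" "p $ 2 = g 2 (v $ 2)" by (simp_all add: p_def)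
    show "\<not> (v \<in> Z \<and> v - axis 1 1 - axis 2 1 \<in> Z \<and> v - axis 1 1 \<notin> Z \<and> v - axis 2 1 \<notin> Z)"
    proof
      assume *: "v \<in> Z \<and> v - axis 1 1 - axis 2 1 \<in> Z \<and> v - axis 1 1 \<notin> Z \<and> v - axis 2 1 \<notin> Z"
      show False
      proof (rule no_opposite_cells[OF surf, of v "v - axis 1 1 - axis 2 1" v "{x. p $ 1 + p $ 2 < x $ 1 + x $ 2}" "{x. p $ 1 + p $ 2 > x $ 1 + x $ 2}"])
        show "ccell v \<subseteq> insert (node v) {x. p $ 1 + p $ 2 < x $ 1 + x $ 2}"
          "ccell (v - axis 1 1 - axis 2 1) \<subseteq> insert (node v) {x. p $ 1 + p $ 2 > x $ 1 + x $ 2}"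
          by (auto simp: mem_ccell forall_2 p vec_eq_iff axis_nth_eq)
      qed (use * near in \<open>auto simp: node_ccell forall_2 axis_nth_eq intro!: open_Collect_less continuous_intros\<close>)
    qed
    show "\<not> (v \<notin> Z \<and> v - axis 1 1 - axis 2 1 \<notin> Z \<and> v - axis 1 1 \<in> Z \<and> v - axis 2 1 \<in> Z)"
    proof
      assume *: "v \<notin> Z \<and> v - axis 1 1 - axis 2 1 \<notin> Z \<and> v - axis 1 1 \<in> Z \<and> v - axis 2 1 \<in> Z"
      show False
      proof (rule no_opposite_cells[OF surf, of "v - axis 1 1" "v - axis 2 1" v "{x. p $ 2 - p $ 1 < x $ 2 - x $ 1}" "{x. p $ 2 - p $ 1 > x $ 2 - x $ 1}"])
        show "ccell (v - axis 1 1) \<subseteq> insert (node v) {x. p $ 2 - p $ 1 < x $ 2 - x $ 1}"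
          "ccell (v - axis 2 1) \<subseteq> insert (node v) {x. p $ 2 - p $ 1 > x $ 2 - x $ 1}"
          by (auto simp: mem_ccell forall_2 p vec_eq_iff axis_nth_eq)
      qed (use * near in \<open>auto simp: node_ccell forall_2 axis_nth_eq intro!: open_Collect_less continuous_intros\<close>)
    qed
  qed
  then show thesis using that by blast
qed

section \<open>Calculus on unions of cells\<close>

text \<open>The mean value inequality, for the deviation from an affine function.\<close>
lemma mvt_affine_bound:
  fixes \<phi> :: "real \<Rightarrow> 'a :: euclidean_space"
  assumes "a \<le> b"
    and der: "\<And>t. t \<in> {a..b} \<Longrightarrow> (\<phi> has_vector_derivative \<phi>' t) (at t within {a..b})"
    and bound: "\<And>t. t \<in> {a..b} \<Longrightarrow> norm (\<phi>' t - v) \<le> B"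
  shows "norm (\<phi> b - \<phi> a - (b - a) *\<^sub>R v) \<le> B * (b - a)"
proof (cases "a < b")
  case True
  define \<psi> where "\<psi> t = \<phi> t - t *\<^sub>R v" for t
  have d: "(\<psi> has_vector_derivative (\<phi>' t - v)) (at t within {a..b})" if "t \<in> {a..b}" for t
    unfolding \<psi>_def by (auto intro!: derivative_eq_intros der that)
  have "\<exists>t\<in>{a<..<b}. norm (\<psi> b - \<psi> a) \<le> norm ((\<lambda>h. h *\<^sub>R (\<phi>' t - v)) (b - a))"
  proof (rule mvt_general[OF True])
    show "continuous_on {a..b} \<psi>"
      using d has_vector_derivative_continuous continuous_on_eq_continuous_within by blast
    show "(\<psi> has_derivative (\<lambda>h. h *\<^sub>R (\<phi>' t - v))) (at t)" if "a < t" "t < b" for t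
      using d[of t] that at_within_interior[of t "{a..b}"] by (simp add: has_vector_derivative_def)
  qed
  then obtain t where t: "t \<in> {a<..<b}" and le: "norm (\<psi> b - \<psi> a) \<le> norm ((b - a) *\<^sub>R (\<phi>' t - v))" by auto
  note le
  also have "\<dots> \<le> B * (b - a)"
    using bound[of t] t True by (simp add: mult.commute mult_right_mono)
  finally show ?thesis by (simp add: \<psi>_def algebra_simps)
qed (use assms in auto)

lemma partial_along_line:
  assumes f: "has_partial_on R k f" and line: "\<And>t. t \<in> {a..b} \<Longrightarrow> crd k t s \<in> R" and t: "t \<in> {a..b}"
  shows "((\<lambda>t. f (crd k t s)) has_vector_derivative partial R k f (crd k t s)) (at t within {a..b})"
proof -
  define h where "h u = f (crd k t s + u *\<^sub>R axis k 1)" for u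
  have *: "crd k t s + u *\<^sub>R axis k 1 = crd k (t + u) s" for u
    by (rule crd_eqI[symmetric]) auto
  have "(h has_vector_derivative partial R k f (crd k t s)) (at 0 within slice R k (crd k t s))"
    using f line[OF t] vector_derivative_works unfolding has_partial_on_def partial_def h_def by blast
  moreover have "(\<lambda>u. u - t) ` {a..b} \<subseteq> slice R k (crd k t s)"
    using line by (auto simp: slice_def *)
  ultimately have "(h has_vector_derivative partial R k f (crd k t s)) (at (t - t) within (\<lambda>u. u - t) ` {a..b})"
    using has_vector_derivative_within_subset by force
  moreover have "((\<lambda>u. u - t) has_vector_derivative 1) (at t within {a..b})"
    by (auto intro!: derivative_eq_intros)
  ultimately have "((h \<circ> (\<lambda>u. u - t)) has_vector_derivative 1 *\<^sub>R partial R k f (crd k t s)) (at t within {a..b})"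
    using vector_diff_chain_within by blast
  then show ?thesis by (simp add: h_def o_def *)
qed

lemma segment_partial_bound:
  fixes a b :: real
  assumes f: "has_partial_on R k f" and line: "\<And>t. t \<in> closed_segment a b \<Longrightarrow> crd k t s \<in> R"
    and bound: "\<And>t. t \<in> closed_segment a b \<Longrightarrow> norm (partial R k f (crd k t s) - v) \<le> B"
  shows "norm (f (crd k b s) - f (crd k a s) - (b - a) *\<^sub>R v) \<le> B * \<bar>b - a\<bar>"
proof (cases "a \<le> b")
  case True
  then show ?thesis
    using mvt_affine_bound[OF True partial_along_line[OF f], of s v B] line bound
    by (auto simp: closed_segment_eq_real_ivl)
next
  case False
  then have "norm (f (crd k a s) - f (crd k b s) - (a - b) *\<^sub>R v) \<le> B * (a - b)"
    using mvt_affine_bound[OF _ partial_along_line[OF f], of b a s v B] line bound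
    by (auto simp: closed_segment_eq_real_ivl)
  moreover have "f (crd k a s) - f (crd k b s) - (a - b) *\<^sub>R v = - (f (crd k b s) - f (crd k a s) - (b - a) *\<^sub>R v)"
    by (simp add: algebra_simps)
  moreover have "\<bar>b - a\<bar> = a - b" using False by simp
  ultimately show ?thesis by (simp only: norm_minus_cancel)
qed

lemma norm_le_coords: "\<bar>s - p $ k\<bar> \<le> \<bar>q $ k - p $ k\<bar> \<Longrightarrow> \<bar>t - p $ oth k\<bar> \<le> \<bar>q $ oth k - p $ oth k\<bar>
    \<Longrightarrow> dist (crd k s t) p \<le> dist q (p :: real ^ 2)"
  unfolding dist_norm
  by (rule norm_le_componentwise_cart) (use all_coords[of "\<lambda>i. norm ((crd k s t - p) $ i) \<le> norm ((q - p) $ i)" k] in simp)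

context cell_region
begin

text \<open>Points near \<open>p\<close> are joined to \<open>p\<close> inside one cell by a path with one segment in each coordinate direction.\<close>
lemma two_segment_bound:
  assumes f: "\<And>k. has_partial_on R k f" and q: "z \<in> Z" "p \<in> ccell z" "q \<in> ccell z"
    and bound: "\<And>k x. x \<in> R \<Longrightarrow> dist x p \<le> dist q p \<Longrightarrow> norm (partial R k f x - v k) \<le> B"
  shows "norm (f q - f p - ((q - p) $ 1 *\<^sub>R v 1 + (q - p) $ 2 *\<^sub>R v 2)) \<le> 2 * B * dist q p"
proof -
  have inR: "crd k s t \<in> R" if "s \<in> closed_segment (p $ k) (q $ k)" "t \<in> closed_segment (p $ oth k) (q $ oth k)" for k s t
  proof -
    have "crd k s t \<in> ccell z"
      unfolding mem_ccell all_coords[of _ k]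
      using that q(2,3) unfolding mem_ccell all_coords[of _ k]
      by (auto simp: closed_segment_eq_real_ivl split: if_splits)
    then show ?thesis using q(1) R_eq by blast
  qed
  have dst: "dist (crd k s t) p \<le> dist q p"
    if "s \<in> closed_segment (p $ k) (q $ k)" "t \<in> closed_segment (p $ oth k) (q $ oth k)" for k s t
    by (rule norm_le_coords) (use that in \<open>auto simp: closed_segment_eq_real_ivl split: if_splits\<close>)
  have B: "B \<ge> 0"
    using bound[of p 1] inR[of "p $ 1" 1 "p $ 2"] norm_ge_zero order_trans
    by (metis UN_I dist_self q(1,2) R_eq zero_le_dist)
  have 1: "norm (f (crd 1 (q $ 1) (p $ 2)) - f (crd 1 (p $ 1) (p $ 2)) - (q $ 1 - p $ 1) *\<^sub>R v 1) \<le> B * \<bar>q $ 1 - p $ 1\<bar>"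
    by (rule segment_partial_bound[OF f]) (use inR[of _ 1] dst[of _ 1] bound in auto)
  have 2: "norm (f (crd 2 (q $ 2) (q $ 1)) - f (crd 2 (p $ 2) (q $ 1)) - (q $ 2 - p $ 2) *\<^sub>R v 2) \<le> B * \<bar>q $ 2 - p $ 2\<bar>"
    by (rule segment_partial_bound[OF f]) (use inR[of _ 2] dst[of _ 2] bound in auto)
  have eqs: "crd 1 (p $ 1) (p $ 2) = p" "crd 2 (q $ 2) (q $ 1) = q" "crd 2 (p $ 2) (q $ 1) = crd 1 (q $ 1) (p $ 2)"
    by (auto simp: crd_def vec_eq_iff forall_2)
  have "\<bar>q $ 1 - p $ 1\<bar> \<le> dist q p" "\<bar>q $ 2 - p $ 2\<bar> \<le> dist q p"
    using component_le_norm_cart[of "q - p" 1] component_le_norm_cart[of "q - p" 2] by (auto simp: dist_norm)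
  then have "B * \<bar>q $ 1 - p $ 1\<bar> + B * \<bar>q $ 2 - p $ 2\<bar> \<le> B * dist q p + B * dist q p"
    using B by (intro add_mono mult_left_mono) auto
  moreover have "f q - f p - ((q - p) $ 1 *\<^sub>R v 1 + (q - p) $ 2 *\<^sub>R v 2) =
      (f (crd 1 (q $ 1) (p $ 2)) - f p - (q $ 1 - p $ 1) *\<^sub>R v 1) + (f q - f (crd 1 (q $ 1) (p $ 2)) - (q $ 2 - p $ 2) *\<^sub>R v 2)"
    (is "_ = ?a + ?b")
    by (simp add: algebra_simps)
  moreover have "norm ?a \<le> B * \<bar>q $ 1 - p $ 1\<bar>" "norm ?b \<le> B * \<bar>q $ 2 - p $ 2\<bar>"
    using 1 2 unfolding eqs .
  ultimately show ?thesis using norm_triangle_ineq[of ?a ?b] by (simp only:)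
qed

text \<open>Bounded partial derivatives make \<open>f\<close> locally Lipschitz, by the two-segment paths.\<close>
lemma continuous_on_if_partials_bounded:
  assumes f: "\<And>k. has_partial_on R k f" and bound: "\<And>k x. x \<in> R \<Longrightarrow> norm (partial R k f x) \<le> B"
  shows "continuous_on R f"
  unfolding continuous_on_iff
proof (intro ballI allI impI)
  fix p and \<epsilon> :: real assume p: "p \<in> R" and "\<epsilon> > 0"
  obtain e where e: "e > 0" "\<And>q. q \<in> R \<Longrightarrow> dist q p < e \<Longrightarrow> \<exists>z\<in>Z. p \<in> ccell z \<and> q \<in> ccell z"
    using region_local by blast
  have B: "B \<ge> 0" using bound[OF p] norm_ge_zero order_trans by blast
  have "dist (f q) (f p) < \<epsilon>" if q: "q \<in> R" "dist q p < min e (\<epsilon> / (2 * B + 1))" for q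
  proof -
    obtain z where "z \<in> Z" "p \<in> ccell z" "q \<in> ccell z" using e(2) q by auto
    then have "norm (f q - f p) \<le> 2 * B * dist q p"
      using two_segment_bound[OF f, of z p q "\<lambda>_. 0" B] bound by simp
    also have "\<dots> \<le> (2 * B + 1) * dist q p" by (simp add: algebra_simps)
    also have "\<dots> < \<epsilon>" using q(2) B by (simp add: field_simps)
    finally show ?thesis by (simp add: dist_norm)
  qed
  moreover have "min e (\<epsilon> / (2 * B + 1)) > 0" using e(1) \<open>\<epsilon> > 0\<close> B by simp
  ultimately show "\<exists>d>0. \<forall>q\<in>R. dist q p < d \<longrightarrow> dist (f q) (f p) < \<epsilon>" by blast
qed

lemma has_derivative_if_partials_continuous:
  assumes f: "\<And>k. has_partial_on R k f" and cont: "\<And>k. continuous_on R (partial R k f)" and p: "p \<in> R"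
  shows "(f has_derivative (\<lambda>h. h $ 1 *\<^sub>R partial R 1 f p + h $ 2 *\<^sub>R partial R 2 f p)) (at p within R)"
  unfolding has_derivative_within_alt
proof (intro conjI allI impI)
  show "bounded_linear (\<lambda>h. h $ 1 *\<^sub>R partial R 1 f p + h $ 2 *\<^sub>R partial R 2 f p)"
    by (intro bounded_linear_add bounded_linear_scaleR_const bounded_linear_vec_nth)
  fix \<epsilon> :: real assume "\<epsilon> > 0"
  obtain e where e: "e > 0" "\<And>q. q \<in> R \<Longrightarrow> dist q p < e \<Longrightarrow> \<exists>z\<in>Z. p \<in> ccell z \<and> q \<in> ccell z"
    using region_local by blast
  have "\<exists>d>0. \<forall>x\<in>R. dist x p < d \<longrightarrow> dist (partial R k f x) (partial R k f p) < \<epsilon> / 2" for k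
    using cont[of k] p \<open>\<epsilon> > 0\<close> unfolding continuous_on_iff by (meson half_gt_zero)
  then obtain d where d: "\<And>k. d k > 0" "\<And>k x. x \<in> R \<Longrightarrow> dist x p < d k \<Longrightarrow> dist (partial R k f x) (partial R k f p) < \<epsilon> / 2"
    by metis
  define \<delta> where "\<delta> = min e (min (d 1) (d 2))"
  have \<delta>: "\<delta> \<le> e" "\<delta> \<le> d k" for k using exhaust_2[of k] by (auto simp: \<delta>_def)
  have "norm (f q - f p - ((q - p) $ 1 *\<^sub>R partial R 1 f p + (q - p) $ 2 *\<^sub>R partial R 2 f p)) \<le> \<epsilon> * norm (q - p)"
    if q: "q \<in> R" "norm (q - p) < \<delta>" for q
  proof -
    obtain z where z: "z \<in> Z" "p \<in> ccell z" "q \<in> ccell z" using e(2)[of q] q \<delta>(1) by (auto simp: dist_norm)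
    have "norm (f q - f p - ((q - p) $ 1 *\<^sub>R partial R 1 f p + (q - p) $ 2 *\<^sub>R partial R 2 f p)) \<le> 2 * (\<epsilon> / 2) * dist q p"
    proof (rule two_segment_bound[OF f z, of "\<lambda>k. partial R k f p"])
      fix k x assume "x \<in> R" "dist x p \<le> dist q p"
      then show "norm (partial R k f x - partial R k f p) \<le> \<epsilon> / 2"
        using d(2)[of x k] q(2) \<delta>(2)[of k] by (simp add: dist_norm)
    qed
    then show ?thesis by (simp add: dist_norm)
  qed
  moreover have "\<delta> > 0" using e d by (simp add: \<delta>_def)
  ultimately show "\<exists>d>0. \<forall>y\<in>R. norm (y - p) < d \<longrightarrow>
      norm (f y - f p - ((y - p) $ 1 *\<^sub>R partial R 1 f p + (y - p) $ 2 *\<^sub>R partial R 2 f p)) \<le> \<epsilon> * norm (y - p)"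
    by blast
qed

text \<open>The definition of C2 asks for continuity of the second partial derivatives. By compactness these are
  bounded, which makes the first ones continuous.\<close>
lemma C2_partial_continuous:
  assumes "C2_on R f"
  shows "continuous_on R (partial R i f)"
proof -
  have "\<exists>B. \<forall>x\<in>R. norm (partial R j (partial R i f) x) \<le> B" for j
    using compact_imp_bounded[OF compact_continuous_image[OF _ compact_R], of "partial R j (partial R i f)"] assms
    unfolding C2_on_def bounded_iff by auto
  then obtain B where B: "\<And>j x. x \<in> R \<Longrightarrow> norm (partial R j (partial R i f) x) \<le> B j" by metis
  show ?thesis
  proof (rule continuous_on_if_partials_bounded)
    show "has_partial_on R k (partial R i f)" for k using assms by (simp add: C2_on_def)
    show "norm (partial R k (partial R i f) x) \<le> max (B 1) (B 2)" if "x \<in> R" for k x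
      using B[OF that, of k] exhaust_2[of k] by auto
  qed
qed

lemma jacobian_mult: "jacobian R f p *v h = h $ 1 *\<^sub>R partial R 1 f p + h $ 2 *\<^sub>R partial R 2 f p"
  by (simp add: vec_eq_iff matrix_vector_mult_def jacobian_def sum_2 mult.commute)

lemma C2_has_derivative:
  assumes "C2_on R f" "p \<in> R"
  shows "(f has_derivative (\<lambda>h. jacobian R f p *v h)) (at p within R)"
  unfolding jacobian_mult
  using assms by (intro has_derivative_if_partials_continuous C2_partial_continuous) (auto simp: C2_on_def)

text \<open>The mean value inequality, applied once in each coordinate direction, compares the second difference
  of \<open>f\<close> over a small square with the mixed partial derivative.\<close>
lemma second_difference_bound:
  assumes f: "has_partial_on R k f" "has_partial_on R (oth k) (partial R k f)" and "h \<ge> 0"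
    and box: "\<And>s t. s \<in> {p $ k..p $ k + h} \<Longrightarrow> t \<in> {p $ oth k..p $ oth k + h} \<Longrightarrow> 
      crd k s t \<in> R \<and> norm (partial R (oth k) (partial R k f) (crd k s t) - v) \<le> B"
  defines "\<Delta> \<equiv> f (crd k (p $ k + h) (p $ oth k + h)) - f (crd k (p $ k + h) (p $ oth k))
              - f (crd k (p $ k) (p $ oth k + h)) + f (crd k (p $ k) (p $ oth k))"
  shows "norm (\<Delta> - h *\<^sub>R h *\<^sub>R v) \<le> B * h * h"
proof -
  define \<phi> where "\<phi> s = f (crd k s (p $ oth k + h)) - f (crd k s (p $ oth k))" for s
  have "norm (\<phi> (p $ k + h) - \<phi> (p $ k) - (p $ k + h - p $ k) *\<^sub>R (h *\<^sub>R v)) \<le> (B * h) * (p $ k + h - p $ k)"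
  proof (rule mvt_affine_bound)
    fix s assume s: "s \<in> {p $ k..p $ k + h}"
    show "(\<phi> has_vector_derivative (partial R k f (crd k s (p $ oth k + h)) - partial R k f (crd k s (p $ oth k))))
       (at s within {p $ k..p $ k + h})"
      unfolding \<phi>_def using box s \<open>h \<ge> 0\<close> by (intro has_vector_derivative_diff partial_along_line[OF f(1)]) auto
    have "norm (partial R k f (crd (oth k) (p $ oth k + h) s) - partial R k f (crd (oth k) (p $ oth k) s)
        - (p $ oth k + h - p $ oth k) *\<^sub>R v) \<le> B * \<bar>p $ oth k + h - p $ oth k\<bar>"
      by (rule segment_partial_bound[OF f(2)]) (use box s \<open>h \<ge> 0\<close> in \<open>auto simp: crd_swap closed_segment_eq_real_ivl\<close>)
    then show "norm (partial R k f (crd k s (p $ oth k + h)) - partial R k f (crd k s (p $ oth k)) - h *\<^sub>R v) \<le> B * h"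
      using \<open>h \<ge> 0\<close> by (simp add: crd_swap)
  qed (use \<open>h \<ge> 0\<close> in auto)
  then show ?thesis by (simp add: \<Delta>_def \<phi>_def algebra_simps)
qed

text \<open>Both orders approximate the same second difference over small squares.\<close>
lemma mixed_partials_eq:
  assumes C2: "C2_on R f" and z: "z \<in> Z" "p \<in> cell z"
  shows "partial R 1 (partial R 2 f) p = partial R 2 (partial R 1 f) p"
proof -
  let ?m = "\<lambda>k. partial R (oth k) (partial R k f)"
  have pR: "p \<in> R" and op: "open (cell z)" "cell z \<subseteq> R" 
    using z cell_subset R_eq by (auto simp: cell_def)
  have small: "norm (?m 2 p - ?m 1 p) \<le> 2 * B" if "B > 0" for B
  proof -
    have "\<exists>d>0. \<forall>x\<in>R. dist x p < d \<longrightarrow> dist (?m k x) (?m k p) < B" for k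
      using C2 pR \<open>B > 0\<close> unfolding C2_on_def continuous_on_iff by blast
    then obtain d where d: "\<And>k. d k > 0" "\<And>k x. x \<in> R \<Longrightarrow> dist x p < d k \<Longrightarrow> dist (?m k x) (?m k p) < B"
      by metis
    obtain e where e: "e > 0" "ball p e \<subseteq> R" using op z(2) open_contains_ball by (metis subset_trans)
    define h where "h = min e (min (d 1) (d 2)) / 3"
    have h: "h > 0" "3 * h \<le> e" "3 * h \<le> d k" for k
      using e(1) d(1) exhaust_2[of k] by (auto simp: h_def)
    have box: "crd k s t \<in> R \<and> norm (?m k (crd k s t) - ?m k p) \<le> B"
      if "s \<in> {p $ k..p $ k + h}" "t \<in> {p $ oth k..p $ oth k + h}" for k s t
    proof -
      have "norm (crd k s t - p) \<le> (\<Sum>i\<in>UNIV. \<bar>(crd k s t - p) $ i\<bar>)" by (rule norm_le_l1_cart)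
      also have "\<dots> = \<bar>s - p $ k\<bar> + \<bar>t - p $ oth k\<bar>"
        using exhaust_2[of k] by (auto simp: sum_2 crd_def)
      also have "\<dots> < 3 * h" using that h(1) by auto
      finally have "dist (crd k s t) p < 3 * h" by (simp add: dist_norm)
      then show ?thesis using h(2) h(3)[of k] e(2) d(2)[of "crd k s t" k]
        by (auto simp: dist_commute dist_norm norm_minus_commute less_imp_le subset_iff)
    qed
    define \<Delta> where "\<Delta> = f (crd 1 (p $ 1 + h) (p $ 2 + h)) - f (crd 1 (p $ 1 + h) (p $ 2))
              - f (crd 1 (p $ 1) (p $ 2 + h)) + f (crd 1 (p $ 1) (p $ 2))"
    have swap: "crd 2 t s = crd 1 s t" for s t by (simp add: crd_def vec_eq_iff forall_2)
    have "norm (\<Delta> - h *\<^sub>R h *\<^sub>R ?m 1 p) \<le> B * h * h"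
      using second_difference_bound[of 1 f h p "?m 1 p" B] C2 h(1) box[of _ 1] by (simp add: C2_on_def \<Delta>_def)
    moreover have "norm (\<Delta> - h *\<^sub>R h *\<^sub>R ?m 2 p) \<le> B * h * h"
      using second_difference_bound[of 2 f h p "?m 2 p" B] C2 h(1) box[of _ 2]
      by (simp add: C2_on_def \<Delta>_def swap algebra_simps)
    ultimately have "norm ((\<Delta> - h *\<^sub>R h *\<^sub>R ?m 1 p) - (\<Delta> - h *\<^sub>R h *\<^sub>R ?m 2 p)) \<le> B * h * h + B * h * h"
      by (rule order_trans[OF norm_triangle_ineq4 add_mono])
    moreover have "(\<Delta> - h *\<^sub>R h *\<^sub>R ?m 1 p) - (\<Delta> - h *\<^sub>R h *\<^sub>R ?m 2 p) = (h * h) *\<^sub>R (?m 2 p - ?m 1 p)"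
      by (simp add: algebra_simps)
    ultimately have "(h * h) * norm (?m 2 p - ?m 1 p) \<le> (h * h) * (2 * B)" using h(1) by simp
    then show ?thesis using h(1) by (simp add: mult_le_cancel_left)
  qed
  have "norm (?m 2 p - ?m 1 p) \<le> 0"
    by (rule field_le_epsilon) (use small[of "e / 2" for e] in simp)
  then show ?thesis by simp
qed

end

text \<open>Fubini's theorem, transported from the product \<open>real \<times> real\<close> along the measure preserving
  map that reads off the two coordinates.\<close>
lemma integral_cbox_iterated:
  fixes f :: "real ^ 2 \<Rightarrow> real"
  assumes "continuous_on (cbox a b) f"
  shows "(f has_integral integral {a $ k..b $ k} (\<lambda>s. integral {a $ oth k..b $ oth k} (\<lambda>t. f (crd k s t)))) (cbox a b)"
proof -
  define \<pi> :: "real ^ 2 \<Rightarrow> real \<times> real" where "\<pi> x = (x $ k, x $ oth k)" for x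
  define \<rho> :: "real \<times> real \<Rightarrow> real ^ 2" where "\<rho> y = crd k (fst y) (snd y)" for y
  have inv: "\<rho> (\<pi> x) = x" "\<pi> (\<rho> y) = y" for x y by (auto simp: \<rho>_def \<pi>_def crd_eqI)
  have memc: "x \<in> cbox u v \<longleftrightarrow> u $ k \<le> x $ k \<and> x $ k \<le> v $ k \<and> u $ oth k \<le> x $ oth k \<and> x $ oth k \<le> v $ oth k"
    for x u v :: "real ^ 2"
    unfolding mem_box_cart all_coords[of _ k] by auto
  have mem2: "y \<in> cbox u v \<longleftrightarrow> fst u \<le> fst y \<and> fst y \<le> fst v \<and> snd u \<le> snd y \<and> snd y \<le> snd v" for y u v :: "real \<times> real"
    by (cases u; cases v; cases y) (auto simp: cbox_Pair_eq)
  have im: "y \<in> \<pi> ` A \<longleftrightarrow> \<rho> y \<in> A" "x \<in> \<rho> ` B \<longleftrightarrow> \<pi> x \<in> B" for x y A B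
    by (auto simp: inv intro: image_eqI[of _ _ "\<rho> y"] image_eqI[of _ _ "\<pi> x"])
  have im\<pi>: "\<pi> ` cbox u v = cbox (\<pi> u) (\<pi> v)" for u v
    by (rule set_eqI, unfold im memc mem2) (auto simp: \<pi>_def \<rho>_def)
  have im\<rho>: "\<rho> ` cbox u v = cbox (\<rho> u) (\<rho> v)" for u v
    by (rule set_eqI, unfold im memc mem2) (auto simp: \<pi>_def \<rho>_def)
  have cont: "continuous_on (cbox (a $ k, a $ oth k) (b $ k, b $ oth k)) (\<lambda>y. f (\<rho> y))"
  proof (rule continuous_on_compose2[OF assms])
    have "continuous_on UNIV (\<lambda>y :: real \<times> real. if m = k then fst y else snd y)" for m
      by (cases "m = k") (auto intro: continuous_intros)
    then have "continuous_on UNIV \<rho>" unfolding \<rho>_def crd_def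
      by (intro continuous_on_vec_lambda)
    then show "continuous_on (cbox (a $ k, a $ oth k) (b $ k, b $ oth k)) \<rho>" using continuous_on_subset by blast
    show "\<rho> ` cbox (a $ k, a $ oth k) (b $ k, b $ oth k) \<subseteq> cbox a b"
      unfolding im\<rho> by (simp add: \<rho>_def crd_eqI)
  qed
  let ?I = "integral {a $ k..b $ k} (\<lambda>s. integral {a $ oth k..b $ oth k} (\<lambda>t. f (crd k s t)))"
  have "((\<lambda>y. f (\<rho> y)) has_integral ?I) (cbox (a $ k, a $ oth k) (b $ k, b $ oth k))"
    using integral_prod_continuous[OF cont] integrable_continuous[OF cont]
    by (simp add: has_integral_iff \<rho>_def)
  then have "((\<lambda>x. f (\<rho> (\<pi> x))) has_integral (1 / 1) *\<^sub>R ?I) (\<rho> ` cbox (a $ k, a $ oth k) (b $ k, b $ oth k))"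
  proof (rule has_integral_twiddle[rotated -1])
    show "continuous (at x) \<pi>" for x unfolding \<pi>_def by (intro continuous_intros)
    show "measure lborel (\<pi> ` cbox u v) = 1 * measure lborel (cbox u v)" for u v
    proof -
      have "measure lborel (cbox (\<pi> u) (\<pi> v)) = measure lborel {u $ k..v $ k} * measure lborel {u $ oth k..v $ oth k}"
        by (simp add: \<pi>_def content_Pair)
      also have "\<dots> = measure lborel (cbox u v)"
      proof (cases "cbox u v = {}")
        case True
        then show ?thesis
          using interval_eq_empty_cart(2)[of u v] all_coords[of "\<lambda>i. \<not> v $ i < u $ i" k] by auto
      next
        case False
        then have "measure lborel (cbox u v) = (\<Prod>i\<in>UNIV. v $ i - u $ i)" by (rule content_cbox_cart)
        also have "\<dots> = (v $ k - u $ k) * (v $ oth k - u $ oth k)"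
          using exhaust_2[of k] by (auto simp: UNIV_2)
        moreover have "u $ k \<le> v $ k" "u $ oth k \<le> v $ oth k" using False by (auto simp: interval_ne_empty_cart)
        ultimately show ?thesis by simp
      qed
      finally show ?thesis by (simp add: im\<pi>)
    qed
    show "\<exists>w z. \<pi> ` cbox u v = cbox w z" for u v using im\<pi> by blast
    show "\<exists>w z. \<rho> ` cbox u v = cbox w z" for u v using im\<rho> by blast
  qed (use inv in auto)
  then show ?thesis by (simp add: inv im\<rho>) (simp add: \<rho>_def crd_eqI)
qed

section \<open>Green's formula on a union of cells\<close>

context grid
begin

definition edge_integral :: "(real ^ 2 \<Rightarrow> real) \<Rightarrow> int ^ 2 \<Rightarrow> 2 \<Rightarrow> real" where
  "edge_integral u z k =
     integral {g k (z $ k)..g k (z $ k + 1)} (\<lambda>t. u (crd k t (g (oth k) (z $ oth k))))"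

lemma crd_ccell: "crd k s t \<in> ccell z \<longleftrightarrow> 
    s \<in> {g k (z $ k)..g k (z $ k + 1)} \<and> t \<in> {g (oth k) (z $ oth k)..g (oth k) (z $ oth k + 1)}"
  unfolding mem_ccell all_coords[of _ k] by auto

lemma continuous_on_crd: "continuous_on A f \<Longrightarrow> continuous_on A h \<Longrightarrow> continuous_on A (\<lambda>t. crd k (f t) (h t))"
proof -
  assume "continuous_on A f" "continuous_on A h"
  then have "continuous_on A (\<lambda>t. if m = k then f t else h t)" for m by (cases "m = k") auto
  then show ?thesis unfolding crd_def by (intro continuous_on_vec_lambda)
qed

text \<open>If \<open>f\<close> is the derivative of \<open>u\<close> in direction \<open>k\<close>, its integral over a cell is the difference
  of the integrals of \<open>u\<close> over two opposite edges, which run in the other direction.\<close>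
lemma cell_integral:
  assumes f: "continuous_on (ccell z) f" and u: "continuous_on (ccell z) u"
    and der: "\<And>s t. crd k s t \<in> ccell z \<Longrightarrow>
      ((\<lambda>s. u (crd k s t)) has_vector_derivative f (crd k s t)) (at s within {g k (z $ k)..g k (z $ k + 1)})"
  shows "(f has_integral (edge_integral u (z + axis k 1) (oth k) - edge_integral u z (oth k))) (ccell z)"
proof -
  let ?T = "{g (oth k) (z $ oth k)..g (oth k) (z $ oth k + 1)}"
  have inner: "integral {g k (z $ k)..g k (z $ k + 1)} (\<lambda>s. f (crd k s t)) =
      u (crd k (g k (z $ k + 1)) t) - u (crd k (g k (z $ k)) t)" if "t \<in> ?T" for t
    using that by (intro integral_unique fundamental_theorem_of_calculus der) (auto simp: crd_ccell)
  have int: "(\<lambda>t. u (crd k s t)) integrable_on ?T" if "s \<in> {g k (z $ k)..g k (z $ k + 1)}" for s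
    using that
    by (intro integrable_continuous_real continuous_on_compose2[OF u] continuous_on_crd continuous_intros) (auto simp: crd_ccell)
  have "(f has_integral integral {node z $ oth k..node (z + 1) $ oth k}
      (\<lambda>s. integral {node z $ oth (oth k)..node (z + 1) $ oth (oth k)} (\<lambda>t. f (crd (oth k) s t)))) (ccell z)"
    using integral_cbox_iterated[of "node z" "node (z + 1)" f "oth k"] f unfolding ccell_def by blast
  also have "integral {node z $ oth k..node (z + 1) $ oth k}
      (\<lambda>s. integral {node z $ oth (oth k)..node (z + 1) $ oth (oth k)} (\<lambda>t. f (crd (oth k) s t))) =
      integral ?T (\<lambda>t. u (crd k (g k (z $ k + 1)) t) - u (crd k (g k (z $ k)) t))"
    by (simp only: node_nth oth_simps vector_add_component one_index crd_swap) (rule integral_cong, rule inner)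
  also have "\<dots> = integral ?T (\<lambda>t. u (crd k (g k (z $ k + 1)) t)) - integral ?T (\<lambda>t. u (crd k (g k (z $ k)) t))"
    by (intro integral_diff int) auto
  also have "\<dots> = edge_integral u (z + axis k 1) (oth k) - edge_integral u z (oth k)"
    by (simp add: edge_integral_def crd_swap)
  finally show ?thesis .
qed

end

text \<open>With \<open>e z\<close> the integral over an edge, this collects the contributions of the two cells adjacent
  to it; they cancel unless exactly one of these cells is in \<open>Z\<close>.\<close>
lemma sum_by_parts:
  fixes e :: "'a :: ab_group_add \<Rightarrow> real"
  assumes W: "finite W" "Z \<subseteq> W" "(\<lambda>z. z + a) ` Z \<subseteq> W"
  shows "(\<Sum>z\<in>Z. e (z + a) - e z) = (\<Sum>z\<in>W. (of_bool (z - a \<in> Z) - of_bool (z \<in> Z)) * e z)"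
proof -
  have "(\<Sum>z\<in>W. of_bool (z \<in> Z) * e z) = (\<Sum>z\<in>Z. e z)"
    using W by (intro sum.mono_neutral_cong_right) auto
  moreover have "(\<Sum>z\<in>W. of_bool (z - a \<in> Z) * e z) = (\<Sum>z\<in>(\<lambda>z. z + a) ` Z. e z)"
    using W by (intro sum.mono_neutral_cong_right) (auto simp: image_iff, metis diff_add_cancel)
  moreover have "(\<Sum>z\<in>(\<lambda>z. z + a) ` Z. e z) = (\<Sum>z\<in>Z. e (z + a))"
    by (subst sum.reindex) (auto simp: inj_on_def)
  ultimately show ?thesis by (simp add: sum_subtractf left_diff_distrib)
qed

context cell_region
begin

text \<open>Every edge of a cell of the region is \<open>edge z k\<close> for some \<open>z\<close> in this set.\<close>
definition near_cells :: "(int ^ 2) set" where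
  "near_cells = Z \<union> (\<Union>k. (\<lambda>z. z + axis k 1) ` Z)"

lemma finite_near_cells: "finite near_cells"
  using finite_Z by (simp add: near_cells_def)

text \<open>This is \<open>1\<close> if the region lies on the left of the edge, traversed in the direction of
  increasing coordinate, \<open>-1\<close> if it lies on the right, and \<open>0\<close> if the edge is not on the boundary.\<close>
definition edge_sign :: "int ^ 2 \<Rightarrow> 2 \<Rightarrow> real" where
  "edge_sign z k = (if k = 1 then - 1 else 1) * (of_bool (z - axis (oth k) 1 \<in> Z) - of_bool (z \<in> Z))"

lemma has_integral_sum_cells:
  fixes f :: "real ^ 2 \<Rightarrow> real"
  assumes "\<And>z. z \<in> Z \<Longrightarrow> (f has_integral i z) (ccell z)"
  shows "(f has_integral (\<Sum>z\<in>Z. i z)) R"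
  unfolding R_eq
proof (rule has_integral_UN[OF finite_Z])
  show "pairwise (\<lambda>z w. negligible (ccell z \<inter> ccell w)) Z"
  proof (rule pairwiseI)
    fix z w :: "int ^ 2" assume "z \<noteq> w"
    then have "ccell z \<inter> ccell w \<subseteq> ccell z - cell z" by (auto simp: cell_ccell)
    then show "negligible (ccell z \<inter> ccell w)"
      using negligible_frontier_interval negligible_subset unfolding ccell_def cell_def by blast
  qed
qed (rule assms)

text \<open>\<open>D k\<close> is the derivative of \<open>u k\<close> in the direction other than \<open>k\<close>, so \<open>D 2 - D 1\<close> is
  the scalar curl of the field with components \<open>u 1\<close> and \<open>u 2\<close>.\<close>
lemma green_cells:
  assumes D: "\<And>k. continuous_on R (D k)" and u: "\<And>k. continuous_on R (u k)"
    and der: "\<And>k z s t. z \<in> Z \<Longrightarrow> crd k s t \<in> ccell z \<Longrightarrow>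
      ((\<lambda>s. u (oth k) (crd k s t)) has_vector_derivative D (oth k) (crd k s t)) (at s within {g k (z $ k)..g k (z $ k + 1)})"
  shows "((\<lambda>x. D 2 x - D 1 x) has_integral
           (\<Sum>z\<in>near_cells. \<Sum>k\<in>UNIV. edge_sign z k * edge_integral (u k) z k)) R"
proof -
  have *: "(D (oth k) has_integral (\<Sum>z\<in>near_cells. (of_bool (z - axis k 1 \<in> Z) - of_bool (z \<in> Z)) * edge_integral (u (oth k)) z (oth k))) R" for k
  proof -
    have "(D (oth k) has_integral (\<Sum>z\<in>Z. edge_integral (u (oth k)) (z + axis k 1) (oth k) - edge_integral (u (oth k)) z (oth k))) R"
    proof (rule has_integral_sum_cells, rule cell_integral)
      fix z assume "z \<in> Z"
      then have "ccell z \<subseteq> R" using R_eq by blast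
      then show "continuous_on (ccell z) (D (oth k))" "continuous_on (ccell z) (u (oth k))"
        using D u continuous_on_subset by blast+
    qed (use der in auto)
    then show ?thesis
      by (subst (asm) sum_by_parts[of near_cells]) (auto simp: finite_near_cells, auto simp: near_cells_def)
  qed
  have "((\<lambda>x. D 2 x - D 1 x) has_integral
     (\<Sum>z\<in>near_cells. (of_bool (z - axis 1 1 \<in> Z) - of_bool (z \<in> Z)) * edge_integral (u 2) z 2) -
     (\<Sum>z\<in>near_cells. (of_bool (z - axis 2 1 \<in> Z) - of_bool (z \<in> Z)) * edge_integral (u 1) z 1)) R"
    using has_integral_diff[OF *[of 1] *[of 2]] by simp
  then show ?thesis
    by (simp add: edge_sign_def sum_2 sum_subtractf[symmetric] algebra_simps)
qed

end

section \<open>Pulling back the vector field\<close>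

locale C2_image = surface_region +
  fixes S :: "(real ^ 2) set" and H F :: "real ^ 2 \<Rightarrow> real ^ 2"
  assumes C2: "C2_on R H" and cont_H: "continuous_on R H" and bij: "bij_betw H R S"
    and det_nonzero: "\<And>x. x \<in> R \<Longrightarrow> det (jacobian R H x) \<noteq> 0"
    and F_C1: "C1_vector_field S F"
begin

definition DH :: "2 \<Rightarrow> real ^ 2 \<Rightarrow> real ^ 2" where
  "DH k = partial R k H"

definition jac :: "real ^ 2 \<Rightarrow> real" where
  "jac x = det (jacobian R H x)"

lemma jac_eq: "jac x = DH 1 x $ 1 * DH 2 x $ 2 - DH 1 x $ 2 * DH 2 x $ 1"
  by (simp add: jac_def det_2 jacobian_def DH_def)

lemma jac_nonzero: "x \<in> R \<Longrightarrow> jac x \<noteq> 0"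
  using det_nonzero by (simp add: jac_def)

lemma H_image: "H ` R = S" and H_inj: "inj_on H R"
  using bij by (auto simp: bij_betw_def)

lemma DH_cont: "continuous_on R (DH k)"
  unfolding DH_def using C2 by (rule C2_partial_continuous)

lemma jac_cont: "continuous_on R jac"
  unfolding jac_eq by (intro continuous_intros DH_cont)

lemma sgn_jac_cont: "continuous_on R (\<lambda>x. sgn (jac x))"
  using jac_cont jac_nonzero by (intro continuous_on_sgn) auto

lemma sgn_jac_const:
  assumes "connected A" "A \<subseteq> R" "x \<in> A" "y \<in> A"
  shows "sgn (jac x) = sgn (jac y)"
proof -
  have "(\<lambda>x. sgn (jac x)) constant_on A"
  proof (rule continuous_finite_range_constant)
    show "continuous_on A (\<lambda>x. sgn (jac x))" using sgn_jac_cont assms(2) continuous_on_subset by blast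
    have "(\<lambda>x. sgn (jac x)) ` A \<subseteq> {-1, 0, 1}" by (auto simp: sgn_if)
    then show "finite ((\<lambda>x. sgn (jac x)) ` A)" by (rule finite_subset) simp
  qed fact
  then show ?thesis
    using assms by (auto simp: constant_on_def)
qed

lemma H_derivative: "x \<in> R \<Longrightarrow> (H has_derivative (\<lambda>h. jacobian R H x *v h)) (at x within R)"
  using C2 by (rule C2_has_derivative)

definition DF :: "real ^ 2 \<Rightarrow> real ^ 2 ^ 2" where
  "DF = derivative_matrix S F"

lemma F_derivative:
  assumes "y \<in> S"
  shows "(F has_derivative (\<lambda>h. DF y *v h)) (at y within S)"
proof -
  have "(F has_derivative frechet_derivative F (at y within S)) (at y within S)"
    using F_C1 assms by (auto simp: C1_vector_field_def differentiable_on_def frechet_derivative_works)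
  moreover from this have "frechet_derivative F (at y within S) = (\<lambda>h. DF y *v h)"
    by (auto simp: DF_def derivative_matrix_def has_derivative_linear matrix_works)
  ultimately show ?thesis by simp
qed

lemma F_cont: "continuous_on S F"
  using F_C1 by (simp add: C1_vector_field_def differentiable_imp_continuous_on)

lemma DF_cont: "continuous_on S DF"
  using F_C1 by (simp add: C1_vector_field_def DF_def)

text \<open>The components of the pullback of the one-form \<open>F \<bullet> ds\<close> under \<open>H\<close>.\<close>
definition pullback :: "2 \<Rightarrow> real ^ 2 \<Rightarrow> real" where
  "pullback k x = F (H x) \<bullet> DH k x"

text \<open>The derivative of \<open>pullback k\<close> in the direction other than \<open>k\<close>, by the chain and product rules.\<close>
definition Dpullback :: "2 \<Rightarrow> real ^ 2 \<Rightarrow> real" where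
  "Dpullback k x = (DF (H x) *v DH (oth k) x) \<bullet> DH k x + F (H x) \<bullet> partial R (oth k) (DH k) x"

lemma FH_cont: "continuous_on R (\<lambda>x. F (H x))"
  using continuous_on_compose2[OF F_cont cont_H] H_image by auto

lemma DFH_cont: "continuous_on R (\<lambda>x. DF (H x))"
  using continuous_on_compose2[OF DF_cont cont_H] H_image by auto

lemma pullback_cont: "continuous_on R (pullback k)"
  unfolding pullback_def by (intro continuous_intros FH_cont DH_cont)

lemma Dpullback_cont: "continuous_on R (Dpullback k)"
proof -
  have "continuous_on R (partial R (oth k) (DH k))"
    using C2 by (simp add: C2_on_def DH_def)
  then have 1: "continuous_on R (\<lambda>x. partial R (oth k) (DH k) x $ i)" for i by (intro continuous_on_component)
  have 2: "continuous_on R (\<lambda>x. DF (H x) $ i $ j)" "continuous_on R (\<lambda>x. DH m x $ i)"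
    "continuous_on R (\<lambda>x. F (H x) $ i)" for i j m
    by (intro continuous_on_component DFH_cont DH_cont FH_cont)+
  show ?thesis
    unfolding Dpullback_def inner_vec_def matrix_vector_mult_def sum_2
    by (simp add: sum_2) (intro continuous_on_add continuous_on_mult 1 2)
qed

lemma pullback_along_line:
  assumes z: "z \<in> Z" and s: "crd k s t \<in> ccell z"
  shows "((\<lambda>s. pullback (oth k) (crd k s t)) has_vector_derivative Dpullback (oth k) (crd k s t))
           (at s within {g k (z $ k)..g k (z $ k + 1)})"
proof -
  let ?I = "{g k (z $ k)..g k (z $ k + 1)}"
  have line: "crd k \<tau> t \<in> R" if "\<tau> \<in> ?I" for \<tau>
  proof -
    have "crd k \<tau> t \<in> ccell z" using s that by (simp add: crd_ccell)
    then show ?thesis using z R_eq by blast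
  qed
  have sI: "s \<in> ?I" and xR: "crd k s t \<in> R" using s line by (auto simp: crd_ccell)
  have H: "((\<lambda>s. H (crd k s t)) has_vector_derivative DH k (crd k s t)) (at s within ?I)"
    unfolding DH_def by (rule partial_along_line) (use C2 line sI in \<open>auto simp: C2_on_def\<close>)
  have DH: "((\<lambda>s. DH (oth k) (crd k s t)) has_vector_derivative partial R k (DH (oth k)) (crd k s t)) (at s within ?I)"
    by (rule partial_along_line) (use C2 line sI in \<open>auto simp: C2_on_def DH_def\<close>)
  have "(F has_derivative (\<lambda>h. DF (H (crd k s t)) *v h)) (at (H (crd k s t)) within (\<lambda>s. H (crd k s t)) ` ?I)"
  proof (rule has_derivative_subset[OF F_derivative])
    show "H (crd k s t) \<in> S" "(\<lambda>s. H (crd k s t)) ` ?I \<subseteq> S" using xR line H_image by blast+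
  qed
  from vector_derivative_diff_chain_within[OF H this]
  have F: "((\<lambda>s. F (H (crd k s t))) has_vector_derivative DF (H (crd k s t)) *v DH k (crd k s t)) (at s within ?I)"
    by (simp add: o_def)
  show ?thesis
    using bounded_bilinear.has_vector_derivative[OF bounded_bilinear_inner F DH]
    unfolding pullback_def Dpullback_def by (simp add: add.commute)
qed

text \<open>The terms with second derivatives of \<open>H\<close> cancel.\<close>
lemma Dpullback_diff:
  assumes "z \<in> Z" "x \<in> cell z"
  shows "Dpullback 2 x - Dpullback 1 x = jac x * scurl S F (H x)"
proof -
  have "partial R 1 (DH 2) x = partial R 2 (DH 1) x"
    unfolding DH_def using C2 assms by (rule mixed_partials_eq)
  then show ?thesis
    by (simp add: Dpullback_def jac_eq scurl_def DF_def[symmetric] inner_vec_def matrix_vector_mult_def sum_2 algebra_simps)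
qed

text \<open>The sign makes up for the orientation: where \<open>H\<close> reverses it, the image of a boundary with \<open>R\<close> on
  the left has \<open>S\<close> on the right.\<close>
definition signed_pullback :: "2 \<Rightarrow> real ^ 2 \<Rightarrow> real" where
  "signed_pullback k x = sgn (jac x) * pullback k x"

lemma signed_pullback_cont: "continuous_on R (signed_pullback k)"
  unfolding signed_pullback_def by (intro continuous_intros sgn_jac_cont pullback_cont)

lemma pulled_back_integral:
  "((\<lambda>x. \<bar>jac x\<bar> * scurl S F (H x)) has_integral
     (\<Sum>z\<in>near_cells. \<Sum>k\<in>UNIV. edge_sign z k * edge_integral (signed_pullback k) z k)) R"
proof (rule has_integral_spike)
  show "((\<lambda>x. sgn (jac x) * Dpullback 2 x - sgn (jac x) * Dpullback 1 x) has_integral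
     (\<Sum>z\<in>near_cells. \<Sum>k\<in>UNIV. edge_sign z k * edge_integral (signed_pullback k) z k)) R"
  proof (rule green_cells[where D = "\<lambda>k x. sgn (jac x) * Dpullback k x"])
    show "continuous_on R (\<lambda>x. sgn (jac x) * Dpullback k x)" for k
      by (intro continuous_intros sgn_jac_cont Dpullback_cont)
    fix k z s t assume z: "z \<in> Z" and s: "crd k s t \<in> ccell z"
    let ?I = "{g k (z $ k)..g k (z $ k + 1)}"
    have sI: "s \<in> ?I" and line: "\<And>\<tau>. \<tau> \<in> ?I \<Longrightarrow> crd k \<tau> t \<in> ccell z"
      using s by (auto simp: crd_ccell)
    have "((\<lambda>s'. sgn (jac (crd k s t)) * pullback (oth k) (crd k s' t)) has_vector_derivative
        sgn (jac (crd k s t)) * Dpullback (oth k) (crd k s t)) (at s within ?I)"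
      using pullback_along_line[OF z s] by (rule has_vector_derivative_mult_right)
    then show "((\<lambda>s. signed_pullback (oth k) (crd k s t)) has_vector_derivative
        sgn (jac (crd k s t)) * Dpullback (oth k) (crd k s t)) (at s within ?I)"
    proof (rule has_vector_derivative_transform[OF sI, rotated])
      fix s' assume "s' \<in> ?I"
      then have "sgn (jac (crd k s' t)) = sgn (jac (crd k s t))"
        using line s z R_eq by (intro sgn_jac_const[of "ccell z"]) (auto simp: ccell_def convex_connected)
      then show "signed_pullback (oth k) (crd k s' t) = sgn (jac (crd k s t)) * pullback (oth k) (crd k s' t)"
        by (simp add: signed_pullback_def)
    qed
  qed (rule signed_pullback_cont)
  show "negligible (\<Union>z\<in>Z. ccell z - cell z)"
    using finite_Z by (intro negligible_Union) (auto simp: ccell_def cell_def negligible_frontier_interval)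
  fix x assume "x \<in> R - (\<Union>z\<in>Z. ccell z - cell z)"
  then obtain z where "z \<in> Z" "x \<in> cell z" using R_eq by blast
  then show "\<bar>jac x\<bar> * scurl S F (H x) = sgn (jac x) * Dpullback 2 x - sgn (jac x) * Dpullback 1 x"
    using Dpullback_diff by (simp add: right_diff_distrib[symmetric] abs_sgn mult.commute mult.assoc)
qed

lemma scurl_has_integral:
  "(scurl S F has_integral
     (\<Sum>z\<in>near_cells. \<Sum>k\<in>UNIV. edge_sign z k * edge_integral (signed_pullback k) z k)) S"
proof -
  define I where "I = (\<Sum>z\<in>near_cells. \<Sum>k\<in>UNIV. edge_sign z k * edge_integral (signed_pullback k) z k)"
  have cont: "continuous_on R (\<lambda>x. \<bar>jac x\<bar> * scurl S F (H x))"
    unfolding scurl_def DF_def[symmetric] by (intro continuous_intros jac_cont DFH_cont)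
  have abs: "(\<lambda>x. \<bar>jac x\<bar> * scurl S F (H x)) absolutely_integrable_on R"
    using borel_integrable_compact[OF compact_R cont] by (simp add: set_integrable_def integrable_completion)
  define f :: "real ^ 2 \<Rightarrow> real ^ 1" where "f y = vec (scurl S F y)" for y
  have "(\<lambda>x. \<bar>det (matrix (\<lambda>h. jacobian R H x *v h))\<bar> *\<^sub>R f (H x)) absolutely_integrable_on R \<and>
      integral R (\<lambda>x. \<bar>det (matrix (\<lambda>h. jacobian R H x *v h))\<bar> *\<^sub>R f (H x)) = vec I"
    using abs pulled_back_integral[folded I_def]
    by (simp add: absolutely_integrable_on_1_iff integral_on_1_eq f_def jac_def integral_unique)
  then have "f absolutely_integrable_on H ` R \<and> integral (H ` R) f = vec I"
    by (subst (asm) has_absolute_integral_change_of_variables_compact[OF compact_R H_derivative H_inj])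
  then have "scurl S F absolutely_integrable_on S \<and> integral S (scurl S F) = I"
    by (simp add: absolutely_integrable_on_1_iff integral_on_1_eq f_def H_image vec_eq_iff)
  then show ?thesis
    unfolding I_def[symmetric] by (metis absolutely_integrable_on_def has_integral_iff)
qed

end

section \<open>The two sides of a boundary edge\<close>

context cell_region
begin

text \<open>Along a boundary edge the region lies, locally, on exactly one side. The number \<open>side z k\<close> is \<open>1\<close>
  or \<open>-1\<close> according to whether it is the side of smaller or of larger transversal coordinate.\<close>
definition side :: "int ^ 2 \<Rightarrow> 2 \<Rightarrow> real" where
  "side z k = of_bool (z - axis (oth k) 1 \<in> Z) - of_bool (z \<in> Z)"

lemma edge_sign_side: "edge_sign z k = (if k = 1 then - 1 else 1) * side z k"
  by (simp add: edge_sign_def side_def)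

lemma edge_sign_nonzero_iff: "p \<in> edge z k \<Longrightarrow> edge_sign z k \<noteq> 0 \<longleftrightarrow> p \<in> R - interior R"
  by (subst edge_boundary_iff) (auto simp: edge_sign_def)

lemma side_cases: "edge_sign z k \<noteq> 0 \<Longrightarrow> side z k = 1 \<or> side z k = - 1"
  by (auto simp: edge_sign_def side_def)

text \<open>Close to a point of the edge there are only the two adjacent cells, of which exactly one is in the
  region.\<close>
lemma edge_local:
  assumes p: "p \<in> edge z k" and nz: "edge_sign z k \<noteq> 0"
  obtains e where "e > 0"
    "\<And>q. q \<in> R \<Longrightarrow> dist q p < e \<Longrightarrow> side z k * (q $ oth k - p $ oth k) \<le> 0"
    "\<And>q. dist q p < e \<Longrightarrow> side z k * (q $ oth k - p $ oth k) < 0 \<Longrightarrow> q \<in> interior R"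
proof -
  obtain e where e: "e > 0" "\<And>q w. dist q p < e \<Longrightarrow> q \<in> ccell w \<Longrightarrow> p \<in> ccell w"
    using ccell_local by blast
  have near: "w = z \<and> q $ oth k \<ge> p $ oth k \<or> w = z - axis (oth k) 1 \<and> q $ oth k \<le> p $ oth k"
    if "dist q p < e" "q \<in> ccell w" for q w
  proof -
    have "w = z \<or> w = z - axis (oth k) 1" using e(2)[OF that] edge_ccell[OF p] by blast
    moreover have "p $ oth k = g (oth k) (z $ oth k)" using p by (simp add: edge_def)
    ultimately show ?thesis using that(2) unfolding mem_ccell all_coords[of _ k] by auto
  qed
  have one: "(z \<in> Z) \<noteq> (z - axis (oth k) 1 \<in> Z)" using nz by (auto simp: edge_sign_def)
  show thesis
  proof (rule that[OF e(1)])
    fix q assume q: "q \<in> R" "dist q p < e"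
    then obtain w where "w \<in> Z" "q \<in> ccell w" using R_eq by blast
    then show "side z k * (q $ oth k - p $ oth k) \<le> 0"
      using near[OF q(2)] one by (cases "z \<in> Z") (auto simp: side_def)
  next
    fix q assume q: "dist q p < e" "side z k * (q $ oth k - p $ oth k) < 0"
    have "w \<in> Z" if "q \<in> ccell w" for w
      using near[OF q(1) that] one q(2) by (cases "z \<in> Z") (auto simp: side_def)
    then show "q \<in> interior R" using interior_R_iff by blast
  qed
qed

end

context C2_image
begin

definition K :: "real ^ 2 \<Rightarrow> real ^ 2" where
  "K = inv_into R H"

lemma K_H [simp]: "x \<in> R \<Longrightarrow> K (H x) = x"
  by (simp add: K_def H_inj)

lemma H_K [simp]: "y \<in> S \<Longrightarrow> H (K y) = y" and K_in_R: "y \<in> S \<Longrightarrow> K y \<in> R"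
  using H_image by (auto simp: K_def f_inv_into_f inv_into_into)

lemma K_cont: "continuous_on S K"
  using continuous_on_inv[OF cont_H compact_R, of K] H_image by auto

lemma homeo: "homeomorphism R S H K"
  using cont_H K_cont H_image K_in_R by (auto simp: homeomorphism_def image_iff)

lemma compact_S: "compact S"
  using compact_continuous_image[OF cont_H compact_R] H_image by simp

lemma boundary_S: "surface_boundary S = H ` (R - interior R)"
  using homeomorphism_image_surface_boundary[OF homeo] by (simp add: surface_boundary_eq)

lemma frontier_S: "frontier S = surface_boundary S"
  using compact_imp_closed[OF compact_S] by (simp add: frontier_def surface_boundary_eq closure_closed)

lemma K_boundary: "y \<in> surface_boundary S \<Longrightarrow> K y \<in> R - interior R"
  unfolding boundary_S by auto

definition Jinv :: "real ^ 2 \<Rightarrow> real ^ 2 \<Rightarrow> real ^ 2" where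
  "Jinv x h = matrix_inv (jacobian R H x) *v h"

lemma linear_Jinv: "linear (Jinv x)"
  unfolding Jinv_def by (rule matrix_vector_mul_linear)

lemma J_Jinv: "x \<in> R \<Longrightarrow> jacobian R H x *v Jinv x h = h"
  and Jinv_J: "x \<in> R \<Longrightarrow> Jinv x (jacobian R H x *v h) = h"
proof -
  assume "x \<in> R"
  then have "invertible (jacobian R H x)" using det_nonzero by (simp add: invertible_det_nz)
  then have "jacobian R H x ** matrix_inv (jacobian R H x) = mat 1 \<and> matrix_inv (jacobian R H x) ** jacobian R H x = mat 1"
    unfolding invertible_def matrix_inv_def by (rule someI_ex)
  then show "jacobian R H x *v Jinv x h = h" "Jinv x (jacobian R H x *v h) = h"
    by (simp_all add: Jinv_def matrix_vector_mul_assoc)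
qed

lemma J_mult: "jacobian R H x *v h = h $ k *\<^sub>R DH k x + h $ oth k *\<^sub>R DH (oth k) x"
  using exhaust_2[of k] by (auto simp: jacobian_mult DH_def add.commute)

lemma DH_nonzero: "x \<in> R \<Longrightarrow> DH k x \<noteq> 0"
  using jac_nonzero[of x] exhaust_2[of k] by (auto simp: jac_eq)

text \<open>The inverse of a continuous injective map on a compact set is continuous, which is enough for its
  differentiability at the image of a point with invertible derivative.\<close>
lemma K_derivative:
  assumes "x \<in> R"
  shows "(K has_derivative Jinv x) (at (H x) within S)"
proof -
  have "(K has_derivative Jinv x) (at (H x) within H ` R)"
  proof (rule has_derivative_inverse_within[OF H_derivative[OF assms]])
    show "continuous (at (H x) within H ` R) K"
      using K_cont H_image assms by (auto simp: continuous_on_eq_continuous_within)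
    show "Jinv x \<circ> (\<lambda>h. jacobian R H x *v h) = id" using Jinv_J assms by auto
  qed (use assms linear_Jinv in auto)
  then show ?thesis by (simp add: H_image)
qed

text \<open>Cramer's rule for the left normal of \<open>c *\<^sub>R DH k x\<close> in the basis \<open>DH 1 x\<close>, \<open>DH 2 x\<close>.\<close>
lemma Jinv_left_normal:
  assumes "x \<in> R"
  shows "Jinv x (left_normal (c *\<^sub>R DH k x)) $ oth k * jac x
    = - (if k = 1 then - 1 else 1) * c * (DH k x \<bullet> DH k x)"
proof -
  define h where "h = Jinv x (left_normal (c *\<^sub>R DH k x))"
  have "left_normal (c *\<^sub>R DH k x) = h $ 1 *\<^sub>R DH 1 x + h $ 2 *\<^sub>R DH 2 x"
    using J_Jinv[OF assms] J_mult[of x _ 1] unfolding h_def by (metis oth_simps(1))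
  then have eq: "- (c * DH k x $ 2) = h $ 1 * DH 1 x $ 1 + h $ 2 * DH 2 x $ 1"
    "c * DH k x $ 1 = h $ 1 * DH 1 x $ 2 + h $ 2 * DH 2 x $ 2"
    by (auto simp: left_normal_def vec_eq_iff forall_2)
  show ?thesis
    using exhaust_2[of k]
  proof
    assume k: "k = 1"
    have "h $ 2 * jac x = DH 1 x $ 1 * (c * DH k x $ 1) - DH 1 x $ 2 * (- (c * DH k x $ 2))"
      unfolding eq by (simp add: jac_eq algebra_simps)
    then show ?thesis using k unfolding h_def by (simp add: inner_vec_def sum_2 algebra_simps)
  next
    assume k: "k = 2"
    have "h $ 1 * jac x = (- (c * DH k x $ 2)) * DH 2 x $ 2 - (c * DH k x $ 1) * DH 2 x $ 1"
      unfolding eq by (simp add: jac_eq algebra_simps)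
    then show ?thesis using k unfolding h_def by (simp add: inner_vec_def sum_2 algebra_simps)
  qed
qed

text \<open>The inverse map, seen from a boundary edge: its transversal component is approximated by
  a linear functional.\<close>
lemma transversal_approx:
  assumes p: "p \<in> edge z k" and nz: "edge_sign z k \<noteq> 0" and "\<kappa> > 0"
  obtains d where "d > 0"
    "\<And>y. y \<in> S \<Longrightarrow> norm (y - H p) < d \<Longrightarrow> 
       \<bar>side z k * (K y $ oth k - p $ oth k) - side z k * Jinv p (y - H p) $ oth k\<bar> \<le> \<kappa> * norm (y - H p)"
    "\<And>y. y \<in> S \<Longrightarrow> norm (y - H p) < d \<Longrightarrow> side z k * (K y $ oth k - p $ oth k) \<le> 0"
    "\<And>y. y \<in> surface_boundary S \<Longrightarrow> norm (y - H p) < d \<Longrightarrow> K y $ oth k = p $ oth k"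
proof -
  have pR: "p \<in> R" using edge_sign_nonzero_iff[OF p] nz by blast
  then have HpS: "H p \<in> S" using H_image by blast
  obtain e where e: "e > 0"
    "\<And>q. q \<in> R \<Longrightarrow> dist q p < e \<Longrightarrow> side z k * (q $ oth k - p $ oth k) \<le> 0"
    "\<And>q. dist q p < e \<Longrightarrow> side z k * (q $ oth k - p $ oth k) < 0 \<Longrightarrow> q \<in> interior R"
    using edge_local[OF p nz] by blast
  obtain d1 where d1: "d1 > 0" "\<And>y. y \<in> S \<Longrightarrow> norm (y - H p) < d1 \<Longrightarrow> norm (K y - K (H p) - Jinv p (y - H p)) \<le> \<kappa> * norm (y - H p)"
    using K_derivative[OF pR] \<open>\<kappa> > 0\<close> unfolding has_derivative_within_alt by blast
  obtain d2 where d2: "d2 > 0" "\<And>y. y \<in> S \<Longrightarrow> dist y (H p) < d2 \<Longrightarrow> dist (K y) (K (H p)) < e"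
    using K_cont HpS e(1) unfolding continuous_on_iff by blast
  show thesis
  proof (rule that[of "min d1 d2"])
    show "min d1 d2 > 0" using d1 d2 by simp
  next
    fix y assume y: "y \<in> S" "norm (y - H p) < min d1 d2"
    have "\<bar>(K y - p - Jinv p (y - H p)) $ oth k\<bar> \<le> \<kappa> * norm (y - H p)"
      using d1(2)[of y] y component_le_norm_cart[of "K y - p - Jinv p (y - H p)" "oth k"] pR by simp
    moreover have "side z k * (K y $ oth k - p $ oth k) - side z k * Jinv p (y - H p) $ oth k
        = side z k * (K y - p - Jinv p (y - H p)) $ oth k"
      by (simp add: algebra_simps)
    moreover have "\<bar>side z k\<bar> = 1" using side_cases[OF nz] by auto
    ultimately show "\<bar>side z k * (K y $ oth k - p $ oth k) - side z k * Jinv p (y - H p) $ oth k\<bar> \<le> \<kappa> * norm (y - H p)"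
      by (simp only: abs_mult mult_1)
    show "side z k * (K y $ oth k - p $ oth k) \<le> 0"
      using e(2)[of "K y"] K_in_R d2(2)[of y] y pR by (simp add: dist_norm)
  next
    fix y assume y: "y \<in> surface_boundary S" "norm (y - H p) < min d1 d2"
    then have "y \<in> S" by (auto simp: surface_boundary_eq)
    then have near: "dist (K y) p < e" using d2(2)[of y] y pR by (simp add: dist_norm)
    have "K y \<in> R" "K y \<notin> interior R" using K_boundary[OF y(1)] by auto
    then have "side z k * (K y $ oth k - p $ oth k) = 0"
      using e(2)[OF _ near] e(3)[OF near] by force
    then show "K y $ oth k = p $ oth k" using side_cases[OF nz] by auto
  qed
qed

text \<open>By the linear approximation, the inverse map would send a point of \<open>S\<close> in the outward direction to
  the wrong side of the edge.\<close>
lemma outward_not_in_S: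
  assumes p: "p \<in> edge z k" and nz: "edge_sign z k \<noteq> 0" and n: "side z k * Jinv p n $ oth k > 0"
  shows "\<exists>\<epsilon>>0. \<forall>s\<in>{0<..<\<epsilon>}. H p + s *\<^sub>R n \<notin> S"
proof -
  define l where "l = side z k * Jinv p n $ oth k"
  define \<kappa> where "\<kappa> = l / (2 * (norm n + 1))"
  have "l > 0" using n by (simp add: l_def)
  then have \<kappa>: "\<kappa> > 0" "\<kappa> * norm n < l"
    by (auto simp: \<kappa>_def field_simps add_pos_nonneg add_nonneg_pos)
  obtain d where d: "d > 0"
    "\<And>y. y \<in> S \<Longrightarrow> norm (y - H p) < d \<Longrightarrow> 
       \<bar>side z k * (K y $ oth k - p $ oth k) - side z k * Jinv p (y - H p) $ oth k\<bar> \<le> \<kappa> * norm (y - H p)"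
    "\<And>y. y \<in> S \<Longrightarrow> norm (y - H p) < d \<Longrightarrow> side z k * (K y $ oth k - p $ oth k) \<le> 0"
    using transversal_approx[OF p nz \<kappa>(1)] by metis
  have "H p + s *\<^sub>R n \<notin> S" if s: "0 < s" "s < d / (norm n + 1)" for s
  proof
    assume S: "H p + s *\<^sub>R n \<in> S"
    have "s * (norm n + 1) < d" using s by (simp add: pos_less_divide_eq add_nonneg_pos)
    then have "s * norm n < d" using s by (simp add: algebra_simps)
    then have near: "norm (H p + s *\<^sub>R n - H p) < d" using s by simp
    have "Jinv p (s *\<^sub>R n) = s *\<^sub>R Jinv p n" using linear_Jinv by (rule linear_scale)
    then have "\<bar>side z k * (K (H p + s *\<^sub>R n) $ oth k - p $ oth k) - s * l\<bar> \<le> \<kappa> * (s * norm n)"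
      using d(2)[OF S near] s by (simp add: l_def mult.left_commute)
    then have "s * l - \<kappa> * (s * norm n) \<le> 0" using d(3)[OF S near] by linarith
    moreover have "\<kappa> * (s * norm n) < s * l" using \<kappa>(2) s by (simp add: mult.left_commute)
    ultimately show False by linarith
  qed
  moreover have "d / (norm n + 1) > 0" using d(1) by (simp add: add_nonneg_pos)
  ultimately show ?thesis by (intro exI[of _ "d / (norm n + 1)"]) auto
qed

text \<open>On a thin convex cone around the inward direction the transversal component of the inverse map lies
  strictly on the side of \<open>R\<close>, whereas on the boundary of \<open>S\<close> it is constant near \<open>H p\<close>. So the
  cone does not meet the boundary. Since it contains images of interior points of \<open>R\<close>, it lies
  in \<open>S\<close>.\<close>
lemma inward_in_S:
  assumes p: "p \<in> edge z k" and nz: "edge_sign z k \<noteq> 0" and n: "side z k * Jinv p n $ oth k < 0"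
  shows "\<exists>\<epsilon>>0. \<forall>s\<in>{0<..<\<epsilon>}. H p + s *\<^sub>R n \<in> S"
proof -
  let ?m = "oth k"
  have pR: "p \<in> R" using edge_sign_nonzero_iff[OF p] nz by blast
  define lam where "lam h = side z k * Jinv p h $ ?m" for h
  have lin: "lam (a + b) = lam a + lam b" "lam (c *\<^sub>R a) = c * lam a" for a b c
    using linear_add[OF linear_Jinv] linear_scale[OF linear_Jinv] by (simp_all add: lam_def algebra_simps)
  obtain e where e: "e > 0"
    "\<And>q. dist q p < e \<Longrightarrow> side z k * (q $ ?m - p $ ?m) < 0 \<Longrightarrow> q \<in> interior R"
    using edge_local[OF p nz] by metis
  obtain B where B: "\<And>h. norm (jacobian R H p *v h) \<le> norm h * B" "B > 0"
    using bounded_linear.pos_bounded[OF matrix_vector_mul_bounded_linear] by blast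
  obtain d0 where d0: "d0 > 0" "\<And>q. q \<in> R \<Longrightarrow> norm (q - p) < d0 \<Longrightarrow> norm (H q - H p - jacobian R H p *v (q - p)) \<le> 1 * norm (q - p)"
    using H_derivative[OF pR] zero_less_one unfolding has_derivative_within_alt by blast
  define M where "M = B + 1"
  have lip: "norm (H q - H p) \<le> M * norm (q - p)" if "q \<in> R" "norm (q - p) < d0" for q
    using d0(2)[OF that] B(1)[of "q - p"] norm_triangle_sub[of "H q - H p" "jacobian R H p *v (q - p)"]
    by (simp add: M_def algebra_simps)
  have M: "M > 0" using B by (simp add: M_def)
  \<comment> \<open>The first bound puts \<open>n\<close> into the cone, the second one puts images of interior points into it.\<close>
  define \<kappa> where "\<kappa> = min (- lam n / (2 * (norm n + 1))) (1 / (3 * M))"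
  have ln: "- lam n > 0" using n by (simp add: lam_def)
  have \<kappa>0: "\<kappa> > 0" using ln M unfolding \<kappa>_def min_less_iff_conj
    by (intro conjI divide_pos_pos) (auto simp: add_nonneg_pos)
  have "\<kappa> * norm n \<le> - lam n / (2 * (norm n + 1)) * norm n"
    by (intro mult_right_mono) (auto simp: \<kappa>_def)
  also have "\<dots> = - lam n * (norm n / (2 * (norm n + 1)))" by simp
  also have "\<dots> < - lam n * 1"
  proof (rule mult_strict_left_mono[OF _ ln])
    have *: "r / (2 * (r + 1)) < 1" if "r \<ge> 0" for r :: real
      using that by (simp add: divide_less_eq)
    show "norm n / (2 * (norm n + 1)) < 1" by (rule *) (rule norm_ge_zero)
  qed
  finally have \<kappa>n: "\<kappa> * norm n < - lam n" by simp
  have "\<kappa> \<le> 1 / (3 * M)" by (simp add: \<kappa>_def)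
  then have \<kappa>M: "3 * (\<kappa> * M) \<le> 1" using M by (simp add: field_simps)
  obtain d where d: "d > 0"
    "\<And>y. y \<in> S \<Longrightarrow> norm (y - H p) < d \<Longrightarrow> \<bar>side z k * (K y $ ?m - p $ ?m) - lam (y - H p)\<bar> \<le> \<kappa> * norm (y - H p)"
    "\<And>y. y \<in> surface_boundary S \<Longrightarrow> norm (y - H p) < d \<Longrightarrow> K y $ ?m = p $ ?m"
    using transversal_approx[OF p nz \<kappa>0] unfolding lam_def by metis
  define \<Gamma> where "\<Gamma> = {y. norm (y - H p) < d \<and> lam (y - H p) + \<kappa> * norm (y - H p) < 0}"
  have "convex \<Gamma>"
  proof (rule convexI)
    fix x y u v :: real and a b assume *: "a \<in> \<Gamma>" "b \<in> \<Gamma>" "0 \<le> u" "0 \<le> v" "u + v = 1"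
    have eq: "u *\<^sub>R a + v *\<^sub>R b - H p = u *\<^sub>R (a - H p) + v *\<^sub>R (b - H p)"
      using *(5) by (simp add: algebra_simps flip: scaleR_add_left)
    have le: "norm (u *\<^sub>R a + v *\<^sub>R b - H p) \<le> u * norm (a - H p) + v * norm (b - H p)"
      unfolding eq using norm_triangle_ineq[of "u *\<^sub>R (a - H p)" "v *\<^sub>R (b - H p)"] * by simp
    have cc: "u * r + v * s < c" if "r < c" "s < c" for r s c
      using convex_bound_lt[OF that *(3-5)] .
    have "norm (u *\<^sub>R a + v *\<^sub>R b - H p) < d"
      using le cc[of "norm (a - H p)" d "norm (b - H p)"] * by (simp add: \<Gamma>_def)
    moreover have "lam (u *\<^sub>R a + v *\<^sub>R b - H p) + \<kappa> * norm (u *\<^sub>R a + v *\<^sub>R b - H p)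
        \<le> u * (lam (a - H p) + \<kappa> * norm (a - H p)) + v * (lam (b - H p) + \<kappa> * norm (b - H p))"
      using mult_left_mono[OF le less_imp_le[OF \<kappa>0]] unfolding eq lin by (simp add: algebra_simps)
    moreover have "\<dots> < 0" by (rule cc) (use * in \<open>auto simp: \<Gamma>_def\<close>)
    ultimately show "u *\<^sub>R a + v *\<^sub>R b \<in> \<Gamma>" by (simp add: \<Gamma>_def)
  qed
  have "y \<notin> frontier S" if "y \<in> \<Gamma>" for y
  proof
    assume y: "y \<in> frontier S"
    then have "K y $ ?m = p $ ?m" "y \<in> S" using d(3)[of y] that by (auto simp: \<Gamma>_def frontier_S surface_boundary_eq)
    then show False using d(2)[of y] that by (auto simp: \<Gamma>_def)
  qed
  then have disj: "\<Gamma> \<inter> frontier S = {}" by blast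
  have "\<Gamma> \<inter> S \<noteq> {}"
  proof -
    have "0 < min (min e d0) (d / M)" using e(1) d0(1) d(1) M by simp
    then obtain s where "0 < s" "s < min (min e d0) (d / M)" using dense by blast
    then have s: "s > 0" "s < e" "s < d0" "s < d / M" by simp_all
    \<comment> \<open>A point at distance \<open>s\<close> from \<open>p\<close> in the inward transversal direction.\<close>
    define q where "q = p - (s * side z k) *\<^sub>R axis ?m 1"
    have side2: "side z k * side z k = 1" "\<bar>side z k\<bar> = 1" using side_cases[OF nz] by auto
    have nq: "norm (q - p) = s" using s side2 by (simp add: q_def abs_mult)
    have sd: "side z k * (q $ ?m - p $ ?m) = - s" using side2 by (simp add: q_def algebra_simps)
    then have "q \<in> interior R" using e(2)[of q] s nq by (simp add: dist_norm)
    then have qR: "q \<in> R" using interior_subset by blast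
    have HqS: "H q \<in> S" using qR H_image by blast
    have ns: "norm (H q - H p) \<le> M * s" using lip[OF qR] nq s by simp
    then have nd: "norm (H q - H p) < d" using s M by (simp add: field_simps)
    have "lam (H q - H p) \<le> - s + \<kappa> * norm (H q - H p)"
      using d(2)[OF HqS nd] sd qR by simp
    then have "lam (H q - H p) + \<kappa> * norm (H q - H p) \<le> - s + 2 * (\<kappa> * norm (H q - H p))" by simp
    also have "\<dots> \<le> - s + 2 * (\<kappa> * (M * s))" using ns \<kappa>0 by simp
    also have "\<dots> < 0" using \<kappa>M s mult_right_mono[OF \<kappa>M, of s] by (simp add: algebra_simps)
    finally have "H q \<in> \<Gamma>" using nd by (simp add: \<Gamma>_def)
    then show ?thesis using HqS by blast
  qed
  then have "\<Gamma> \<subseteq> S"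
    using connected_Int_frontier[OF convex_connected[OF \<open>convex \<Gamma>\<close>], of S] disj by blast
  moreover have "H p + s *\<^sub>R n \<in> \<Gamma>" if s: "0 < s" "s < d / (norm n + 1)" for s
  proof -
    have "s * (norm n + 1) < d" using s by (simp add: pos_less_divide_eq add_nonneg_pos)
    then have "s * norm n < d" using s by (simp add: algebra_simps)
    moreover have "s * (lam n + \<kappa> * norm n) < 0" using \<kappa>n s by (simp add: mult_less_0_iff)
    ultimately show ?thesis using s by (simp add: \<Gamma>_def lin algebra_simps)
  qed
  moreover have "d / (norm n + 1) > 0" using d(1) by (simp add: add_nonneg_pos)
  ultimately show ?thesis by (intro exI[of _ "d / (norm n + 1)"]) auto
qed

text \<open>This decides on which side of the image of an edge the left normal of a velocity
  \<open>c *\<^sub>R DH k p\<close> points. By Cramer's rule the transversal component of its preimage has a sign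
  determined by \<open>k\<close>, \<open>c\<close> and the Jacobian; it is compared with the side of the region.\<close>
lemma left_side_iff:
  assumes p: "p \<in> edge z k" and nz: "edge_sign z k \<noteq> 0" and "c \<noteq> 0"
  defines "n \<equiv> left_normal (c *\<^sub>R DH k p)"
  shows "side z k * Jinv p n $ oth k < 0 \<longleftrightarrow> edge_sign z k * sgn (jac p) * c > 0"
    and "side z k * Jinv p n $ oth k \<noteq> 0"
proof -
  have pR: "p \<in> R" using edge_sign_nonzero_iff[OF p] nz by blast
  define D where "D = DH k p \<bullet> DH k p"
  have D: "D > 0" using DH_nonzero[OF pR] by (simp add: D_def)
  have j: "jac p \<noteq> 0" using jac_nonzero pR by blast
  have "Jinv p n $ oth k = - (if k = 1 then - 1 else 1) * c * D / jac p"
    using Jinv_left_normal[OF pR, of c k] j by (simp add: n_def D_def field_simps)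
  then have eq: "side z k * Jinv p n $ oth k = - ((edge_sign z k * c / jac p) * D)"
    by (simp add: edge_sign_side)
  show "side z k * Jinv p n $ oth k \<noteq> 0" unfolding eq using nz j D \<open>c \<noteq> 0\<close> by simp
  show "side z k * Jinv p n $ oth k < 0 \<longleftrightarrow> edge_sign z k * sgn (jac p) * c > 0"
    unfolding eq using D j by (auto simp: zero_less_mult_iff sgn_if zero_less_divide_iff mult_less_0_iff divide_less_0_iff)
qed

lemma left_imp_sign:
  assumes p: "p \<in> edge z k" and nz: "edge_sign z k \<noteq> 0" and "c \<noteq> 0"
    and left: "\<exists>\<epsilon>>0. \<forall>s\<in>{0<..<\<epsilon>}. H p + s *\<^sub>R left_normal (c *\<^sub>R DH k p) \<in> S"
  shows "edge_sign z k * sgn (jac p) * c > 0"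
proof (rule ccontr)
  let ?n = "left_normal (c *\<^sub>R DH k p)"
  assume "\<not> ?thesis"
  then have "side z k * Jinv p ?n $ oth k > 0"
    using left_side_iff[OF assms(1-3)] by linarith
  then obtain \<epsilon> where "\<epsilon> > 0" "\<forall>s\<in>{0<..<\<epsilon>}. H p + s *\<^sub>R ?n \<notin> S" using outward_not_in_S[OF p nz] by blast
  moreover obtain \<epsilon>' where "\<epsilon>' > 0" "\<forall>s\<in>{0<..<\<epsilon>'}. H p + s *\<^sub>R ?n \<in> S" using left by blast
  ultimately show False by (auto dest!: bspec[of _ _ "min \<epsilon> \<epsilon>' / 2"] simp: min_def split: if_splits)
qed

lemma sign_imp_left:
  assumes p: "p \<in> edge z k" and nz: "edge_sign z k \<noteq> 0" and c: "edge_sign z k * sgn (jac p) * c > 0"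
  shows "\<exists>\<epsilon>>0. \<forall>s\<in>{0<..<\<epsilon>}. H p + s *\<^sub>R left_normal (c *\<^sub>R DH k p) \<in> S \<and>
     H p - s *\<^sub>R left_normal (c *\<^sub>R DH k p) \<notin> S"
proof -
  let ?n = "left_normal (c *\<^sub>R DH k p)"
  have "c \<noteq> 0" using c by auto
  then have neg: "side z k * Jinv p ?n $ oth k < 0" using left_side_iff[OF p nz] c by blast
  obtain \<epsilon> where \<epsilon>: "\<epsilon> > 0" "\<forall>s\<in>{0<..<\<epsilon>}. H p + s *\<^sub>R ?n \<in> S" using inward_in_S[OF p nz neg] by blast
  have "Jinv p (- ?n) = - Jinv p ?n" using linear_Jinv by (rule linear_neg)
  then have "side z k * Jinv p (- ?n) $ oth k > 0" using neg by simp
  then obtain \<epsilon>' where \<epsilon>': "\<epsilon>' > 0" "\<forall>s\<in>{0<..<\<epsilon>'}. H p + s *\<^sub>R (- ?n) \<notin> S" using outward_not_in_S[OF p nz] by blast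
  show ?thesis using \<epsilon> \<epsilon>' by (intro exI[of _ "min \<epsilon> \<epsilon>'"]) auto
qed

end

section \<open>Line integrals along the boundary\<close>

context grid
begin

lemma edge_unique:
  assumes "p \<in> edge z k" "p \<in> edge w l"
  shows "z = w" "k = l"
proof -
  show kl: "k = l"
  proof (rule ccontr)
    assume "k \<noteq> l"
    then have "l = oth k" using neq_iff_oth by blast
    then have "g l (z $ l) = p $ l" "g l (w $ l) < p $ l" "p $ l < g l (w $ l + 1)" using assms by (auto simp: edge_def)
    then have "g l (w $ l) < g l (z $ l)" "g l (z $ l) < g l (w $ l + 1)" by simp_all
    then show False by simp
  qed
  have "w $ k = z $ k" using assms between_unique[of k "z $ k" "p $ k" "w $ k"] by (auto simp: edge_def kl less_imp_le)
  moreover have "g (oth k) (w $ oth k) = g (oth k) (z $ oth k)" using assms by (simp add: edge_def kl)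
  ultimately show "z = w" by (simp add: vec_eq_coords[of _ _ k])
qed

lemma node_not_edge: "node v \<notin> edge z k"
  by (auto simp: edge_def)

lemma edge_crd: "p \<in> edge z k \<Longrightarrow> crd k (p $ k) (g (oth k) (z $ oth k)) = p"
  by (rule crd_eqI) (auto simp: edge_def)

lemma crd_edge: "crd k s (g (oth k) (z $ oth k)) \<in> edge z k \<longleftrightarrow> g k (z $ k) < s \<and> s < g k (z $ k + 1)"
  by (simp add: edge_def)

lemma edge_eq_image: "edge z k = (\<lambda>s. crd k s (g (oth k) (z $ oth k))) ` {g k (z $ k)<..<g k (z $ k + 1)}"
  using edge_crd by (force simp: edge_def)

lemma connected_edge: "connected (edge z k)"
  unfolding edge_eq_image by (intro connected_continuous_image continuous_on_crd continuous_intros) auto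

lemma edge_nonempty: "edge z k \<noteq> {}"
  by (simp add: edge_eq_image)

text \<open>An open neighbourhood of an edge that meets no other edge and no node.\<close>
definition edge_nbhd :: "int ^ 2 \<Rightarrow> 2 \<Rightarrow> (real ^ 2) set" where
  "edge_nbhd z k = {x. g k (z $ k) < x $ k \<and> x $ k < g k (z $ k + 1) \<and>
     g (oth k) (z $ oth k - 1) < x $ oth k \<and> x $ oth k < g (oth k) (z $ oth k + 1)}"

lemma open_edge_nbhd: "open (edge_nbhd z k)"
  unfolding edge_nbhd_def
  by (intro open_Collect_conj open_Collect_less continuous_intros)

lemma edge_subset_nbhd: "edge z k \<subseteq> edge_nbhd z k"
  by (auto simp: edge_def edge_nbhd_def)

lemma edge_nbhd_cases: "x \<in> edge_nbhd z k \<Longrightarrow> x \<in> edge z k \<or> x \<in> cell z \<or> x \<in> cell (z - axis (oth k) 1)"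
  unfolding edge_nbhd_def edge_def mem_cell all_coords[of _ k] by auto

end

context cell_region
begin

lemma edge_nbhd_boundary: "x \<in> edge_nbhd z k \<Longrightarrow> x \<in> R - interior R \<Longrightarrow> x \<in> edge z k"
  using edge_nbhd_cases cell_not_boundary by blast

lemma finite_nodes: "finite {v. node v \<in> R}"
proof (rule finite_subset)
  show "{v. node v \<in> R} \<subseteq> (\<Union>w\<in>Z. {v. \<forall>k. w $ k \<le> v $ k \<and> v $ k \<le> w $ k + 1})"
  proof
    fix v assume "v \<in> {v. node v \<in> R}"
    then obtain w where w: "w \<in> Z" "node v \<in> ccell w" using R_eq by blast
    have "w $ k \<le> v $ k \<and> v $ k \<le> w $ k + 1" for k
      using spec[OF w(2)[unfolded node_ccell], of k] by auto
    then show "v \<in> (\<Union>w\<in>Z. {v. \<forall>k. w $ k \<le> v $ k \<and> v $ k \<le> w $ k + 1})" using w(1) by blast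
  qed
  show "finite (\<Union>w\<in>Z. {v :: int ^ 2. \<forall>k. w $ k \<le> v $ k \<and> v $ k \<le> w $ k + 1})"
    by (intro finite_UN_I finite_Z finite_int_box)
qed

definition boundary_edges :: "((int ^ 2) \<times> 2) set" where
  "boundary_edges = {(z, k). edge_sign z k \<noteq> 0}"

lemma boundary_edges_near: "(z, k) \<in> boundary_edges \<Longrightarrow> z \<in> near_cells"
proof -
  assume "(z, k) \<in> boundary_edges"
  then have "z \<in> Z \<or> z - axis (oth k) 1 \<in> Z" by (auto simp: boundary_edges_def edge_sign_def)
  moreover have "z = (z - axis (oth k) 1) + axis (oth k) 1" by simp
  ultimately show "z \<in> near_cells" unfolding near_cells_def by blast
qed

lemma finite_boundary_edges: "finite boundary_edges"
  by (rule finite_subset[of _ "near_cells \<times> UNIV"]) (use boundary_edges_near finite_near_cells in auto)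

lemma edge_in_boundary: "(z, k) \<in> boundary_edges \<Longrightarrow> edge z k \<subseteq> R - interior R"
  using edge_sign_nonzero_iff by (auto simp: boundary_edges_def)

lemma closed_edge_in_R:
  assumes "(z, k) \<in> boundary_edges" "s \<in> {g k (z $ k)..g k (z $ k + 1)}"
  shows "crd k s (g (oth k) (z $ oth k)) \<in> R"
proof -
  have "z \<in> Z \<or> z - axis (oth k) 1 \<in> Z" using assms(1) by (auto simp: boundary_edges_def edge_sign_def)
  moreover have "crd k s (g (oth k) (z $ oth k)) \<in> ccell z" "crd k s (g (oth k) (z $ oth k)) \<in> ccell (z - axis (oth k) 1)"
    using assms(2) by (auto simp: crd_ccell)
  ultimately show ?thesis using R_eq by blast
qed

lemma boundary_point_cases:
  assumes "x \<in> R - interior R"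
  obtains z k where "(z, k) \<in> boundary_edges" "x \<in> edge z k" | v where "x = node v"
proof (cases rule: point_cases[of x])
  case (1 z)
  then show ?thesis using cell_not_boundary assms by blast
next
  case (2 z k)
  then show ?thesis using edge_sign_nonzero_iff[OF 2] assms that(1)[of z k] by (auto simp: boundary_edges_def)
qed (use that in blast)

end

context C2_image
begin

text \<open>The part of the line integral over the times at which the path is on a given edge. The pulled back
  path \<open>\<alpha>\<close> is injective and moves only in direction \<open>k\<close> during these times, so its coordinate
  \<open>\<beta>\<close> is injective and the change of variables formula with \<open>\<bar>\<beta>'\<bar>\<close> applies. The sign of
  \<open>\<beta>'\<close> is given, at each time with nonzero velocity, by the condition that \<open>S\<close> is on the
  left.\<close>
lemma edge_line_integral:
  assumes \<phi>: "continuous_on {a..b} \<phi>" "inj_on \<phi> {a..<b}" "\<phi> ` {a..b} \<subseteq> surface_boundary S" "on_left S a b \<phi>"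
    and X: "finite X" "\<And>t. t \<in> {a<..<b} - X \<Longrightarrow> (\<phi> has_vector_derivative \<phi>' t) (at t)"
    and e: "(z, k) \<in> boundary_edges" and onto: "H ` edge z k \<subseteq> \<phi> ` {a..b}"
  shows "((\<lambda>t. F (\<phi> t) \<bullet> \<phi>' t) has_integral edge_sign z k * edge_integral (signed_pullback k) z k)
           {t \<in> {a<..<b} - X. K (\<phi> t) \<in> edge z k}"
proof -
  define T where "T = {t \<in> {a<..<b} - X. K (\<phi> t) \<in> edge z k}"
  define \<alpha> where "\<alpha> t = K (\<phi> t)" for t
  define \<beta> where "\<beta> t = \<alpha> t $ k" for t
  define c where "c = g (oth k) (z $ oth k)"
  define \<beta>' where "\<beta>' t = Jinv (\<alpha> t) (\<phi>' t) $ k" for t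
  define u where "u s = signed_pullback k (crd k s c)" for s
  let ?I = "{g k (z $ k)..g k (z $ k + 1)}"
  have nz: "edge_sign z k \<noteq> 0" using e by (simp add: boundary_edges_def)
  have \<phi>S: "\<phi> t \<in> S" "\<alpha> t \<in> R - interior R" "H (\<alpha> t) = \<phi> t" if "t \<in> {a..b}" for t
  proof -
    have "\<phi> t \<in> surface_boundary S" using that \<phi>(3) by blast
    then show "\<phi> t \<in> S" "\<alpha> t \<in> R - interior R" "H (\<alpha> t) = \<phi> t"
      using K_boundary[of "\<phi> t"] by (auto simp: \<alpha>_def surface_boundary_eq)
  qed
  have \<alpha>cont: "continuous_on {a..b} \<alpha>"
    unfolding \<alpha>_def by (rule continuous_on_compose2[OF K_cont \<phi>(1)]) (use \<phi>S in auto)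
  define U where "U = {t \<in> {a<..<b}. \<alpha> t \<in> edge_nbhd z k}"
  have "open U"
  proof -
    have "open ({a<..<b} \<inter> \<alpha> -` edge_nbhd z k)"
      by (rule continuous_open_preimage[OF continuous_on_subset[OF \<alpha>cont] _ open_edge_nbhd]) auto
    moreover have "U = {a<..<b} \<inter> \<alpha> -` edge_nbhd z k" by (auto simp: U_def)
    ultimately show ?thesis by simp
  qed
  have U_edge: "\<alpha> t \<in> edge z k" if "t \<in> U" for t
    using that \<phi>S(2)[of t] edge_nbhd_boundary by (auto simp: U_def)
  have T_eq: "T = U - X"
    using U_edge edge_subset_nbhd by (auto simp: T_def U_def \<alpha>_def)
  have Tm: "T \<in> sets lebesgue"
    unfolding T_eq using \<open>open U\<close> X(1) by (intro sets.Diff) (auto simp: negligible_imp_sets negligible_finite)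
  have \<alpha>_der: "(\<alpha> has_vector_derivative Jinv (\<alpha> t) (\<phi>' t)) (at t)" if "t \<in> T" for t
  proof -
    have t: "t \<in> {a<..<b}" "t \<notin> X" using that by (auto simp: T_def)
    have 1: "(\<phi> has_vector_derivative \<phi>' t) (at t within {a<..<b})"
      using X(2)[of t] t has_vector_derivative_at_within by blast
    have "(K has_derivative Jinv (\<alpha> t)) (at (\<phi> t) within \<phi> ` {a<..<b})"
    proof (rule has_derivative_subset)
      show "(K has_derivative Jinv (\<alpha> t)) (at (\<phi> t) within S)"
        using K_derivative[of "\<alpha> t"] \<phi>S[of t] t by simp
      show "\<phi> ` {a<..<b} \<subseteq> S" using \<phi>S(1) by auto
    qed
    from vector_derivative_diff_chain_within[OF 1 this]
    have "(\<alpha> has_vector_derivative Jinv (\<alpha> t) (\<phi>' t)) (at t within {a<..<b})"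
      by (simp add: o_def \<alpha>_def[abs_def])
    then show ?thesis by (rule has_vector_derivative_within_open[OF t(1) open_greaterThanLessThan, THEN iffD1])
  qed
  have comp_der: "((\<lambda>t. \<alpha> t $ m) has_vector_derivative Jinv (\<alpha> t) (\<phi>' t) $ m) (at t)" if "t \<in> T" for t m
    using bounded_linear.has_vector_derivative[OF bounded_linear_vec_nth \<alpha>_der[OF that]] .
  \<comment> \<open>The path \<open>\<alpha>\<close> stays on the edge in a neighbourhood of \<open>t\<close>.\<close>
  have \<alpha>'_oth: "Jinv (\<alpha> t) (\<phi>' t) $ oth k = 0" if "t \<in> T" for t
  proof (rule vector_derivative_unique_at)
    show "((\<lambda>t. \<alpha> t $ oth k) has_vector_derivative Jinv (\<alpha> t) (\<phi>' t) $ oth k) (at t)" using comp_der that .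
    show "((\<lambda>t. \<alpha> t $ oth k) has_vector_derivative 0) (at t)"
    proof (rule has_vector_derivative_transform_within_open)
      show "((\<lambda>t. c) has_vector_derivative 0) (at t)" by simp
      show "t \<in> U" using that T_eq by blast
      show "c = \<alpha> s $ oth k" if "s \<in> U" for s using U_edge[OF that] by (simp add: edge_def c_def)
    qed fact
  qed
  have \<phi>'_eq: "\<phi>' t = \<beta>' t *\<^sub>R DH k (\<alpha> t)" if "t \<in> T" for t
  proof -
    have "\<alpha> t \<in> R" using \<phi>S(2)[of t] that by (auto simp: T_def)
    then show ?thesis
      using J_Jinv[of "\<alpha> t" "\<phi>' t"] \<alpha>'_oth[OF that] by (simp add: J_mult[of _ _ k] \<beta>'_def)
  qed
  have \<alpha>_crd: "\<alpha> t = crd k (\<beta> t) c" if "t \<in> T" for t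
    using edge_crd[of "\<alpha> t" z k] that by (simp add: T_def \<alpha>_def \<beta>_def c_def)
  have sign: "edge_sign z k * sgn (jac (\<alpha> t)) * \<bar>\<beta>' t\<bar> = \<beta>' t" if t: "t \<in> T" for t
  proof (cases "\<beta>' t = 0")
    case False
    have tab: "t \<in> {a<..<b}" "t \<notin> X" "\<alpha> t \<in> edge z k" using t by (auto simp: T_def \<alpha>_def)
    have jac: "jac (\<alpha> t) \<noteq> 0" using jac_nonzero \<phi>S(2)[of t] tab by auto
    have "\<phi>' t \<noteq> 0" using \<phi>'_eq[OF t] False DH_nonzero \<phi>S(2)[of t] tab by auto
    then have "\<exists>\<epsilon>>0. \<forall>s\<in>{0<..<\<epsilon>}. \<phi> t + s *\<^sub>R left_normal (\<phi>' t) \<in> S"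
      using \<phi>(4) X(2)[of t] tab unfolding on_left_def by blast
    then have "edge_sign z k * sgn (jac (\<alpha> t)) * \<beta>' t > 0"
      using left_imp_sign[OF tab(3) nz False] \<phi>'_eq[OF t] \<phi>S(3)[of t] tab by simp
    moreover have "edge_sign z k = 1 \<or> edge_sign z k = - 1" using nz by (auto simp: edge_sign_def)
    ultimately show ?thesis using jac by (auto simp: sgn_if split: if_splits)
  qed simp
  have int_eq: "F (\<phi> t) \<bullet> \<phi>' t = edge_sign z k * (\<bar>\<beta>' t\<bar> * u (\<beta> t))" if "t \<in> T" for t
  proof -
    have "t \<in> {a..b}" using that by (auto simp: T_def)
    then have "F (\<phi> t) \<bullet> \<phi>' t = \<beta>' t * pullback k (\<alpha> t)"
      using \<phi>'_eq[OF that] \<phi>S(3)[of t] by (simp add: pullback_def)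
    also have "\<dots> = edge_sign z k * (\<bar>\<beta>' t\<bar> * signed_pullback k (\<alpha> t))"
      using sign[OF that] by (simp add: signed_pullback_def) (metis (no_types, opaque_lifting) mult.assoc mult.commute)
    finally show ?thesis using \<alpha>_crd[OF that] by (simp add: u_def)
  qed
  have ucont: "continuous_on ?I u"
    unfolding u_def
    by (rule continuous_on_compose2[OF signed_pullback_cont])
      (use closed_edge_in_R[OF e] in \<open>auto simp: c_def intro!: continuous_on_crd continuous_intros\<close>)
  have image: "\<beta> ` T \<subseteq> ?I"
    by (auto simp: T_def \<beta>_def \<alpha>_def edge_def less_imp_le)
  \<comment> \<open>The path passes through every point of the edge, at finitely many points possibly at one of the
      excluded times.\<close>
  have rest: "finite (?I - \<beta> ` T)"
  proof (rule finite_subset)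
    show "?I - \<beta> ` T \<subseteq> {g k (z $ k), g k (z $ k + 1)} \<union> \<beta> ` (X \<union> {a, b})"
    proof
      fix s assume s: "s \<in> ?I - \<beta> ` T"
      show "s \<in> {g k (z $ k), g k (z $ k + 1)} \<union> \<beta> ` (X \<union> {a, b})"
      proof (cases "s = g k (z $ k) \<or> s = g k (z $ k + 1)")
        case False
        then have edge: "crd k s c \<in> edge z k" using s by (auto simp: c_def crd_edge)
        then have "H (crd k s c) \<in> \<phi> ` {a..b}" using onto by blast
        then obtain t where t: "t \<in> {a..b}" "\<phi> t = H (crd k s c)" by auto
        have "crd k s c \<in> R" using edge edge_in_boundary[OF e] by blast
        then have "\<alpha> t = crd k s c" using t by (simp add: \<alpha>_def)
        then have "\<beta> t = s" "\<alpha> t \<in> edge z k" using edge by (simp_all add: \<beta>_def)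
        then show ?thesis using s t(1) by (cases "t \<in> T") (auto simp: T_def \<alpha>_def)
      qed auto
    qed
  qed (use X(1) in simp)
  have n1: "negligible {s \<in> ?I - \<beta> ` T. u s \<noteq> 0}"
    by (rule negligible_subset[OF negligible_finite[OF rest]]) auto
  have "{s \<in> \<beta> ` T - ?I. u s \<noteq> 0} = {}" using image by blast
  then have n2: "negligible {s \<in> \<beta> ` T - ?I. u s \<noteq> 0}" by (metis negligible_empty)
  have "u absolutely_integrable_on \<beta> ` T"
    using absolutely_integrable_spike_set_eq[OF n1 n2] absolutely_integrable_continuous_real[OF ucont] by simp
  moreover have "integral (\<beta> ` T) u = integral ?I u"
    using integral_spike_set[OF n1 n2] by simp
  moreover have "(\<lambda>t. \<bar>\<beta>' t\<bar> * u (\<beta> t)) absolutely_integrable_on T \<and> integral T (\<lambda>t. \<bar>\<beta>' t\<bar> * u (\<beta> t)) = integral ?I u \<longleftrightarrow>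
      u absolutely_integrable_on \<beta> ` T \<and> integral (\<beta> ` T) u = integral ?I u"
  proof (rule has_absolute_integral_change_of_variables_1'[OF Tm])
    show "(\<beta> has_field_derivative \<beta>' t) (at t within T)" if "t \<in> T" for t
      using comp_der[OF that, of k] unfolding \<beta>_def \<beta>'_def
      by (simp add: has_real_derivative_iff_has_vector_derivative has_vector_derivative_at_within)
    show "inj_on \<beta> T"
    proof (rule inj_onI)
      fix s t assume st: "s \<in> T" "t \<in> T" "\<beta> s = \<beta> t"
      then have "\<alpha> s = \<alpha> t" using \<alpha>_crd by simp
      then have "\<phi> s = \<phi> t" using st \<phi>S(3)[of s] \<phi>S(3)[of t] by (simp add: T_def)
      then show "s = t" using st \<phi>(2) by (auto simp: T_def inj_on_def)
    qed
  qed
  ultimately have "((\<lambda>t. \<bar>\<beta>' t\<bar> * u (\<beta> t)) has_integral integral ?I u) T"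
    by (metis absolutely_integrable_on_def has_integral_iff)
  then have "((\<lambda>t. edge_sign z k * (\<bar>\<beta>' t\<bar> * u (\<beta> t))) has_integral edge_sign z k * integral ?I u) T"
    by (rule has_integral_mult_right)
  then have "((\<lambda>t. F (\<phi> t) \<bullet> \<phi>' t) has_integral edge_sign z k * integral ?I u) T"
    by (rule has_integral_eq[rotated]) (simp add: int_eq)
  then show ?thesis
    unfolding T_def[symmetric] by (simp add: edge_integral_def u_def[abs_def] c_def)
qed

definition edges_of :: "(real ^ 2) set \<Rightarrow> ((int ^ 2) \<times> 2) set" where
  "edges_of C = {(z, k) \<in> boundary_edges. H ` edge z k \<subseteq> C}"

lemma finite_edges_of: "finite (edges_of C)"
  by (rule finite_subset[OF _ finite_boundary_edges]) (auto simp: edges_of_def)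

lemma connected_H_edge: "(z, k) \<in> boundary_edges \<Longrightarrow> connected (H ` edge z k)"
  and H_edge_boundary: "(z, k) \<in> boundary_edges \<Longrightarrow> H ` edge z k \<subseteq> surface_boundary S"
  using edge_in_boundary[of z k] connected_edge cont_H unfolding boundary_S
  by (blast intro: connected_continuous_image continuous_on_subset)+

text \<open>All but finitely many times belong to one of the edges of the component: the exceptions are the end points,
  the times where the path is not differentiable, and, by injectivity, the times at which it passes one
  of the finitely many nodes.\<close>
lemma component_line_integral:
  assumes C: "C \<in> components (surface_boundary S)" and \<phi>: "oriented_parametrization S C a b \<phi>"
  shows "line_integral F a b \<phi> = (\<Sum>(z, k)\<in>edges_of C. edge_sign z k * edge_integral (signed_pullback k) z k)"
proof -
  have ab: "a < b" and cont: "continuous_on {a..b} \<phi>" and inj: "inj_on \<phi> {a..<b}" and im: "\<phi> ` {a..b} = C" and left: "on_left S a b \<phi>"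
    using \<phi> by (auto simp: oriented_parametrization_def piecewise_C1_differentiable_on_def)
  obtain X where X: "finite X" "\<phi> C1_differentiable_on ({a..b} - X)"
    using \<phi> by (auto simp: oriented_parametrization_def piecewise_C1_differentiable_on_def)
  define \<phi>' where "\<phi>' t = vector_derivative \<phi> (at t)" for t
  have der: "(\<phi> has_vector_derivative \<phi>' t) (at t)" if "t \<in> {a<..<b} - X" for t
  proof -
    have "\<phi> differentiable at t" using X(2) that by (auto simp: C1_differentiable_on_eq)
    then show ?thesis by (simp add: \<phi>'_def vector_derivative_works[symmetric])
  qed
  have CS: "C \<subseteq> surface_boundary S" using C in_components_subset by blast
  have \<phi>R: "K (\<phi> t) \<in> R - interior R" "H (K (\<phi> t)) = \<phi> t" "\<phi> t \<in> C" if "t \<in> {a..b}" for t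
  proof -
    show "\<phi> t \<in> C" using that im by blast
    then have "\<phi> t \<in> surface_boundary S" using CS by blast
    then show "K (\<phi> t) \<in> R - interior R" "H (K (\<phi> t)) = \<phi> t"
      using K_boundary[of "\<phi> t"] by (auto simp: surface_boundary_eq)
  qed
  define T where "T e = {t \<in> {a<..<b} - X. K (\<phi> t) \<in> edge (fst e) (snd e)}" for e
  have "((\<lambda>t. F (\<phi> t) \<bullet> \<phi>' t) has_integral
     (\<Sum>e\<in>edges_of C. edge_sign (fst e) (snd e) * edge_integral (signed_pullback (snd e)) (fst e) (snd e))) (\<Union>e\<in>edges_of C. T e)"
  proof (rule has_integral_UN)
    show "finite (edges_of C)" by (rule finite_edges_of)
    show "pairwise (\<lambda>e e'. negligible (T e \<inter> T e')) (edges_of C)"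
    proof (rule pairwiseI)
      fix e e' :: "(int ^ 2) \<times> 2" assume "e \<noteq> e'"
      then have "T e \<inter> T e' = {}" using edge_unique by (auto simp: T_def prod_eq_iff) 
      then show "negligible (T e \<inter> T e')" by simp
    qed
    fix e assume "e \<in> edges_of C"
    then show "((\<lambda>t. F (\<phi> t) \<bullet> \<phi>' t) has_integral
        edge_sign (fst e) (snd e) * edge_integral (signed_pullback (snd e)) (fst e) (snd e)) (T e)"
      unfolding T_def
      by (intro edge_line_integral cont inj left X der) (use im CS in \<open>auto simp: edges_of_def\<close>)
  qed
  moreover have "finite ({a..b} - (\<Union>e\<in>edges_of C. T e))"
  proof (rule finite_subset)
    let ?N = "(H ` node ` {v. node v \<in> R})"
    show "{a..b} - (\<Union>e\<in>edges_of C. T e) \<subseteq> X \<union> {a, b} \<union> (\<phi> -` ?N \<inter> {a..<b})"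
    proof
      fix t assume t: "t \<in> {a..b} - (\<Union>e\<in>edges_of C. T e)"
      then have tab: "t \<in> {a..b}" by blast
      show "t \<in> X \<union> {a, b} \<union> (\<phi> -` ?N \<inter> {a..<b})"
      proof (cases "t \<in> X \<union> {a, b}")
        case False
        then have t': "t \<in> {a<..<b} - X" using tab by auto
        from \<phi>R(1)[OF tab] show ?thesis
        proof (cases rule: boundary_point_cases)
          case (1 z k)
          have "H ` edge z k \<subseteq> C"
          proof (rule components_maximal[OF C connected_H_edge[OF 1(1)] H_edge_boundary[OF 1(1)]])
            show "C \<inter> H ` edge z k \<noteq> {}" using \<phi>R(2,3)[OF tab] 1(2) by (metis IntI empty_iff imageI)
          qed
          then have "(z, k) \<in> edges_of C" using 1(1) by (simp add: edges_of_def)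
          moreover have "t \<in> T (z, k)" using t' 1(2) by (simp add: T_def)
          ultimately show ?thesis using t by blast
        next
          case (2 v)
          then have "\<phi> t = H (node v)" "node v \<in> R" using \<phi>R(1,2)[OF tab] by auto
          then show ?thesis using t' by auto
        qed
      qed auto
    qed
    show "finite (X \<union> {a, b} \<union> (\<phi> -` ?N \<inter> {a..<b}))"
      using X(1) finite_vimage_IntI[OF _ inj, of ?N] finite_nodes by simp
  qed
  ultimately have "((\<lambda>t. F (\<phi> t) \<bullet> \<phi>' t) has_integral
     (\<Sum>e\<in>edges_of C. edge_sign (fst e) (snd e) * edge_integral (signed_pullback (snd e)) (fst e) (snd e))) {a..b}"
  proof (subst has_integral_spike_set_eq[of "{a..b}" "\<Union>e\<in>edges_of C. T e"], goal_cases)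
    case 1
    show ?case by (rule negligible_subset[OF negligible_finite[OF 1(2)]]) auto
  next
    case 2
    have "(\<Union>e\<in>edges_of C. T e) \<subseteq> {a..b}" by (auto simp: T_def)
    then have "{t \<in> (\<Union>e\<in>edges_of C. T e) - {a..b}. F (\<phi> t) \<bullet> \<phi>' t \<noteq> 0} = {}" by blast
    then show ?case by (metis negligible_empty)
  qed
  then show ?thesis
    by (simp add: line_integral_def \<phi>'_def integral_unique case_prod_unfold)
qed

text \<open>Edges are connected, so each boundary edge belongs to exactly one component.\<close>
lemma sum_line_integrals:
  assumes fin: "finite (components (surface_boundary S))"
    and param: "\<And>C. C \<in> components (surface_boundary S) \<Longrightarrow> oriented_parametrization S C (a C) (b C) (\<phi> C)"
  shows "(\<Sum>C\<in>components (surface_boundary S). line_integral F (a C) (b C) (\<phi> C)) = integral S (scurl S F)"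
proof -
  let ?f = "\<lambda>(z, k). edge_sign z k * edge_integral (signed_pullback k) z k"
  have "(\<Sum>C\<in>components (surface_boundary S). line_integral F (a C) (b C) (\<phi> C)) =
      (\<Sum>C\<in>components (surface_boundary S). sum ?f (edges_of C))"
    using component_line_integral param by (intro sum.cong) auto
  also have "\<dots> = sum ?f (\<Union>C\<in>components (surface_boundary S). edges_of C)"
  proof (rule sum.UNION_disjoint[symmetric, OF fin])
    show "\<forall>C\<in>components (surface_boundary S). finite (edges_of C)"
      using finite_edges_of by blast
    show "\<forall>C\<in>components (surface_boundary S). \<forall>D\<in>components (surface_boundary S). C \<noteq> D \<longrightarrow> edges_of C \<inter> edges_of D = {}"
    proof (intro ballI impI)
      fix C D assume "C \<in> components (surface_boundary S)" "D \<in> components (surface_boundary S)" "C \<noteq> D"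
      then have "C \<inter> D = {}" by (metis components_nonoverlap)
      then show "edges_of C \<inter> edges_of D = {}" using edge_nonempty by (fastforce simp: edges_of_def)
    qed
  qed
  also have "(\<Union>C\<in>components (surface_boundary S). edges_of C) = boundary_edges"
  proof
    show "boundary_edges \<subseteq> (\<Union>C\<in>components (surface_boundary S). edges_of C)"
    proof
      fix e assume e: "e \<in> boundary_edges"
      obtain z k where zk: "e = (z, k)" by (cases e)
      have "surface_boundary S \<noteq> {}" using H_edge_boundary[of z k] edge_nonempty[of z k] e zk by auto
      then obtain C where "C \<in> components (surface_boundary S)" "H ` edge z k \<subseteq> C"
        using exists_component_superset[OF H_edge_boundary _ connected_H_edge] e zk by metis
      then show "e \<in> (\<Union>C\<in>components (surface_boundary S). edges_of C)" using e zk by (auto simp: edges_of_def)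
    qed
  qed (auto simp: edges_of_def)
  also have "sum ?f boundary_edges = sum ?f (near_cells \<times> UNIV)"
    by (rule sum.mono_neutral_left)
      (use finite_near_cells boundary_edges_near in \<open>auto simp: boundary_edges_def\<close>)
  also have "\<dots> = (\<Sum>z\<in>near_cells. \<Sum>k\<in>UNIV. edge_sign z k * edge_integral (signed_pullback k) z k)"
    by (simp add: sum.cartesian_product)
  also have "\<dots> = integral S (scurl S F)"
    using scurl_has_integral by (simp add: integral_unique)
  finally show ?thesis .
qed

end

section \<open>Polygonal paths that rest at their vertices\<close>

text \<open>A bijection of the unit interval onto itself whose derivative vanishes at both ends.\<close>
definition smooth_step :: "real \<Rightarrow> real" where
  "smooth_step u = 3 * u ^ 2 - 2 * u ^ 3"

lemma smooth_step_derivative: "(smooth_step has_real_derivative 6 * u * (1 - u)) (at u within A)"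
  unfolding smooth_step_def by (auto intro!: derivative_eq_intros simp: algebra_simps power2_eq_square)

lemma smooth_step_0 [simp]: "smooth_step 0 = 0" and smooth_step_1 [simp]: "smooth_step 1 = 1"
  by (simp_all add: smooth_step_def)

lemma smooth_step_strict_mono:
  assumes "0 \<le> u" "u < v" "v \<le> 1"
  shows "smooth_step u < smooth_step v"
proof (rule DERIV_pos_imp_increasing_open[OF assms(2)])
  show "\<exists>y. (smooth_step has_real_derivative y) (at x) \<and> 0 < y" if "u < x" "x < v" for x
    using that assms smooth_step_derivative[of x UNIV] by (intro exI[of _ "6 * x * (1 - x)"]) auto
  show "continuous_on {u..v} smooth_step"
    unfolding smooth_step_def by (intro continuous_intros)
qed

lemma smooth_step_bounds: "0 < u \<Longrightarrow> u < 1 \<Longrightarrow> 0 < smooth_step u \<and> smooth_step u < 1"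
  using smooth_step_strict_mono[of 0 u] smooth_step_strict_mono[of u 1] by simp

lemma smooth_step_onto:
  assumes "0 \<le> r" "r \<le> 1"
  obtains u where "0 \<le> u" "u \<le> 1" "smooth_step u = r"
proof -
  have "continuous_on {0..1} smooth_step" unfolding smooth_step_def by (intro continuous_intros)
  then show thesis using IVT'[of smooth_step 0 r 1] assms that by auto
qed

text \<open>The path is at the vertex \<open>w j\<close> at time \<open>j\<close>, with velocity zero.\<close>
definition polygon_path :: "(nat \<Rightarrow> 'a::real_normed_vector) \<Rightarrow> real \<Rightarrow> 'a" where
  "polygon_path w t = w (nat \<lfloor>t\<rfloor>) + smooth_step (t - of_int \<lfloor>t\<rfloor>) *\<^sub>R (w (Suc (nat \<lfloor>t\<rfloor>)) - w (nat \<lfloor>t\<rfloor>))"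

lemma polygon_path_eq:
  assumes "real j \<le> t" "t \<le> real j + 1"
  shows "polygon_path w t = w j + smooth_step (t - real j) *\<^sub>R (w (Suc j) - w j)"
proof (cases "t = real j + 1")
  case True
  then have "\<lfloor>t\<rfloor> = int j + 1" by linarith
  then show ?thesis using True by (simp add: polygon_path_def nat_add_distrib)
next
  case False
  then have "\<lfloor>t\<rfloor> = int j" using assms by (simp add: floor_eq_iff)
  then show ?thesis by (simp add: polygon_path_def)
qed

lemma polygon_path_derivative:
  assumes "t \<in> {real j..real j + 1}"
  shows "(polygon_path w has_vector_derivative (6 * (t - real j) * (1 - (t - real j))) *\<^sub>R (w (Suc j) - w j))
           (at t within {real j..real j + 1})"
proof (rule has_vector_derivative_transform[OF assms])
  show "polygon_path w x = w j + smooth_step (x - real j) *\<^sub>R (w (Suc j) - w j)" if "x \<in> {real j..real j + 1}" for x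
    using polygon_path_eq[of j x w] that by simp
  have "((\<lambda>x. smooth_step (x - real j)) has_real_derivative 6 * (t - real j) * (1 - (t - real j))) (at t within {real j..real j + 1})"
    unfolding smooth_step_def by (auto intro!: derivative_eq_intros simp: algebra_simps power2_eq_square)
  from has_vector_derivative_add[OF has_vector_derivative_const has_vector_derivative_scaleR[OF this has_vector_derivative_const]]
  show "((\<lambda>x. w j + smooth_step (x - real j) *\<^sub>R (w (Suc j) - w j)) has_vector_derivative
      (6 * (t - real j) * (1 - (t - real j))) *\<^sub>R (w (Suc j) - w j)) (at t within {real j..real j + 1})"
    by simp
qed

lemma polygon_path_continuous: "continuous_on {0..real n} (polygon_path w)"
proof (induction n)
  case (Suc n)
  have "{0..real (Suc n)} = {0..real n} \<union> {real n..real n + 1}" by auto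
  moreover have "continuous_on {real n..real n + 1} (polygon_path w)"
    using polygon_path_derivative has_vector_derivative_continuous continuous_on_eq_continuous_within by blast
  ultimately show ?case using Suc by (simp add: continuous_on_closed_Un)
qed simp

lemma unit_interval_index:
  assumes "0 \<le> t" "t < real n"
  obtains j where "j < n" "real j \<le> t" "t < real j + 1"
proof (rule that[of "nat \<lfloor>t\<rfloor>"])
  have eq: "real (nat \<lfloor>t\<rfloor>) = of_int \<lfloor>t\<rfloor>" using assms(1) by simp
  show le: "real (nat \<lfloor>t\<rfloor>) \<le> t" and "t < real (nat \<lfloor>t\<rfloor>) + 1" unfolding eq by linarith+
  show "nat \<lfloor>t\<rfloor> < n" using le assms(2) by linarith
qed

lemma polygon_path_cases:
  assumes "real j \<le> t" "t < real j + 1"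
  shows "t = real j \<and> polygon_path w t = w j \<or>
    (\<exists>u. 0 < u \<and> u < 1 \<and> t \<noteq> real j \<and> u = smooth_step (t - real j) \<and> polygon_path w t = w j + u *\<^sub>R (w (Suc j) - w j))"
proof (cases "t = real j")
  case True
  then show ?thesis using polygon_path_eq[of j t w] by simp
next
  case False
  then show ?thesis
    using polygon_path_eq[of j t w] assms smooth_step_bounds[of "t - real j"]
    by (intro disjI2 exI[of _ "smooth_step (t - real j)"]) auto
qed

lemma polygon_path_image:
  assumes "n > 0"
  shows "polygon_path w ` {0..real n} = (\<Union>j<n. closed_segment (w j) (w (Suc j)))"
proof
  have mem: "w j + u *\<^sub>R (w (Suc j) - w j) \<in> closed_segment (w j) (w (Suc j))" if "0 \<le> u" "u \<le> 1" for u j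
    using that unfolding in_segment by (intro exI[of _ u]) (simp add: algebra_simps)
  show "polygon_path w ` {0..real n} \<subseteq> (\<Union>j<n. closed_segment (w j) (w (Suc j)))"
  proof
    fix x assume "x \<in> polygon_path w ` {0..real n}"
    then obtain t where t: "0 \<le> t" "t \<le> real n" "x = polygon_path w t" by auto
    obtain j where j: "j < n" "real j \<le> t" "t \<le> real j + 1"
    proof (cases "t = real n")
      case True
      then show thesis using assms that[of "n - 1"] by (simp add: of_nat_diff)
    next
      case False
      then show thesis using unit_interval_index[of t n] t that by (metis less_imp_le order_le_less)
    qed
    have "0 \<le> smooth_step (t - real j)" "smooth_step (t - real j) \<le> 1"
      using j smooth_step_bounds[of "t - real j"] by (cases "t = real j"; cases "t = real j + 1"; force)+
    then show "x \<in> (\<Union>j<n. closed_segment (w j) (w (Suc j)))"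
      using mem[of "smooth_step (t - real j)" j] polygon_path_eq[OF j(2,3), of w] t(3) j(1) by auto
  qed
  show "(\<Union>j<n. closed_segment (w j) (w (Suc j))) \<subseteq> polygon_path w ` {0..real n}"
  proof
    fix x assume "x \<in> (\<Union>j<n. closed_segment (w j) (w (Suc j)))"
    then obtain j r where j: "j < n" "0 \<le> r" "r \<le> 1" "x = (1 - r) *\<^sub>R w j + r *\<^sub>R w (Suc j)"
      by (auto simp: in_segment)
    obtain u where u: "0 \<le> u" "u \<le> 1" "smooth_step u = r" using smooth_step_onto j by blast
    have "x = w j + r *\<^sub>R (w (Suc j) - w j)" using j(4) by (simp add: algebra_simps)
    then have "x = polygon_path w (real j + u)"
      using polygon_path_eq[of j "real j + u" w] u by simp
    moreover have "real j + u \<in> {0..real n}" using u j(1) by auto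
    ultimately show "x \<in> polygon_path w ` {0..real n}" by blast
  qed
qed

lemma polygon_path_inj:
  assumes "inj_on w {..<n}"
    and os: "\<And>i j u r. i < n \<Longrightarrow> j < n \<Longrightarrow> i \<noteq> j \<Longrightarrow> 0 < u \<Longrightarrow> u < 1 \<Longrightarrow> 0 < r \<Longrightarrow> r < 1 \<Longrightarrow>
      w i + u *\<^sub>R (w (Suc i) - w i) \<noteq> w j + r *\<^sub>R (w (Suc j) - w j)"
    and vs: "\<And>i j u. i < n \<Longrightarrow> j < n \<Longrightarrow> 0 < u \<Longrightarrow> u < 1 \<Longrightarrow> w i + u *\<^sub>R (w (Suc i) - w i) \<noteq> w j"
    and ne: "\<And>i. i < n \<Longrightarrow> w (Suc i) \<noteq> w i"
  shows "inj_on (polygon_path w) {0..<real n}"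
proof (rule inj_onI)
  fix s t assume st: "s \<in> {0..<real n}" "t \<in> {0..<real n}" and eq: "polygon_path w s = polygon_path w t"
  obtain i where i: "i < n" "real i \<le> s" "s < real i + 1" using unit_interval_index[of s n] st by auto
  obtain j where j: "j < n" "real j \<le> t" "t < real j + 1" using unit_interval_index[of t n] st by auto
  from polygon_path_cases[OF i(2,3), of w] show "s = t"
  proof (elim disjE exE conjE)
    assume s: "s = real i" "polygon_path w s = w i"
    from polygon_path_cases[OF j(2,3), of w] show "s = t"
    proof (elim disjE exE conjE)
      assume "t = real j" "polygon_path w t = w j"
      then show "s = t" using s eq i(1) j(1) assms(1) by (auto simp: inj_on_def)
    next
      fix r assume "0 < r" "r < 1" "polygon_path w t = w j + r *\<^sub>R (w (Suc j) - w j)"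
      then show "s = t" using vs[OF j(1) i(1)] s eq by metis
    qed
  next
    fix u assume s: "0 < u" "u < 1" "u = smooth_step (s - real i)" "polygon_path w s = w i + u *\<^sub>R (w (Suc i) - w i)"
    from polygon_path_cases[OF j(2,3), of w] show "s = t"
    proof (elim disjE exE conjE)
      assume "t = real j" "polygon_path w t = w j"
      then show "s = t" using vs[OF i(1) j(1)] s eq by metis
    next
      fix r assume t: "0 < r" "r < 1" "r = smooth_step (t - real j)" "polygon_path w t = w j + r *\<^sub>R (w (Suc j) - w j)"
      have ij: "i = j" using os[OF i(1) j(1)] s t eq by metis
      then have "u = r" using eq s(4) t(4) ne[OF i(1)] by simp
      then have "smooth_step (s - real i) = smooth_step (t - real i)" using s(3) t(3) ij by simp
      then have "\<not> s - real i < t - real i" "\<not> t - real i < s - real i"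
        using smooth_step_strict_mono[of "s - real i" "t - real i"] smooth_step_strict_mono[of "t - real i" "s - real i"] i j ij by auto
      then show "s = t" by simp
    qed
  qed
qed

section \<open>Boundary cycles\<close>

text \<open>The first repetition in an orbit of an injective map is a return to the starting point.\<close>
lemma finite_permutation_orbit:
  assumes "finite V" "inj_on f V" "\<And>x. x \<in> V \<Longrightarrow> f x \<in> V" "v \<in> V"
  obtains n where "n > 0" "(f ^^ n) v = v" "inj_on (\<lambda>i. (f ^^ i) v) {..<n}"
proof -
  have inV: "(f ^^ i) v \<in> V" for i using assms(3,4) by (induction i) auto
  have unroll: "(f ^^ (j - i)) v = v" if "i \<le> j" "(f ^^ i) v = (f ^^ j) v" for i j
    using that
  proof (induction i arbitrary: j)
    case (Suc i)
    then obtain j' where j': "j = Suc j'" "i \<le> j'" by (cases j) auto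
    then have "f ((f ^^ i) v) = f ((f ^^ j') v)" using Suc.prems by simp
    then have "(f ^^ i) v = (f ^^ j') v" using assms(2) inV by (auto dest: inj_onD)
    then show ?case using Suc.IH j' by simp
  qed simp
  have "\<not> inj (\<lambda>i. (f ^^ i) v)"
    using inV assms(1) by (metis finite_imageD finite_subset image_subsetI infinite_UNIV_nat)
  then obtain i j where "i < j" "(f ^^ i) v = (f ^^ j) v"
    by (metis (mono_tags, lifting) injI linorder_neqE_nat)
  then have ex: "j - i > 0 \<and> (f ^^ (j - i)) v = v" using unroll by simp
  define n where "n = (LEAST n. n > 0 \<and> (f ^^ n) v = v)"
  have n: "n > 0 \<and> (f ^^ n) v = v" unfolding n_def using ex by (rule LeastI)
  have least: "\<not> (m > 0 \<and> (f ^^ m) v = v)" if "m < n" for m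
    using that not_less_Least unfolding n_def by blast
  have "inj_on (\<lambda>i. (f ^^ i) v) {..<n}"
  proof (rule inj_onI, rule ccontr)
    fix i j assume *: "i \<in> {..<n}" "j \<in> {..<n}" "(f ^^ i) v = (f ^^ j) v" "i \<noteq> j"
    then have "min i j \<le> max i j" "(f ^^ min i j) v = (f ^^ max i j) v" by (auto simp: min_def max_def)
    then have "(f ^^ (max i j - min i j)) v = v" by (rule unroll)
    moreover have "max i j - min i j < n" "max i j - min i j > 0"
      using * by (auto simp: min_def max_def less_imp_diff_less)
    ultimately show False using least by blast
  qed
  then show thesis using that n by blast
qed

context grid
begin

lemma node_diff: "node (z + axis k 1) - node z = (g k (z $ k + 1) - g k (z $ k)) *\<^sub>R axis k 1"
  by (simp add: vec_eq_coords[of _ _ k])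

lemma edge_param:
  assumes "0 < u" "u < 1"
  shows "node z + u *\<^sub>R (node (z + axis k 1) - node z) \<in> edge z k"
proof -
  have pos: "g k (z $ k + 1) - g k (z $ k) > 0" by simp
  have "u * (g k (z $ k + 1) - g k (z $ k)) < 1 * (g k (z $ k + 1) - g k (z $ k))"
    using assms pos by (intro mult_strict_right_mono) auto
  then have "g k (z $ k) + u * (g k (z $ k + 1) - g k (z $ k)) < g k (z $ k + 1)" by (simp add: algebra_simps)
  then show ?thesis using assms pos by (simp add: edge_def)
qed

lemma edge_subset_segment: "edge z k \<subseteq> closed_segment (node z) (node (z + axis k 1))"
proof
  fix x assume "x \<in> edge z k"
  define l where "l = g k (z $ k + 1) - g k (z $ k)"
  have "l > 0" by (simp add: l_def)
  have x: "g k (z $ k) < x $ k" "x $ k < g k (z $ k) + l" "x $ oth k = g (oth k) (z $ oth k)"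
    using \<open>x \<in> edge z k\<close> by (auto simp: edge_def l_def)
  define r where "r = (x $ k - g k (z $ k)) / l"
  have r: "0 \<le> r" "r \<le> 1" "r * l = x $ k - g k (z $ k)" using x \<open>l > 0\<close> by (auto simp: r_def)
  have "x = node z + r *\<^sub>R (node (z + axis k 1) - node z)"
    unfolding node_diff l_def[symmetric] using x r by (simp add: vec_eq_coords[of _ _ k])
  then have "x = (1 - r) *\<^sub>R node z + r *\<^sub>R node (z + axis k 1)" by (simp add: algebra_simps)
  then show "x \<in> closed_segment (node z) (node (z + axis k 1))" using r in_segment by blast
qed

end

context surface_region
begin

definition boundary_nodes :: "(int ^ 2) set" where
  "boundary_nodes = {v. node v \<in> R - interior R}"

text \<open>The relation \<open>step 1\<close> joins consecutive boundary nodes, with the region on the left;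
  for \<open>step (-1)\<close> it is on the right.\<close>
definition step :: "real \<Rightarrow> int ^ 2 \<Rightarrow> int ^ 2 \<Rightarrow> bool" where
  "step s v w \<longleftrightarrow> (\<exists>k. w = v + axis k 1 \<and> edge_sign v k = s \<or> v = w + axis k 1 \<and> edge_sign w k = - s)"

lemma finite_boundary_nodes: "finite boundary_nodes"
  using finite_nodes by (rule finite_subset[rotated]) (auto simp: boundary_nodes_def)

lemma step_sym: "step s v w \<longleftrightarrow> step (- s) w v"
  by (auto simp: step_def)

lemma step_cases_iff: "step s v w \<longleftrightarrow>
     w = v + axis 1 1 \<and> edge_sign v 1 = s \<or> w = v + axis 2 1 \<and> edge_sign v 2 = s \<or>
     w = v - axis 1 1 \<and> edge_sign (v - axis 1 1) 1 = - s \<or> w = v - axis 2 1 \<and> edge_sign (v - axis 2 1) 2 = - s"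
proof -
  have "v = w + axis k 1 \<longleftrightarrow> w = v - axis k 1" for k by (auto simp: algebra_simps)
  moreover have "(\<exists>k. P k) \<longleftrightarrow> P 1 \<or> P (2 :: 2)" for P by (metis exhaust_2)
  ultimately show ?thesis unfolding step_def by auto
qed

lemma boundary_nodes_iff: "v \<in> boundary_nodes \<longleftrightarrow>
    (v \<in> Z \<or> v - axis 1 1 \<in> Z \<or> v - axis 2 1 \<in> Z \<or> v - axis 1 1 - axis 2 1 \<in> Z) \<and>
    (v \<notin> Z \<or> v - axis 1 1 \<notin> Z \<or> v - axis 2 1 \<notin> Z \<or> v - axis 1 1 - axis 2 1 \<notin> Z)"
proof -
  have "node v \<in> ccell w \<longleftrightarrow> w = v \<or> w = v - axis 1 1 \<or> w = v - axis 2 1 \<or> w = v - axis 1 1 - axis 2 1" for w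
    unfolding node_ccell forall_2 by (auto simp: vec_eq_iff forall_2 axis_nth_eq)
  then show ?thesis unfolding boundary_nodes_def mem_Collect_eq boundary_iff by auto
qed

lemma edge_sign_1: "edge_sign v 1 = of_bool (v \<in> Z) - of_bool (v - axis 2 1 \<in> Z)"
  and edge_sign_2: "edge_sign v 2 = of_bool (v - axis 1 1 \<in> Z) - of_bool (v \<in> Z)"
  by (simp_all add: edge_sign_def)

text \<open>The four cells around a boundary node are neither all in the region nor all outside, and they are
  not alternating. So going around the node one passes exactly once into the region and once out of it.\<close>
lemma ex1_step:
  assumes "v \<in> boundary_nodes" and s: "s = 1 \<or> s = - 1"
  shows "\<exists>!w. step s v w"
proof -
  define a b c d where "a = (v \<in> Z)" and "b = (v - axis 1 1 \<in> Z)" and "c = (v - axis 1 1 - axis 2 1 \<in> Z)" and "d = (v - axis 2 1 \<in> Z)"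
  have comm: "v - axis 2 1 - axis 1 1 = v - axis 1 1 - axis 2 (1::int)" by (simp add: algebra_simps)
  have st: "step s v w \<longleftrightarrow> w = v + axis 1 1 \<and> of_bool a - of_bool d = s \<or> w = v + axis 2 1 \<and> of_bool b - of_bool a = s \<or>
     w = v - axis 1 1 \<and> of_bool b - of_bool c = - s \<or> w = v - axis 2 1 \<and> of_bool c - of_bool d = - s" for w
    unfolding step_cases_iff edge_sign_1 edge_sign_2 comm a_def b_def c_def d_def by simp
  have mix: "(a \<or> b \<or> c \<or> d) \<and> (\<not> a \<or> \<not> b \<or> \<not> c \<or> \<not> d)" and opp: "\<not> (a \<and> c \<and> \<not> b \<and> \<not> d)" "\<not> (\<not> a \<and> \<not> c \<and> b \<and> d)"
    using assms(1) no_opposite[of v] unfolding boundary_nodes_iff a_def b_def c_def d_def by blast+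
  show ?thesis
    unfolding st using s mix opp by (cases a; cases b; cases c; cases d) auto
qed

lemma boundary_edge_ends:
  assumes "(z, k) \<in> boundary_edges"
  shows "z \<in> boundary_nodes" "z + axis k 1 \<in> boundary_nodes"
proof -
  have one: "(z \<in> Z) \<noteq> (z - axis (oth k) 1 \<in> Z)" using assms by (auto simp: boundary_edges_def edge_sign_def)
  have "node z \<in> ccell z" "node z \<in> ccell (z - axis (oth k) 1)"
    "node (z + axis k 1) \<in> ccell z" "node (z + axis k 1) \<in> ccell (z - axis (oth k) 1)"
    unfolding node_ccell all_coords[of _ k] by auto
  then show "z \<in> boundary_nodes" "z + axis k 1 \<in> boundary_nodes" using one unfolding boundary_nodes_def mem_Collect_eq boundary_iff by blast+
qed

lemma step_in_boundary_nodes: "step s v w \<Longrightarrow> s \<noteq> 0 \<Longrightarrow> v \<in> boundary_nodes \<and> w \<in> boundary_nodes"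
proof -
  assume st: "step s v w" and "s \<noteq> 0"
  obtain k where "w = v + axis k 1 \<and> edge_sign v k = s \<or> v = w + axis k 1 \<and> edge_sign w k = - s"
    using st unfolding step_def by blast
  then have "w = v + axis k 1 \<and> (v, k) \<in> boundary_edges \<or> v = w + axis k 1 \<and> (w, k) \<in> boundary_edges"
    using \<open>s \<noteq> 0\<close> by (auto simp: boundary_edges_def)
  then show ?thesis using boundary_edge_ends[of v k] boundary_edge_ends[of w k] by auto
qed

text \<open>Each step runs along a boundary edge \<open>edge z k\<close>, with velocity proportional to \<open>axis k 1\<close>. The
  edge determines the node from which the step starts.\<close>
lemma step_edge:
  assumes st: "step s v w" and s: "s = 1 \<or> s = - 1"
  obtains z k c where "(z, k) \<in> boundary_edges" "v = (if edge_sign z k = s then z else z + axis k 1)"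
    "node w - node v = c *\<^sub>R axis k 1" "edge_sign z k * s * c > 0"
    "\<And>u. 0 < u \<Longrightarrow> u < 1 \<Longrightarrow> node v + u *\<^sub>R (node w - node v) \<in> edge z k"
proof -
  note diff = node_diff and in_edge = edge_param
  have pos: "g k (z $ k + 1) - g k (z $ k) > 0" for z k by simp
  obtain k where "w = v + axis k 1 \<and> edge_sign v k = s \<or> v = w + axis k 1 \<and> edge_sign w k = - s"
    using st unfolding step_def by blast
  then show thesis
  proof (elim disjE conjE)
    assume w: "w = v + axis k 1" "edge_sign v k = s"
    show thesis
    proof (rule that[of v k])
      show "edge_sign v k * s * (g k (v $ k + 1) - g k (v $ k)) > 0" using s w pos by auto
    qed (use w s diff in_edge in \<open>auto simp: boundary_edges_def\<close>)
  next
    assume w: "v = w + axis k 1" "edge_sign w k = - s"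
    show thesis
    proof (rule that[of w k])
      show "edge_sign w k * s * - (g k (w $ k + 1) - g k (w $ k)) > 0" using s w pos[of k w] by auto
      show "node w - node v = (- (g k (w $ k + 1) - g k (w $ k))) *\<^sub>R axis k 1"
        using diff[of w k] w by (metis minus_diff_eq scaleR_minus_left)
      fix u :: real assume "0 < u" "u < 1"
      then show "node v + u *\<^sub>R (node w - node v) \<in> edge w k"
        using in_edge[of "1 - u" w k] w by (simp add: algebra_simps)
    qed (use w s in \<open>auto simp: boundary_edges_def\<close>)
  qed
qed

definition succ :: "real \<Rightarrow> int ^ 2 \<Rightarrow> int ^ 2" where
  "succ s v = (THE w. step s v w)"

lemma step_succ: "v \<in> boundary_nodes \<Longrightarrow> s = 1 \<or> s = - 1 \<Longrightarrow> step s v (succ s v)"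
  unfolding succ_def by (rule theI') (rule ex1_step)

lemma succ_in_boundary_nodes: "v \<in> boundary_nodes \<Longrightarrow> s = 1 \<or> s = - 1 \<Longrightarrow> succ s v \<in> boundary_nodes"
  using step_succ step_in_boundary_nodes[of s v "succ s v"] by fastforce

lemma succ_inj: "s = 1 \<or> s = - 1 \<Longrightarrow> inj_on (succ s) boundary_nodes"
proof (rule inj_onI)
  fix u v assume s: "s = 1 \<or> s = - 1" and uv: "u \<in> boundary_nodes" "v \<in> boundary_nodes" "succ s u = succ s v"
  then have "step (- s) (succ s u) u" "step (- s) (succ s u) v" using step_succ step_sym by metis+
  moreover have "- s = 1 \<or> - s = - 1" using s by auto
  ultimately show "u = v" using ex1_step[OF succ_in_boundary_nodes[OF uv(1) s], of "- s"] by blast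
qed

definition seg :: "real \<Rightarrow> int ^ 2 \<Rightarrow> (real ^ 2) set" where
  "seg s v = closed_segment (node v) (node (succ s v))"

text \<open>The last alternative recovers \<open>v\<close> from the edge, so that different segments share no inner point.\<close>
lemma seg_cases:
  assumes "v \<in> boundary_nodes" "s = 1 \<or> s = - 1" "x \<in> seg s v"
  obtains "x = node v" | "x = node (succ s v)" | z k where "(z, k) \<in> boundary_edges" "x \<in> edge z k"
    "v = (if edge_sign z k = s then z else z + axis k 1)"
proof (cases "x = node v \<or> x = node (succ s v)")
  case False
  obtain r where r: "0 \<le> r" "r \<le> 1" "x = (1 - r) *\<^sub>R node v + r *\<^sub>R node (succ s v)"
    using assms(3) unfolding seg_def in_segment by blast
  with False have "r \<noteq> 0" "r \<noteq> 1" by auto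
  with r have r': "0 < r" "r < 1" by auto
  have x: "x = node v + r *\<^sub>R (node (succ s v) - node v)" using r by (simp add: algebra_simps)
  show thesis using step_edge[OF step_succ[OF assms(1,2)] assms(2)] that(3) x r' by metis
qed (use that in blast)

lemma boundary_eq_segs:
  assumes s: "s = 1 \<or> s = - 1"
  shows "R - interior R = (\<Union>v\<in>boundary_nodes. seg s v)"
proof
  show "R - interior R \<subseteq> (\<Union>v\<in>boundary_nodes. seg s v)"
  proof
    fix x assume x: "x \<in> R - interior R"
    then show "x \<in> (\<Union>v\<in>boundary_nodes. seg s v)"
    proof (cases rule: boundary_point_cases)
      case (1 z k)
      define v where "v = (if edge_sign z k = s then z else z + axis k 1)"
      define w where "w = (if edge_sign z k = s then z + axis k 1 else z)"
      have "edge_sign z k = s \<or> edge_sign z k = - s"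
        using 1(1) s by (auto simp: boundary_edges_def edge_sign_def)
      then have st: "step s v w" by (auto simp: step_def v_def w_def)
      have vV: "v \<in> boundary_nodes" using boundary_edge_ends[OF 1(1)] by (simp add: v_def)
      then have w: "w = succ s v" using ex1_step[OF vV s] step_succ[OF vV s] st by blast
      have "closed_segment (node v) (node w) = closed_segment (node z) (node (z + axis k 1))"
        by (auto simp: v_def w_def closed_segment_commute)
      then have "x \<in> closed_segment (node v) (node w)" using edge_subset_segment 1(2) by blast
      then show ?thesis unfolding seg_def using vV w by blast
    next
      case (2 v)
      then have "v \<in> boundary_nodes" using x by (simp add: boundary_nodes_def)
      then show ?thesis using 2 by (auto simp: seg_def)
    qed
  qed
  show "(\<Union>v\<in>boundary_nodes. seg s v) \<subseteq> R - interior R"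
  proof
    fix x assume "x \<in> (\<Union>v\<in>boundary_nodes. seg s v)"
    then obtain v where v: "v \<in> boundary_nodes" "x \<in> seg s v" by blast
    show "x \<in> R - interior R"
      by (rule seg_cases[OF v(1) s v(2)])
        (use v succ_in_boundary_nodes[OF v(1) s] edge_in_boundary in \<open>auto simp: boundary_nodes_def\<close>)
  qed
qed

end

context surface_region
begin

text \<open>The orbit of \<open>v\<close> under the successor map and its complement are both closed under successors and
  predecessors, so the segments starting in one do not meet those starting in the other.\<close>
lemma boundary_cycle:
  assumes v: "v \<in> boundary_nodes" and s: "s = 1 \<or> s = - 1"
  obtains n w where "n > 0" "w 0 = v" "w n = v" "inj_on w {..<n}" "\<And>i. w i \<in> boundary_nodes" "\<And>i. step s (w i) (w (Suc i))"
    "\<And>i. seg s (w i) = closed_segment (node (w i)) (node (w (Suc i)))"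
    "(\<Union>j<n. seg s (w j)) \<inter> (\<Union>u\<in>boundary_nodes - w ` {..<n}. seg s u) = {}"
proof -
  obtain n where n: "n > 0" "(succ s ^^ n) v = v" "inj_on (\<lambda>i. (succ s ^^ i) v) {..<n}"
    using finite_permutation_orbit[OF finite_boundary_nodes succ_inj[OF s] succ_in_boundary_nodes[OF _ s] v] by metis
  define w where "w i = (succ s ^^ i) v" for i
  have wV: "w i \<in> boundary_nodes" for i unfolding w_def using succ_in_boundary_nodes[OF _ s] v by (induction i) auto
  have wS: "w (Suc i) = succ s (w i)" for i by (simp add: w_def)
  have wn: "w n = w 0" using n(2) by (simp add: w_def)
  have winj: "inj_on w {..<n}" using n(3) by (simp add: w_def[abs_def])
  let ?O = "w ` {..<n}"
  have O1: "succ s u \<in> ?O" if u: "u \<in> ?O" for u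
  proof -
    obtain i where i: "i < n" "u = w i" using u by auto
    show ?thesis
    proof (cases "Suc i = n")
      case True
      then have "succ s u = w 0" using wS[of i] wn i by simp
      then show ?thesis using n(1) by blast
    next
      case False
      then have "Suc i < n" using i by simp
      then show ?thesis using wS[of i] i by (metis imageI lessThan_iff)
    qed
  qed
  have O2: "u \<in> ?O" if u: "u \<in> boundary_nodes" "succ s u \<in> ?O" for u
  proof -
    obtain i where i: "i < n" "succ s u = w i" using u by auto
    have "\<exists>j<n. w i = succ s (w j)"
    proof (cases i)
      case 0
      then show ?thesis using wS[of "n - 1"] wn n(1) by (intro exI[of _ "n - 1"]) auto
    next
      case (Suc j)
      then show ?thesis using i wS by (intro exI[of _ j]) auto
    qed
    then obtain j where "j < n" "succ s u = succ s (w j)" using i by auto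
    then show ?thesis using succ_inj[OF s] u(1) wV by (auto dest: inj_onD)
  qed
  have disj: False if u: "u \<in> ?O" "u' \<in> boundary_nodes - ?O" and x: "x \<in> seg s u" "x \<in> seg s u'" for u u' x
  proof -
    have uV: "u \<in> boundary_nodes" "u' \<in> boundary_nodes" using u wV by auto
    have "u' \<notin> ?O" "succ s u' \<notin> ?O" using u(2) O2[OF uV(2)] by auto
    with uV(2) x(2) have c2: "(\<exists>y. y \<notin> ?O \<and> x = node y) \<or> (\<exists>z k. x \<in> edge z k \<and> u' = (if edge_sign z k = s then z else z + axis k 1))"
      by (elim seg_cases[OF _ s]) blast+
    have "u \<in> ?O" "succ s u \<in> ?O" using u(1) O1 by blast+
    with uV(1) x(1) have c1: "(\<exists>y\<in>?O. x = node y) \<or> (\<exists>z k. x \<in> edge z k \<and> u = (if edge_sign z k = s then z else z + axis k 1))"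
      by (elim seg_cases[OF _ s]) blast+
    from c1 show False
    proof (elim disjE bexE exE conjE)
      fix y assume y: "y \<in> ?O" "x = node y"
      from c2 show False using y node_not_edge by auto
    next
      fix z k assume zk: "x \<in> edge z k" "u = (if edge_sign z k = s then z else z + axis k 1)"
      from c2 show False
      proof (elim disjE exE conjE)
        fix y assume "x = node y"
        then show False using zk(1) node_not_edge by simp
      next
        fix z' k' assume zk': "x \<in> edge z' k'" "u' = (if edge_sign z' k' = s then z' else z' + axis k' 1)"
        have "u = u'" using edge_unique[OF zk(1) zk'(1)] zk(2) zk'(2) by simp
        then show False using u by blast
      qed
    qed
  qed
  show thesis
  proof (rule that[of n w])
    show "step s (w i) (w (Suc i))" for i unfolding wS by (rule step_succ[OF wV s])
    show "(\<Union>j<n. seg s (w j)) \<inter> (\<Union>u\<in>boundary_nodes - w ` {..<n}. seg s u) = {}"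
      using disj by blast
  qed (use n winj wV wn wS in \<open>auto simp: w_def seg_def\<close>)
qed

end

context C2_image
begin

text \<open>If \<open>s\<close> is the sign of the Jacobian along the cycle, then the image of the cycle under \<open>H\<close>
  has \<open>S\<close> on its left: the cycle itself has \<open>R\<close> on its left for \<open>s = 1\<close> and on its right
  for \<open>s = - 1\<close>.\<close>
lemma cycle_parametrization:
  assumes s: "s = 1 \<or> s = - 1" and n: "n > 0" and wn: "w n = w 0" and inj: "inj_on w {..<n}"
    and st: "\<And>i. step s (w i) (w (Suc i))"
    and sgn: "\<And>x. x \<in> (\<Union>j<n. closed_segment (node (w j)) (node (w (Suc j)))) \<Longrightarrow> x \<in> R \<and> sgn (jac x) = s"
  shows "oriented_parametrization S (H ` (\<Union>j<n. closed_segment (node (w j)) (node (w (Suc j))))) 0 (real n)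
           (\<lambda>t. H (polygon_path (\<lambda>i. node (w i)) t))"
proof -
  define \<gamma> where "\<gamma> = polygon_path (\<lambda>i. node (w i))"
  define \<phi> where "\<phi> t = H (\<gamma> t)" for t
  define d where "d j = node (w (Suc j)) - node (w j)" for j
  let ?A = "\<Union>j<n. closed_segment (node (w j)) (node (w (Suc j)))"
  have im: "\<gamma> ` {0..real n} = ?A"
    unfolding \<gamma>_def by (rule polygon_path_image[OF n])
  have \<gamma>R: "\<gamma> t \<in> R" "sgn (jac (\<gamma> t)) = s" if "t \<in> {0..real n}" for t
    using sgn[of "\<gamma> t"] im that by blast+
  have \<gamma>cont: "continuous_on {0..real n} \<gamma>"
    unfolding \<gamma>_def by (rule polygon_path_continuous)
  have "\<exists>z k c. (z, k) \<in> boundary_edges \<and> w i = (if edge_sign z k = s then z else z + axis k 1) \<and>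
      d i = c *\<^sub>R axis k 1 \<and> edge_sign z k * s * c > 0 \<and>
      (\<forall>u. 0 < u \<and> u < 1 \<longrightarrow> node (w i) + u *\<^sub>R d i \<in> edge z k)" for i
    using step_edge[OF st[of i] s] unfolding d_def by metis
  then obtain z k c where e: "\<And>i. (z i, k i) \<in> boundary_edges"
    "\<And>i. w i = (if edge_sign (z i) (k i) = s then z i else z i + axis (k i) 1)"
    "\<And>i. d i = c i *\<^sub>R axis (k i) 1" "\<And>i. edge_sign (z i) (k i) * s * c i > 0"
    "\<And>i u. 0 < u \<Longrightarrow> u < 1 \<Longrightarrow> node (w i) + u *\<^sub>R d i \<in> edge (z i) (k i)"
    by metis
  have \<gamma>edge: "\<gamma> t \<in> edge (z j) (k j)" if "real j < t" "t < real j + 1" for j t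
    using polygon_path_eq[of j t "\<lambda>i. node (w i)"] e(5)[of "smooth_step (t - real j)" j] smooth_step_bounds[of "t - real j"] that
    by (simp add: \<gamma>_def d_def)
  define r where "r j t = 6 * (t - real j) * (1 - (t - real j))" for j t
  have \<gamma>der: "(\<gamma> has_vector_derivative r j t *\<^sub>R d j) (at t within {real j..real j + 1})" if "t \<in> {real j..real j + 1}" for j t
    using polygon_path_derivative[OF that, of "\<lambda>i. node (w i)"] by (simp add: \<gamma>_def d_def r_def)
  have \<phi>der: "(\<phi> has_vector_derivative (r j t * c j) *\<^sub>R DH (k j) (\<gamma> t)) (at t within {real j..real j + 1})"
    if j: "j < n" and t: "t \<in> {real j..real j + 1}" for j t
  proof -
    have sub: "{real j..real j + 1} \<subseteq> {0..real n}" using j by auto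
    have "(H has_derivative (\<lambda>h. jacobian R H (\<gamma> t) *v h)) (at (\<gamma> t) within \<gamma> ` {real j..real j + 1})"
      by (rule has_derivative_subset[OF H_derivative]) (use sub t \<gamma>R in auto)
    from vector_derivative_diff_chain_within[OF \<gamma>der[OF t] this]
    show ?thesis by (simp add: \<phi>_def[abs_def] o_def e(3) J_mult[of _ _ "k j"])
  qed
  have \<phi>der_at: "(\<phi> has_vector_derivative (r j t * c j) *\<^sub>R DH (k j) (\<gamma> t)) (at t)"
    if "j < n" "real j < t" "t < real j + 1" for j t
    using \<phi>der[of j t] that at_within_interior[of t "{real j..real j + 1}"] by simp
  have index: "\<exists>j<n. real j < t \<and> t < real j + 1" if "t \<in> {0..real n} - real ` {..n}" for t
  proof -
    have "t \<noteq> real n" "0 \<le> t" "t < real n" using that by force+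
    then obtain j where "j < n" "real j \<le> t" "t < real j + 1" using unit_interval_index by metis
    moreover have "t \<noteq> real j" using that \<open>j < n\<close> by auto
    ultimately show ?thesis by force
  qed
  have "oriented_parametrization S (H ` ?A) 0 (real n) \<phi>"
    unfolding oriented_parametrization_def
  proof (intro conjI)
    show "0 < real n" using n by simp
    show "\<phi> 0 = \<phi> (real n)"
      using polygon_path_eq[of 0 0 "\<lambda>i. node (w i)"] polygon_path_eq[of n "real n" "\<lambda>i. node (w i)"] wn
      by (simp add: \<phi>_def \<gamma>_def)
    have \<phi>cont: "continuous_on {0..real n} \<phi>"
      unfolding \<phi>_def by (rule continuous_on_compose2[OF cont_H \<gamma>cont]) (use \<gamma>R in auto)
    show "\<phi> piecewise_C1_differentiable_on {0..real n}"
      unfolding piecewise_C1_differentiable_on_def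
    proof (intro conjI exI[of _ "real ` {..n}"])
      define D where "D t = (r (nat \<lfloor>t\<rfloor>) t * c (nat \<lfloor>t\<rfloor>)) *\<^sub>R DH (k (nat \<lfloor>t\<rfloor>)) (\<gamma> t)" for t
      have fl: "nat \<lfloor>t\<rfloor> = j" if "real j < t" "t < real j + 1" for j t
      proof -
        have "\<lfloor>t\<rfloor> = int j" using that by (simp add: floor_eq_iff)
        then show ?thesis by simp
      qed
      have "continuous_on (\<Union>j<n. {real j<..<real j + 1}) D"
      proof (rule continuous_on_open_UN)
        fix j assume j: "j \<in> {..<n}"
        have "continuous_on {real j<..<real j + 1} (\<lambda>t. (r j t * c j) *\<^sub>R DH (k j) (\<gamma> t))"
        proof (intro continuous_intros)
          show "continuous_on {real j<..<real j + 1} (r j)" unfolding r_def by (intro continuous_intros)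
          have sub: "{real j<..<real j + 1} \<subseteq> {0..real n}" using j by auto
          show "continuous_on {real j<..<real j + 1} (\<lambda>t. DH (k j) (\<gamma> t))"
            by (rule continuous_on_compose2[OF DH_cont continuous_on_subset[OF \<gamma>cont sub]]) (use \<gamma>R sub in blast)
        qed
        then show "continuous_on {real j<..<real j + 1} D"
        proof (rule continuous_on_eq)
          fix t assume "t \<in> {real j<..<real j + 1}"
          then have "nat \<lfloor>t\<rfloor> = j" by (intro fl) auto
          then show "(r j t * c j) *\<^sub>R DH (k j) (\<gamma> t) = D t" by (simp add: D_def)
        qed
      qed simp
      then have "continuous_on ({0..real n} - real ` {..n}) D"
        by (rule continuous_on_subset) (use index in force)
      moreover have "(\<phi> has_vector_derivative D t) (at t)" if t: "t \<in> {0..real n} - real ` {..n}" for t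
      proof -
        obtain j where j: "j < n" "real j < t" "t < real j + 1" using index[OF t] by blast
        then show ?thesis using \<phi>der_at[OF j] fl[OF j(2,3)] by (simp add: D_def)
      qed
      ultimately show "\<phi> C1_differentiable_on ({0..real n} - real ` {..n})"
        unfolding C1_differentiable_on_def by blast
    qed (use \<phi>cont in auto)
    show "\<phi> ` {0..real n} = H ` ?A" unfolding \<phi>_def im[symmetric] by (simp add: image_image)
    have "inj_on \<gamma> {0..<real n}"
      unfolding \<gamma>_def
    proof (rule polygon_path_inj)
      show "inj_on (\<lambda>i. node (w i)) {..<n}" using inj by (auto simp: inj_on_def)
      show "node (w i) + u *\<^sub>R (node (w (Suc i)) - node (w i)) \<noteq> node (w j)"
        if "0 < u" "u < 1" for i j and u :: real
        using e(5)[of u i] that node_not_edge by (metis d_def)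
      show "node (w (Suc i)) \<noteq> node (w i)" for i
        using e(3,4)[of i] by (auto simp: d_def)
      fix i j :: nat and u r :: real
      assume ij: "i < n" "j < n" "i \<noteq> j" and ur: "0 < u" "u < 1" "0 < r" "r < 1"
      show "node (w i) + u *\<^sub>R (node (w (Suc i)) - node (w i)) \<noteq> node (w j) + r *\<^sub>R (node (w (Suc j)) - node (w j))"
      proof
        assume eq: "node (w i) + u *\<^sub>R (node (w (Suc i)) - node (w i)) = node (w j) + r *\<^sub>R (node (w (Suc j)) - node (w j))"
        have "z i = z j" "k i = k j"
          using edge_unique[OF e(5)[OF ur(1,2), of i], of "z j" "k j"] e(5)[OF ur(3,4), of j] eq by (simp_all add: d_def)
        then have "w i = w j" using e(2)[of i] e(2)[of j] by simp
        then show False using inj ij by (auto simp: inj_on_def)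
      qed
    qed
    then show "inj_on \<phi> {0..<real n}"
      unfolding \<phi>_def using H_inj \<gamma>R(1) by (auto simp: inj_on_def)
    show "on_left S 0 (real n) \<phi>"
      unfolding on_left_def
    proof (intro ballI allI impI)
      fix t v assume t: "t \<in> {0<..<real n}" and v: "(\<phi> has_vector_derivative v) (at t) \<and> v \<noteq> 0"
      then obtain j where j: "j < n" "real j \<le> t" "t < real j + 1" using unit_interval_index[of t n] by auto
      have t': "t \<in> {real j..real j + 1}" using j by auto
      have "(\<phi> has_vector_derivative v) (at t within {real j..real j + 1})"
        using v has_vector_derivative_at_within by blast
      then have v_eq: "v = (r j t * c j) *\<^sub>R DH (k j) (\<gamma> t)"
        using \<phi>der[OF j(1) t'] t' vector_derivative_unique_within_closed_interval[of "real j" "real j + 1" t \<phi>] by auto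
      \<comment> \<open>At the vertices the path is at rest.\<close>
      then have "t \<noteq> real j" using v by (auto simp: r_def)
      then have tj: "real j < t" "t < real j + 1" using j by auto
      have rpos: "r j t > 0" using tj by (simp add: r_def)
      have tn: "t \<in> {0..real n}" using t by auto
      have "edge_sign (z j) (k j) * s * c j * r j t > 0" using e(4)[of j] rpos by (rule mult_pos_pos)
      then have "edge_sign (z j) (k j) * sgn (jac (\<gamma> t)) * (r j t * c j) > 0"
        using \<gamma>R(2)[OF tn] by (simp add: mult_ac)
      moreover have "edge_sign (z j) (k j) \<noteq> 0" using e(1)[of j] by (simp add: boundary_edges_def)
      ultimately show "\<exists>\<epsilon>>0. \<forall>s\<in>{0<..<\<epsilon>}. \<phi> t + s *\<^sub>R left_normal v \<in> S \<and> \<phi> t - s *\<^sub>R left_normal v \<notin> S"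
        using sign_imp_left[OF \<gamma>edge[OF tj]] unfolding v_eq \<phi>_def by blast
    qed
  qed
  then show ?thesis by (simp add: \<phi>_def[abs_def] \<gamma>_def)
qed

text \<open>A cycle and the rest of the boundary are disjoint compact sets, and the cycle is connected; so its image is
  a whole component.\<close>
lemma component_parametrization:
  assumes C: "C \<in> components (surface_boundary S)"
  shows "\<exists>v\<in>boundary_nodes. H (node v) \<in> C" and "\<exists>a b \<phi>. oriented_parametrization S C a b \<phi>"
proof -
  obtain y where y: "y \<in> C" using C in_components_nonempty by blast
  have CS: "C \<subseteq> surface_boundary S" using C in_components_subset by blast
  define x where "x = K y"
  have x: "x \<in> R - interior R" "H x = y"
    using y CS K_boundary[of y] by (auto simp: x_def surface_boundary_eq)
  \<comment> \<open>The cycle through \<open>x\<close> is to have \<open>R\<close> on its left or right according to this sign.\<close>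
  define s where "s = sgn (jac x)"
  have s: "s = 1 \<or> s = - 1" using jac_nonzero[of x] x(1) by (auto simp: s_def sgn_if)
  obtain v where v: "v \<in> boundary_nodes" "x \<in> seg s v" using x(1) boundary_eq_segs[OF s] by blast
  obtain n w where w: "n > 0" "w 0 = v" "w n = v" "inj_on w {..<n}" "\<And>i. w i \<in> boundary_nodes" "\<And>i. step s (w i) (w (Suc i))"
    "\<And>i. seg s (w i) = closed_segment (node (w i)) (node (w (Suc i)))"
    "(\<Union>j<n. seg s (w j)) \<inter> (\<Union>u\<in>boundary_nodes - w ` {..<n}. seg s u) = {}"
    using boundary_cycle[OF v(1) s] by metis
  define A where "A = (\<Union>j<n. closed_segment (node (w j)) (node (w (Suc j))))"
  define B where "B = (\<Union>u\<in>boundary_nodes - w ` {..<n}. seg s u)"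
  have A_eq: "A = (\<Union>j<n. seg s (w j))" by (simp add: A_def w(7))
  have AB: "A \<inter> B = {}" using w(8) unfolding A_eq B_def .
  have bd: "R - interior R = A \<union> B"
    unfolding boundary_eq_segs[OF s] A_eq B_def using w(5) by auto
  have "connected (polygon_path (\<lambda>i. node (w i)) ` {0..real n})"
    by (intro connected_continuous_image polygon_path_continuous) simp
  then have conA: "connected A" unfolding A_def polygon_path_image[OF w(1)] .
  have xA: "x \<in> A" using v(2) w(1,2) unfolding A_eq by blast
  have sgnA: "a \<in> R \<and> sgn (jac a) = s" if "a \<in> A" for a
    using that sgn_jac_const[OF conA _ that xA] bd by (auto simp: s_def)
  have compact: "compact A" "compact B"
    unfolding A_def B_def seg_def using finite_boundary_nodes by (auto intro!: compact_UN)
  have HAC: "H ` A \<subseteq> C"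
  proof (rule components_maximal[OF C])
    show "connected (H ` A)"
      by (rule connected_continuous_image[OF continuous_on_subset[OF cont_H] conA]) (use sgnA in auto)
    show "H ` A \<subseteq> surface_boundary S" unfolding boundary_S bd by auto
    show "C \<inter> H ` A \<noteq> {}" using xA x(2) y by blast
  qed
  have "C \<subseteq> H ` A"
  proof -
    have closed: "closed (H ` A)" "closed (H ` B)"
      using bd by (auto intro!: compact_imp_closed compact_continuous_image continuous_on_subset[OF cont_H] compact)
    have sub: "C \<subseteq> H ` A \<union> H ` B" using CS unfolding boundary_S bd by auto
    have "H ` A \<inter> H ` B \<inter> C = {}"
      using AB bd inj_on_image_Int[OF H_inj, of A B] by auto
    then have "H ` A \<inter> C = {} \<or> H ` B \<inter> C = {}"
      using connected_closedD[OF in_components_connected[OF C] _ sub closed] by blast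
    moreover have "H ` A \<inter> C \<noteq> {}" using xA x(2) y by blast
    ultimately have "H ` B \<inter> C = {}" by blast
    then show ?thesis using \<open>C \<subseteq> H ` A \<union> H ` B\<close> by blast
  qed
  with HAC have C_eq: "C = H ` A" by blast
  have "node v \<in> A" using w(1,2) unfolding A_def by (auto intro!: bexI[of _ 0])
  then show "\<exists>v\<in>boundary_nodes. H (node v) \<in> C" using v(1) C_eq by blast
  have "oriented_parametrization S (H ` A) 0 (real n) (\<lambda>t. H (polygon_path (\<lambda>i. node (w i)) t))"
    unfolding A_def by (rule cycle_parametrization[OF s w(1) _ w(4,6)]) (use w(2,3) sgnA in \<open>auto simp: A_def\<close>)
  then show "\<exists>a b \<phi>. oriented_parametrization S C a b \<phi>" unfolding C_eq by blast
qed

lemma finite_components: "finite (components (surface_boundary S))"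
proof (rule finite_subset)
  show "components (surface_boundary S) \<subseteq> (\<lambda>v. connected_component_set (surface_boundary S) (H (node v))) ` boundary_nodes"
  proof
    fix C assume C: "C \<in> components (surface_boundary S)"
    then obtain v where v: "v \<in> boundary_nodes" "H (node v) \<in> C" using component_parametrization(1) by blast
    then have "connected_component_set (surface_boundary S) (H (node v)) = C"
      using C by (metis components_iff connected_component_eq)
    then show "C \<in> (\<lambda>v. connected_component_set (surface_boundary S) (H (node v))) ` boundary_nodes" using v(1) by blast
  qed
qed (use finite_boundary_nodes in simp)

theorem green_formula: "scurl S F integrable_on S \<and> has_boundary_integral S F (integral S (scurl S F))"
  unfolding has_boundary_integral_def
  using scurl_has_integral finite_components component_parametrization(2) sum_line_integrals by blast

end

theorem corollary2p10:
  fixes R S :: "(real ^ 2) set" and H F :: "real ^ 2 \<Rightarrow> real ^ 2"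
  assumes "surface_with_boundary R" and "compact R" and "rectilinear_boundary R"
    and "surface_with_boundary S" and "diffeomorphism R S H"
    and "C1_vector_field S F"
  shows "scurl S F integrable_on S \<and> has_boundary_integral S F (integral S (scurl S F))"
proof -
  obtain g Z where "surface_region g Z R" using surface_region_exists[OF assms(1-3)] .
  then interpret surface_region g Z R .
  interpret C2_image g Z R S H F
    using assms by unfold_locales (auto simp: diffeomorphism_def)
  show ?thesis by (rule green_formula)
qed

end
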